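(* Let $n\in\mathbb{N}$. For all zigzag modules $\mathbb{V},\mathbb{W}\in n\text{-Mod}$ we have $$d_b^1(\mathrm{Dgm}(\mathbb{V}),\mathrm{Dgm}(\mathbb{W}))\le d_{\mathcal{R}}^1(\mathbb{V},\mathbb{W}),$$ where $d_b^1$ is the $\ell^1$-bottleneck distance and $d_{\mathcal{R}}^1$ is the $1$-reflection distance.
   Context: **Zigzag modules.** Fix a field $\mathbb{F}$ and $n\in\mathbb{N}$; all vector spaces are finite dimensional over $\mathbb{F}$. A zigzag module of length $n$, $\mathbb{V}=(V_i,p_i)$, consists of vector spaces $V_1,\dots,V_n$ and, for each $1\le i\le n-1$, one linear map $p_i$ (structure map) which is either forward, $V_i\to V_{i+1}$, or backward, $V_{i+1}\to V_i$. The type of $\mathbb{V}$ is the sequence $\tau\in\mathcal{T}_n:=\{\rightarrow,\leftarrow\}^{n-1}$ of directions of $p_1,\dots,p_{n-1}$. $n\text{-Mod}$ is the collection of zigzag modules of length $n$; $\mathrm{Mod}_\tau$ those of type $\tau$. Morphisms in $\mathrm{Mod}_\tau$ are families of linear maps $V_i\to W_i$ commuting with structure maps; an isomorphism has all components bijective; direct sums are componentwise. For $\mathbb{V},\mathbb{W}\in\mathrm{Mod}_\tau$, $\mathbb{W}\preceq\mathbb{V}$ means $\mathbb{V}\cong\mathbb{W}\oplus\mathbb{U}$ for some $\mathbb{U}\in\mathrm{Mod}_\tau$. For $1\le b\le d\le n$, the interval module $\mathbb{I}_\tau([b,d])\in\mathrm{Mod}_\tau$ has $\mathbb{F}$ at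 indices $b\le i\le d$ and $0$ elsewhere, with $p_i=\mathrm{id}$ for $b\le i<d$ and $p_i=0$ otherwise; it is simple if $b=d$. Every $\mathbb{V}\in\mathrm{Mod}_\tau$ is a finite direct sum $\bigoplus_{i=1}^N\mathbb{I}_\tau([b_i,d_i])$, uniquely up to order (Krull–Remak–Schmidt, Gabriel); $\mathrm{Dgm}(\mathbb{V})$ is the multiset of the pairs $(b_i,d_i)$. **Equivalence.** If $p_k$ is an isomorphism, $\mathcal{A}_k(\mathbb{V})$ is obtained from $\mathbb{V}$ by replacing $p_k$ with $p_k^{-1}$ (reversing the $k$-th arrow). $\mathbb{V}\sim\mathbb{W}$ means $\mathbb{W}$ is isomorphic to a module obtained from $\mathbb{V}$ by a finite (possibly empty) sequence of such reversals. $\mathbb{W}\precsim\mathbb{V}$ means there is $\mathbb{W}'$ with $\mathbb{W}\sim\mathbb{W}'\preceq\mathbb{V}$. **Reflection functors.** For $2\le k\le n-1$: $\mathcal{L}_k(\mathbb{V})$ is obtained by replacing the part $V_{k-1}\leftrightarrow V_k\leftrightarrow V_{k+1}$ of $\mathbb{V}$ with $V_{k-1}\leftarrow L\to V_{k+1}$, where $L$ is the limit of that part and the maps are the limit projections; $\mathcal{C}_k(\mathbb{V})$ is obtained by replacing it with $V_{k-1}\to C\leftarrow V_{k+1}$, where $C$ is its colimit with the colimit maps. At index $1$: $\mathcal{L}_1^{\rightarrow}$ (resp. $\mathcal{L}_1^{\leftarrow}$) replaces $V_1$ and $p_1$ with $L\to V_2$, where $L$ is the limit of $0\to V_1\leftrightarrow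 V_2$ (resp. $0\leftarrow V_1\leftrightarrow V_2$); $\mathcal{C}_1^{\rightarrow},\mathcal{C}_1^{\leftarrow}$ replace them with $C\leftarrow V_2$, $C$ the colimit of the same respective diagrams. At index $n$: $\mathcal{L}_n^{\rightarrow},\mathcal{L}_n^{\leftarrow},\mathcal{C}_n^{\rightarrow},\mathcal{C}_n^{\leftarrow}$ are defined analogously using $V_{n-1}\leftrightarrow V_n\to 0$ (for $\rightarrow$) and $V_{n-1}\leftrightarrow V_n\leftarrow 0$ (for $\leftarrow$). $\mathcal{R}_k$ denotes any one of the reflection functors at index $k$. **Reflection distance.** $\mathcal{S}(\mathbb{V})$ is $\mathbb{V}$ with all simple interval summands removed: $\mathcal{S}(\mathbb{V})=\bigoplus_{(b,d)\in\mathrm{Dgm}(\mathbb{V}),\,b\ne d}\mathbb{I}([b,d])$ (zero module if there are no such summands). For a finite sequence $\mathfrak{R}=(\mathcal{R}_{k_\ell},\dots,\mathcal{R}_{k_1})$ of reflection functors, $1\le k_i\le n$, set $\mathfrak{R}(\mathbb{V})=(\mathcal{S}\circ\mathcal{R}_{k_\ell}\circ\mathcal{S}\circ\cdots\circ\mathcal{S}\circ\mathcal{R}_{k_1}\circ\mathcal{S})(\mathbb{V})$; for the empty sequence $\varepsilon$, $\varepsilon(\mathbb{V})=\mathcal{S}(\mathbb{V})$. For $p\in[1,\infty)$, $C_p(\mathfrak{R})=\ell^{1/p}$ for a nonempty sequence of length $\ell$, $C_p(\varepsilon)=0$. The $p$-reflection distance is $$d_{\mathcal{R}}^p(\mathbb{V},\mathbb{W})=\min_{(\mathfrak{R},\mathfrak{R}')}\big\{\max\{C_p(\mathfrak{R}),C_p(\mathfrak{R}')\}\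 \big|\ \mathfrak{R}(\mathbb{V})\precsim\mathbb{W},\ \mathfrak{R}'(\mathbb{W})\precsim\mathbb{V}\big\}$$ over pairs of finite sequences of reflection functors. **Bottleneck distance.** A matching $M:S\nrightarrow T$ between multisets is a bijection between a sub-multiset of $S$ and a sub-multiset of $T$ (copies of a point are treated as distinct); elements not involved are unmatched. For multisets $S,T$ of points of $\mathbb{R}^2$ and $p\in[1,\infty]$ ($1/\infty=0$), $$c_p(M)=\max\Big\{\max_{(s,t)\in M}\|s-t\|_p,\ \max_{r\in S\sqcup T\text{ unmatched}}\frac{|r_y-r_x|}{2^{1-1/p}}\Big\},\qquad d_b^p(S,T)=\inf_{M:S\nrightarrow T}c_p(M),$$ where $r=(r_x,r_y)$ and maxima over empty sets are $0$. *)

theory Defs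
  imports
    Complex_Main
    "HOL-Library.Multiset"
    "HOL-Library.Extended_Real"
    "HOL-Library.Product_Plus"
    "HOL-Library.Function_Algebras"
begin

section \<open>Zigzag modules\<close>

datatype direction = Forward | Backward

text \<open>
  The field is a type of class \<^class>\<open>field\<close>.  The vector spaces of a zigzag module are
  finite-dimensional subspaces of an ambient vector space, given by a type \<open>'v\<close> of vectors and
  a scalar multiplication on it (of arbitrary dimension).  This is no restriction: a family of
  vector spaces embeds into its direct sum.  Structure maps only matter on their source space, and
  all fields only matter at indices in range (\<open>{1..n}\<close> for spaces, \<open>{1..<n}\<close> for arrows).
\<close>

record ('a, 'v) zigzag =
  zz_scale :: "'a \<Rightarrow> 'v \<Rightarrow> 'v"
  zz_space :: "nat \<Rightarrow> 'v set"
  zz_dir :: "nat \<Rightarrow> direction"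
  zz_map :: "nat \<Rightarrow> 'v \<Rightarrow> 'v"

definition fd_subspace :: "('a::field \<Rightarrow> 'v::ab_group_add \<Rightarrow> 'v) \<Rightarrow> 'v set \<Rightarrow> bool" where
  "fd_subspace s A \<longleftrightarrow> module.subspace s A \<and> (\<exists>B. finite B \<and> module.span s B = A)"

definition linear_between ::
  "('a::field \<Rightarrow> 'v::ab_group_add \<Rightarrow> 'v) \<Rightarrow> 'v set \<Rightarrow>
   ('a \<Rightarrow> 'w::ab_group_add \<Rightarrow> 'w) \<Rightarrow> 'w set \<Rightarrow> ('v \<Rightarrow> 'w) \<Rightarrow> bool" where
  "linear_between s A t B f \<longleftrightarrow>
     f ` A \<subseteq> B \<and> (\<forall>x\<in>A. \<forall>y\<in>A. f (x + y) = f x + f y) \<and> (\<forall>c. \<forall>x\<in>A. f (s c x) = t c (f x))"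

definition zz_source :: "('a, 'v) zigzag \<Rightarrow> nat \<Rightarrow> 'v set" where
  "zz_source V i = (case zz_dir V i of Forward \<Rightarrow> zz_space V i | Backward \<Rightarrow> zz_space V (i + 1))"

definition zz_target :: "('a, 'v) zigzag \<Rightarrow> nat \<Rightarrow> 'v set" where
  "zz_target V i = (case zz_dir V i of Forward \<Rightarrow> zz_space V (i + 1) | Backward \<Rightarrow> zz_space V i)"

definition zigzag_module :: "nat \<Rightarrow> ('a::field, 'v::ab_group_add) zigzag \<Rightarrow> bool" where
  "zigzag_module n V \<longleftrightarrow>
     vector_space (zz_scale V) \<and>
     (\<forall>i\<in>{1..n}. fd_subspace (zz_scale V) (zz_space V i)) \<and>
     (\<forall>i\<in>{1..<n}. linear_between (zz_scale V) (zz_source V i) (zz_scale V) (zz_target V i) (zz_map V i))"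

definition same_type :: "nat \<Rightarrow> ('a, 'v) zigzag \<Rightarrow> ('a, 'w) zigzag \<Rightarrow> bool" where
  "same_type n V W \<longleftrightarrow> (\<forall>i\<in>{1..<n}. zz_dir V i = zz_dir W i)"

definition zz_morphism ::
  "nat \<Rightarrow> ('a::field, 'v::ab_group_add) zigzag \<Rightarrow> ('a, 'w::ab_group_add) zigzag \<Rightarrow>
   (nat \<Rightarrow> 'v \<Rightarrow> 'w) \<Rightarrow> bool" where
  "zz_morphism n V W f \<longleftrightarrow>
     same_type n V W \<and>
     (\<forall>i\<in>{1..n}. linear_between (zz_scale V) (zz_space V i) (zz_scale W) (zz_space W i) (f i)) \<and>
     (\<forall>i\<in>{1..<n}. case zz_dir V i of
        Forward \<Rightarrow> \<forall>x\<in>zz_space V i. f (i + 1) (zz_map V i x) = zz_map W i (f i x)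
      | Backward \<Rightarrow> \<forall>x\<in>zz_space V (i + 1). f i (zz_map V i x) = zz_map W i (f (i + 1) x))"

definition zz_iso ::
  "nat \<Rightarrow> ('a::field, 'v::ab_group_add) zigzag \<Rightarrow> ('a, 'w::ab_group_add) zigzag \<Rightarrow> bool" where
  "zz_iso n V W \<longleftrightarrow>
     (\<exists>f. zz_morphism n V W f \<and> (\<forall>i\<in>{1..n}. bij_betw (f i) (zz_space V i) (zz_space W i)))"

text \<open>Direct sums are only formed of modules of the same type, so the directions of either
  summand can be taken.\<close>

definition zz_sum ::
  "('a, 'v) zigzag \<Rightarrow> ('a, 'w) zigzag \<Rightarrow> ('a, 'v \<times> 'w) zigzag" where
  "zz_sum V W = \<lparr>
     zz_scale = (\<lambda>c (x, y). (zz_scale V c x, zz_scale W c y)),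
     zz_space = (\<lambda>i. zz_space V i \<times> zz_space W i),
     zz_dir = zz_dir V,
     zz_map = (\<lambda>i. map_prod (zz_map V i) (zz_map W i)) \<rparr>"

text \<open>The direct sum of a family of modules of type \<open>\<tau>\<close> over a finite index set \<open>J\<close>.\<close>

definition zz_family_sum ::
  "(nat \<Rightarrow> direction) \<Rightarrow> 'j set \<Rightarrow> ('j \<Rightarrow> ('a, 'v::zero) zigzag) \<Rightarrow> ('a, 'j \<Rightarrow> 'v) zigzag" where
  "zz_family_sum \<tau> J M = \<lparr>
     zz_scale = (\<lambda>c x j. zz_scale (M j) c (x j)),
     zz_space = (\<lambda>i. {x. (\<forall>j\<in>J. x j \<in> zz_space (M j) i) \<and> (\<forall>j. j \<notin> J \<longrightarrow> x j = 0)}),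
     zz_dir = \<tau>,
     zz_map = (\<lambda>i x j. if j \<in> J then zz_map (M j) i (x j) else 0) \<rparr>"

definition summand ::
  "nat \<Rightarrow> ('a::field, 'w::ab_group_add) zigzag \<Rightarrow> ('a, 'v::ab_group_add) zigzag \<Rightarrow> bool" where
  \<comment> \<open>The complement is isomorphic to a submodule of \<open>V\<close>, so it may be taken over the same
      type of vectors as \<open>V\<close>.\<close>
  "summand n W V \<longleftrightarrow>
     (\<exists>U :: ('a, 'v) zigzag. zigzag_module n U \<and> same_type n W U \<and> zz_iso n V (zz_sum W U))"


section \<open>Interval modules and persistence diagrams\<close>

definition interval_module :: "(nat \<Rightarrow> direction) \<Rightarrow> nat \<times> nat \<Rightarrow> ('a::field, 'a) zigzag" where
  "interval_module \<tau> = (\<lambda>(b, d). \<lparr>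
     zz_scale = (*),
     zz_space = (\<lambda>i. if b \<le> i \<and> i \<le> d then UNIV else {0}),
     zz_dir = \<tau>,
     zz_map = (\<lambda>i. if b \<le> i \<and> i < d then id else (\<lambda>_. 0)) \<rparr>)"

text \<open>A multiset of intervals is indexed by numbering the copies of each of its elements.\<close>

type_synonym 'a univ = "(nat \<times> nat) \<times> nat \<Rightarrow> 'a"

definition interval_sum ::
  "(nat \<Rightarrow> direction) \<Rightarrow> (nat \<times> nat) multiset \<Rightarrow> ('a::field, 'a univ) zigzag" where
  "interval_sum \<tau> D = zz_family_sum \<tau> {(x, j). j < count D x} (\<lambda>(x, j). interval_module \<tau> x)"

definition dgm :: "nat \<Rightarrow> ('a::field, 'v::ab_group_add) zigzag \<Rightarrow> (nat \<times> nat) multiset" where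
  "dgm n V = (THE D. (\<forall>(b, d)\<in>#D. 1 \<le> b \<and> b \<le> d \<and> d \<le> n) \<and>
                     zz_iso n V (interval_sum (zz_dir V) D :: ('a, 'a univ) zigzag))"

definition remove_simples ::
  "nat \<Rightarrow> ('a::field, 'v::ab_group_add) zigzag \<Rightarrow> ('a, 'a univ) zigzag" where
  "remove_simples n V = interval_sum (zz_dir V) (filter_mset (\<lambda>(b, d). b \<noteq> d) (dgm n V))"


section \<open>Equivalence by arrow reversals\<close>

definition reverse_arrow :: "nat \<Rightarrow> ('a, 'v) zigzag \<Rightarrow> ('a, 'v) zigzag" where
  "reverse_arrow k V = V\<lparr>
     zz_dir := (zz_dir V)(k := case zz_dir V k of Forward \<Rightarrow> Backward | Backward \<Rightarrow> Forward),
     zz_map := (zz_map V)(k := inv_into (zz_source V k) (zz_map V k)) \<rparr>"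

inductive arrow_reversals :: "nat \<Rightarrow> ('a, 'v) zigzag \<Rightarrow> ('a, 'v) zigzag \<Rightarrow> bool" for n V where
  refl: "arrow_reversals n V V"
| step: "\<lbrakk> arrow_reversals n V V'; 1 \<le> k; k < n;
           bij_betw (zz_map V' k) (zz_source V' k) (zz_target V' k) \<rbrakk>
         \<Longrightarrow> arrow_reversals n V (reverse_arrow k V')"

definition zz_equiv ::
  "nat \<Rightarrow> ('a::field, 'v::ab_group_add) zigzag \<Rightarrow> ('a, 'w::ab_group_add) zigzag \<Rightarrow> bool" where
  "zz_equiv n V W \<longleftrightarrow> (\<exists>V'. arrow_reversals n V V' \<and> zz_iso n V' W)"

definition sub_equiv ::
  "nat \<Rightarrow> ('a::field, 'w::ab_group_add) zigzag \<Rightarrow> ('a, 'v::ab_group_add) zigzag \<Rightarrow> bool" where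
  \<comment> \<open>\<open>W'\<close> matters only up to isomorphism, and every module equivalent to \<open>W\<close> has an isomorphic
      copy over the type of vectors of \<open>W\<close>.\<close>
  "sub_equiv n W V \<longleftrightarrow>
     (\<exists>W' :: ('a, 'w) zigzag. zigzag_module n W' \<and> zz_equiv n W W' \<and> summand n W' V)"


section \<open>Reflection functors\<close>

text \<open>
  Cones over (cocones under) the part of \<open>V\<close> at the indices \<open>k - 1\<close>, \<open>k\<close>, \<open>k + 1\<close>, for \<open>k \<ge> 1\<close>,
  with apex \<open>X\<close> and legs \<open>\<pi> (k - 1)\<close>, \<open>\<pi> k\<close>, \<open>\<pi> (k + 1)\<close>.
\<close>

definition is_cone ::
  "('a::field, 'v::ab_group_add) zigzag \<Rightarrow> nat \<Rightarrow> 'v set \<Rightarrow> (nat \<Rightarrow> 'v \<Rightarrow> 'v) \<Rightarrow> bool" where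
  "is_cone V k X \<pi> \<longleftrightarrow>
     fd_subspace (zz_scale V) X \<and>
     (\<forall>i\<in>{k - 1, k, k + 1}. linear_between (zz_scale V) X (zz_scale V) (zz_space V i) (\<pi> i)) \<and>
     (\<forall>i\<in>{k - 1, k}. \<forall>x\<in>X. case zz_dir V i of
        Forward \<Rightarrow> zz_map V i (\<pi> i x) = \<pi> (i + 1) x
      | Backward \<Rightarrow> zz_map V i (\<pi> (i + 1) x) = \<pi> i x)"

definition is_cocone ::
  "('a::field, 'v::ab_group_add) zigzag \<Rightarrow> nat \<Rightarrow> 'v set \<Rightarrow> (nat \<Rightarrow> 'v \<Rightarrow> 'v) \<Rightarrow> bool" where
  "is_cocone V k X \<iota> \<longleftrightarrow>
     fd_subspace (zz_scale V) X \<and>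
     (\<forall>i\<in>{k - 1, k, k + 1}. linear_between (zz_scale V) (zz_space V i) (zz_scale V) X (\<iota> i)) \<and>
     (\<forall>i\<in>{k - 1, k}. case zz_dir V i of
        Forward \<Rightarrow> \<forall>x\<in>zz_space V i. \<iota> (i + 1) (zz_map V i x) = \<iota> i x
      | Backward \<Rightarrow> \<forall>x\<in>zz_space V (i + 1). \<iota> i (zz_map V i x) = \<iota> (i + 1) x)"

text \<open>
  Apexes range over the finite-dimensional subspaces of the ambient space of \<open>V\<close>.  Below, limits and
  colimits are only taken for the ambient space \<^typ>\<open>'a univ\<close>, which is infinite-dimensional and
  hence contains a copy of every finite-dimensional space; so these are the limits and colimits in
  the category of finite-dimensional vector spaces.
\<close>

definition is_limit ::
  "('a::field, 'v::ab_group_add) zigzag \<Rightarrow> nat \<Rightarrow> 'v set \<Rightarrow> (nat \<Rightarrow> 'v \<Rightarrow> 'v) \<Rightarrow> bool" where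
  "is_limit V k L \<pi> \<longleftrightarrow>
     is_cone V k L \<pi> \<and>
     (\<forall>X \<phi>. is_cone V k X \<phi> \<longrightarrow>
        (\<exists>h. linear_between (zz_scale V) X (zz_scale V) L h \<and>
             (\<forall>i\<in>{k - 1, k, k + 1}. \<forall>x\<in>X. \<pi> i (h x) = \<phi> i x) \<and>
             (\<forall>h'. linear_between (zz_scale V) X (zz_scale V) L h' \<and>
                   (\<forall>i\<in>{k - 1, k, k + 1}. \<forall>x\<in>X. \<pi> i (h' x) = \<phi> i x)
                   \<longrightarrow> (\<forall>x\<in>X. h' x = h x))))"

definition is_colimit ::
  "('a::field, 'v::ab_group_add) zigzag \<Rightarrow> nat \<Rightarrow> 'v set \<Rightarrow> (nat \<Rightarrow> 'v \<Rightarrow> 'v) \<Rightarrow> bool" where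
  "is_colimit V k C \<iota> \<longleftrightarrow>
     is_cocone V k C \<iota> \<and>
     (\<forall>X \<phi>. is_cocone V k X \<phi> \<longrightarrow>
        (\<exists>h. linear_between (zz_scale V) C (zz_scale V) X h \<and>
             (\<forall>i\<in>{k - 1, k, k + 1}. \<forall>x\<in>zz_space V i. h (\<iota> i x) = \<phi> i x) \<and>
             (\<forall>h'. linear_between (zz_scale V) C (zz_scale V) X h' \<and>
                   (\<forall>i\<in>{k - 1, k, k + 1}. \<forall>x\<in>zz_space V i. h' (\<iota> i x) = \<phi> i x)
                   \<longrightarrow> (\<forall>x\<in>C. h' x = h x))))"

text \<open>Limits and colimits are determined up to isomorphism; a choice is made.\<close>

definition limit_at :: "nat \<Rightarrow> ('a::field, 'a univ) zigzag \<Rightarrow> ('a, 'a univ) zigzag" where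
  "limit_at k V = (let (L, \<pi>) = (SOME (L, \<pi>). is_limit V k L \<pi>) in
     V\<lparr> zz_space := (zz_space V)(k := L),
        zz_dir := (zz_dir V)(k - 1 := Backward, k := Forward),
        zz_map := (zz_map V)(k - 1 := \<pi> (k - 1), k := \<pi> (k + 1)) \<rparr>)"

definition colimit_at :: "nat \<Rightarrow> ('a::field, 'a univ) zigzag \<Rightarrow> ('a, 'a univ) zigzag" where
  "colimit_at k V = (let (C, \<iota>) = (SOME (C, \<iota>). is_colimit V k C \<iota>) in
     V\<lparr> zz_space := (zz_space V)(k := C),
        zz_dir := (zz_dir V)(k - 1 := Forward, k := Backward),
        zz_map := (zz_map V)(k - 1 := \<iota> (k - 1), k := \<iota> (k + 1)) \<rparr>)"

text \<open>
  The functors at the ends are the ones at an inner index after prepending (appending) the zero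
  space with an arrow \<open>e\<close> at index \<open>0\<close> (\<open>n\<close>).  So \<open>First _ Forward\<close> uses
  \<open>0 \<rightarrow> V\<^sub>1 \<leftrightarrow> V\<^sub>2\<close>, and \<open>Last _ Forward\<close> uses
  \<open>V\<^sub>n\<^sub>-\<^sub>1 \<leftrightarrow> V\<^sub>n \<rightarrow> 0\<close>.  The data at the indices \<open>0\<close> and \<open>n\<close>, \<open>n + 1\<close> of the result
  are out of range and irrelevant.
\<close>

definition prepend_zero :: "direction \<Rightarrow> ('a, 'v::zero) zigzag \<Rightarrow> ('a, 'v) zigzag" where
  "prepend_zero e V = V\<lparr>
     zz_space := (zz_space V)(0 := {0}),
     zz_dir := (zz_dir V)(0 := e),
     zz_map := (zz_map V)(0 := (\<lambda>_. 0)) \<rparr>"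

definition append_zero :: "nat \<Rightarrow> direction \<Rightarrow> ('a, 'v::zero) zigzag \<Rightarrow> ('a, 'v) zigzag" where
  "append_zero n e V = V\<lparr>
     zz_space := (zz_space V)(n + 1 := {0}),
     zz_dir := (zz_dir V)(n := e),
     zz_map := (zz_map V)(n := (\<lambda>_. 0)) \<rparr>"

datatype universal_kind = Limit_Functor | Colimit_Functor

datatype reflection =
    Inner universal_kind nat
  | First universal_kind direction
  | Last universal_kind direction

text \<open>The functors at the ends involve \<open>V\<^sub>2\<close> and \<open>V\<^sub>n\<^sub>-\<^sub>1\<close>, hence need \<open>n \<ge> 2\<close>.\<close>

fun reflection_defined :: "nat \<Rightarrow> reflection \<Rightarrow> bool" where
  "reflection_defined n (Inner _ k) \<longleftrightarrow> 2 \<le> k \<and> k + 1 \<le> n"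
| "reflection_defined n (First _ _) \<longleftrightarrow> 2 \<le> n"
| "reflection_defined n (Last _ _) \<longleftrightarrow> 2 \<le> n"

fun universal_at ::
  "universal_kind \<Rightarrow> nat \<Rightarrow> ('a::field, 'a univ) zigzag \<Rightarrow> ('a, 'a univ) zigzag" where
  "universal_at Limit_Functor k V = limit_at k V"
| "universal_at Colimit_Functor k V = colimit_at k V"

fun reflect ::
  "nat \<Rightarrow> reflection \<Rightarrow> ('a::field, 'a univ) zigzag \<Rightarrow> ('a, 'a univ) zigzag" where
  "reflect n (Inner u k) V = universal_at u k V"
| "reflect n (First u e) V = universal_at u 1 (prepend_zero e V)"
| "reflect n (Last u e) V = universal_at u n (append_zero n e V)"


section \<open>The reflection distance\<close>

text \<open>Sequences are listed in order of application: the head of the list is applied first.\<close>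

definition reflect_seq ::
  "nat \<Rightarrow> reflection list \<Rightarrow> ('a::field, 'v::ab_group_add) zigzag \<Rightarrow> ('a, 'a univ) zigzag" where
  "reflect_seq n rs V = fold (\<lambda>r U. remove_simples n (reflect n r U)) rs (remove_simples n V)"

definition reflection_cost :: "real \<Rightarrow> reflection list \<Rightarrow> real" where
  "reflection_cost p rs = (if rs = [] then 0 else real (length rs) powr (1 / p))"

definition reflection_dist ::
  "real \<Rightarrow> nat \<Rightarrow> ('a::field, 'v::ab_group_add) zigzag \<Rightarrow> ('a, 'w::ab_group_add) zigzag \<Rightarrow> ereal" where
  "reflection_dist p n V W = Inf {ereal (max (reflection_cost p rs) (reflection_cost p rs')) | rs rs'.
     list_all (reflection_defined n) rs \<and> list_all (reflection_defined n) rs' \<and>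
     sub_equiv n (reflect_seq n rs V) W \<and> sub_equiv n (reflect_seq n rs' W) V}"


section \<open>The bottleneck distance\<close>

text \<open>
  A matching of multisets is given by the multiset of its matched pairs; the marginals are the
  matched sub-multisets.  Exponents \<open>p\<close> are extended reals with \<open>1 \<le> p \<le> \<infinity>\<close>.
\<close>

definition is_matching :: "('p \<times> 'q) multiset \<Rightarrow> 'p multiset \<Rightarrow> 'q multiset \<Rightarrow> bool" where
  "is_matching M S T \<longleftrightarrow> image_mset fst M \<subseteq># S \<and> image_mset snd M \<subseteq># T"

definition lp_norm :: "ereal \<Rightarrow> real \<times> real \<Rightarrow> real" where
  "lp_norm p = (\<lambda>(x, y). if p = \<infinity> then max \<bar>x\<bar> \<bar>y\<bar>
     else (\<bar>x\<bar> powr real_of_ereal p + \<bar>y\<bar> powr real_of_ereal p) powr (1 / real_of_ereal p))"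

definition matching_cost ::
  "ereal \<Rightarrow> ((real \<times> real) \<times> (real \<times> real)) multiset \<Rightarrow>
   (real \<times> real) multiset \<Rightarrow> (real \<times> real) multiset \<Rightarrow> real" where
  "matching_cost p M S T = Max (insert 0
     ((\<lambda>(s, t). lp_norm p (s - t)) ` set_mset M \<union>
      (\<lambda>(x, y). \<bar>y - x\<bar> / 2 powr (1 - real_of_ereal (1 / p))) `
        set_mset ((S - image_mset fst M) + (T - image_mset snd M))))"

definition bottleneck_dist ::
  "ereal \<Rightarrow> (real \<times> real) multiset \<Rightarrow> (real \<times> real) multiset \<Rightarrow> real" where
  "bottleneck_dist p S T = Inf {matching_cost p M S T | M. is_matching M S T}"

definition dgm_points ::
  "nat \<Rightarrow> ('a::field, 'v::ab_group_add) zigzag \<Rightarrow> (real \<times> real) multiset" where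
  "dgm_points n V = image_mset (\<lambda>(b, d). (real b, real d)) (dgm n V)"

end

theory Submission
  imports Defs
begin

text \<open>
  The idea is that a reflection functor moves every interval of a diagram by at most one, so that a
  sequence of \<open>\<ell>\<close> reflections moves it by at most \<open>\<ell>\<close>.  Limits and colimits respect direct sums, hence
  a reflection at \<open>k\<close> can be computed on one interval summand at a time.  It keeps the spaces away from
  \<open>k\<close>, and on a non-simple interval it only decides whether \<open>k\<close> is covered: at most one
  endpoint changes, by at most one, and the interval does not vanish (\<open>barcode_reflect\<close>).  Consequently,
  along a sequence of \<open>\<ell>\<close> reflections an interval of \<open>V\<close> either survives, at \<open>\<ell>\<^sup>1\<close>-distance at most \<open>\<ell>\<close>
  from where it started, or it becomes simple at some point and is removed; in the latter case its
  length was at most \<open>\<ell>\<close>, which is exactly its cost as an unmatched point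
  (\<open>reflect_seq_displacement\<close>).

  If the reflected module is a summand of \<open>W\<close> up to arrow reversals, its intervals are among those of
  \<open>W\<close> with multiplicity (\<open>dgm_mono_of_sub_equiv\<close>).  So the sequence from \<open>V\<close> to \<open>W\<close> yields a
  partial injection of diagrams that moves points by at most \<open>\<ell>\<close> and is undefined only on
  intervals of length at most \<open>\<ell>\<close>, and the sequence from \<open>W\<close> to \<open>V\<close> yields one in the other
  direction.  By the argument of Schroeder and Bernstein, in the form due to Mendelsohn and Dulmage,
  these combine to a single matching that only uses pairs of either injection and covers both of their
  domains (\<open>matching_of_partial_maps\<close>).  Its cost is at most the larger of the two lengths.

  Diagrams make sense only because interval decompositions exist and are unique.  Existence
  (\<open>barcode_exists\<close>) is by induction on the length of the module: the intervals ending at the last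
  index are linearly ordered by the existence of homomorphisms between them, and Gaussian elimination
  along this order adapts their basis vectors to the kernel or image of the next structure map.
  Uniqueness (\<open>bars_unique\<close>) holds because the values that homomorphisms from a given interval module
  take at its left endpoint form a space whose dimension is additive and invariant under isomorphism,
  and the matrix of these dimensions for interval modules is unitriangular.
\<close>

section \<open>Matchings from partial maps in both directions\<close>

lemma fibrewise_injection:
  assumes "finite S" "finite T"
    and le: "\<And>x. card {s\<in>S. l s = x} \<le> card {t\<in>T. l' t = x}"
  shows "\<exists>F. inj_on F S \<and> F ` S \<subseteq> T \<and> (\<forall>s\<in>S. l' (F s) = l s)"
proof -
  have "\<exists>f. \<forall>x. inj_on (f x) {s\<in>S. l s = x} \<and> f x ` {s\<in>S. l s = x} \<subseteq> {t\<in>T. l' t = x}"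
  proof (intro choice allI)
    fix x
    show "\<exists>f. inj_on f {s\<in>S. l s = x} \<and> f ` {s\<in>S. l s = x} \<subseteq> {t\<in>T. l' t = x}"
      using card_le_inj[OF _ _ le[of x]] assms(1,2) by auto
  qed
  then obtain f where f: "\<And>x. inj_on (f x) {s\<in>S. l s = x}"
      "\<And>x. f x ` {s\<in>S. l s = x} \<subseteq> {t\<in>T. l' t = x}" by blast
  have lab: "f (l s) s \<in> T \<and> l' (f (l s) s) = l s" if "s \<in> S" for s
    using f(2)[of "l s"] that by blast
  moreover have "inj_on (\<lambda>s. f (l s) s) S"
  proof (rule inj_onI)
    fix s t assume st: "s \<in> S" "t \<in> S" "f (l s) s = f (l t) t"
    then have "l s = l t" using lab by metis
    then show "s = t" using st f(1)[of "l s"] by (auto simp: inj_on_def)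
  qed
  ultimately show ?thesis by (intro exI[of _ "\<lambda>s. f (l s) s"]) auto
qed

lemma count_image_mset_set:
  assumes "finite S"
  shows "count (image_mset l (mset_set S)) x = card {s\<in>S. l s = x}"
  using assms by (simp add: count_image_mset vimage_def Int_def conj_commute)

text \<open>
  For \<open>A'\<close> and \<open>B'\<close> the domains of two partial injections in opposite directions, the Schroeder--Bernstein
  argument does not produce a bijection, but still a matching that covers both domains.
\<close>

lemma mendelsohn_dulmage:
  assumes f: "inj_on f A'" "f ` A' \<subseteq> B" and g: "inj_on g B'" "g ` B' \<subseteq> A"
  shows "\<exists>R. R \<subseteq> {(a, f a) | a. a \<in> A'} \<union> {(g b, b) | b. b \<in> B'} \<and>
             inj_on fst R \<and> inj_on snd R \<and> A' \<subseteq> fst ` R \<and> B' \<subseteq> snd ` R"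
proof -
  \<comment> \<open>A fixed point \<open>X\<close> is a part of \<open>A'\<close> to be matched by \<open>f\<close> whose complement is matched by \<open>g\<close>.\<close>
  define \<Phi> where "\<Phi> X = A' - g ` (B' - f ` X)" for X
  have "mono \<Phi>" unfolding \<Phi>_def mono_def by blast
  then obtain X where X: "X = A' - g ` (B' - f ` X)"
    using lfp_unfold[of \<Phi>] unfolding \<Phi>_def by metis
  define Y where "Y = B' - f ` X"
  define R where "R = {(a, f a) | a. a \<in> X} \<union> {(g b, b) | b. b \<in> Y}"
  have XA: "X \<subseteq> A'" and disj: "X \<inter> g ` Y = {}" and cov: "A' \<subseteq> X \<union> g ` Y"
    using X unfolding Y_def by blast+
  have "R \<subseteq> {(a, f a) | a. a \<in> A'} \<union> {(g b, b) | b. b \<in> B'}"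
    using XA unfolding R_def Y_def by blast
  moreover have "inj_on fst R"
    using disj g(1) unfolding R_def Y_def inj_on_def by fastforce
  moreover have "inj_on snd R"
  proof -
    have "inj_on f X" using f(1) XA inj_on_subset by blast
    then show ?thesis unfolding R_def Y_def inj_on_def by fastforce
  qed
  moreover have "fst ` R = X \<union> g ` Y" "snd ` R = f ` X \<union> Y" unfolding R_def by force+
  ultimately show ?thesis using cov by (intro exI[of _ R]) (auto simp: Y_def)
qed

lemma finite_copies: "finite {(x, j). j < count D x}"
proof -
  have "{(x, j). j < count D x} = (SIGMA x:set_mset D. {..<count D x})"
    by (auto simp: count_greater_zero_iff[symmetric] simp del: count_greater_zero_iff)
  then show ?thesis by simp
qed

lemma image_fst_copies: "image_mset fst (mset_set {(x, j). j < count D x}) = D"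
proof (rule multiset_eqI)
  fix x
  have "{s \<in> {(x, j). j < count D x}. fst s = x} = Pair x ` {..<count D x}" by auto
  then show "count (image_mset fst (mset_set {(x, j). j < count D x})) x = count D x"
    by (simp only: count_image_mset_set[OF finite_copies]) (simp add: card_image inj_on_def)
qed

lemma image_mset_set_subset:
  assumes "finite A" "X \<subseteq> A"
  shows "image_mset l (mset_set X) \<subseteq># image_mset l (mset_set A)"
  using assms by (simp add: image_mset_subseteq_mono subset_imp_msubset_mset_set)

text \<open>
  The copies of a point in a multiset are told apart by numbering them; a submultiset relation then
  lifts a map of points to an injection of numbered points.
\<close>

lemma matching_of_partial_maps:
  fixes D :: "'p multiset" and E :: "'q multiset"
  assumes f: "image_mset f (filter_mset P D) \<subseteq># E"
    and g: "image_mset g (filter_mset Q E) \<subseteq># D"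
  shows "\<exists>M. is_matching M D E \<and>
     (\<forall>(s, t)\<in>#M. (P s \<and> t = f s) \<or> (Q t \<and> s = g t)) \<and>
     (\<forall>s\<in>#D - image_mset fst M. \<not> P s) \<and> (\<forall>t\<in>#E - image_mset snd M. \<not> Q t)"
proof -
  define A where "A = {(x, j). j < count D x}"
  define B where "B = {(x, j). j < count E x}"
  define A' where "A' = {a\<in>A. P (fst a)}"
  define B' where "B' = {b\<in>B. Q (fst b)}"
  have fin: "finite A" "finite B" unfolding A_def B_def by (rule finite_copies)+
  then have fin': "finite A'" "finite B'" unfolding A'_def B'_def by auto
  have D: "image_mset fst (mset_set A) = D" and E: "image_mset fst (mset_set B) = E"
    unfolding A_def B_def by (rule image_fst_copies)+
  have fD: "filter_mset P D = image_mset fst (mset_set A')"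
    unfolding D[symmetric] A'_def by (simp add: filter_mset_image_mset filter_mset_mset_set fin)
  have fE: "filter_mset Q E = image_mset fst (mset_set B')"
    unfolding E[symmetric] B'_def by (simp add: filter_mset_image_mset filter_mset_mset_set fin)
  have lift: "\<exists>F. inj_on F X' \<and> F ` X' \<subseteq> Y \<and> (\<forall>s\<in>X'. fst (F s) = h (fst s))"
    if "finite X'" "finite Y" "image_mset h (image_mset fst (mset_set X')) \<subseteq># image_mset fst (mset_set Y)"
    for X' :: "('x \<times> nat) set" and Y :: "('y \<times> nat) set" and h
  proof -
    have "card {s\<in>X'. (h \<circ> fst) s = x} \<le> card {t\<in>Y. fst t = x}" for x
      using mset_subset_eq_count[OF that(3), of x] that(1,2)
      by (simp add: count_image_mset_set[symmetric] multiset.map_comp comp_def)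
    from fibrewise_injection[OF that(1,2) this] show ?thesis by auto
  qed
  obtain F where F: "inj_on F A'" "F ` A' \<subseteq> B" "\<forall>s\<in>A'. fst (F s) = f (fst s)"
    using lift[OF fin'(1) fin(2), of f] f unfolding fD E[symmetric] by blast
  obtain G where G: "inj_on G B'" "G ` B' \<subseteq> A" "\<forall>s\<in>B'. fst (G s) = g (fst s)"
    using lift[OF fin'(2) fin(1), of g] g unfolding fE D[symmetric] by blast
  obtain R where R: "R \<subseteq> {(a, F a) | a. a \<in> A'} \<union> {(G b, b) | b. b \<in> B'}"
     "inj_on fst R" "inj_on snd R" "A' \<subseteq> fst ` R" "B' \<subseteq> snd ` R"
    using mendelsohn_dulmage[OF F(1,2) G(1,2)] by blast
  have sub: "A' \<subseteq> A" "B' \<subseteq> B" unfolding A'_def B'_def by auto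
  have "{(a, F a) | a. a \<in> A'} \<subseteq> A \<times> B" using F(2) sub(1) by auto
  moreover have "{(G b, b) | b. b \<in> B'} \<subseteq> A \<times> B" using G(2) sub(2) by auto
  ultimately have "R \<subseteq> A \<times> B" using R(1) by (meson Un_least subset_trans)
  then have RA: "fst ` R \<subseteq> A" and RB: "snd ` R \<subseteq> B" by auto
  have finR: "finite R" using finite_imageD[OF finite_subset[OF RA fin(1)] R(2)] .
  define M where "M = image_mset (map_prod fst fst) (mset_set R)"
  have M1: "image_mset fst M = image_mset fst (mset_set (fst ` R))"
    and M2: "image_mset snd M = image_mset fst (mset_set (snd ` R))"
    unfolding M_def image_mset_mset_set[OF R(2), symmetric] image_mset_mset_set[OF R(3), symmetric]
    by (simp_all add: multiset.map_comp comp_def)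
  have "is_matching M D E"
    unfolding is_matching_def M1 M2 using image_mset_set_subset[OF fin(1) RA, of fst]
      image_mset_set_subset[OF fin(2) RB, of fst] D E by simp
  moreover have "(P s \<and> t = f s) \<or> (Q t \<and> s = g t)" if st: "(s, t) \<in># M" for s t
  proof -
    obtain a b where ab: "(a, b) \<in> R" "s = fst a" "t = fst b"
      using st finR unfolding M_def by auto
    then consider "a \<in> A'" "b = F a" | "b \<in> B'" "a = G b" using R(1) by blast
    then show ?thesis
    proof cases
      case 1
      then have "t = f s" using bspec[OF F(3) 1(1)] ab by simp
      then show ?thesis using 1(1) ab(2) unfolding A'_def by blast
    next
      case 2
      then have "s = g t" using bspec[OF G(3) 2(1)] ab by simp
      then show ?thesis using 2(1) ab(3) unfolding B'_def by blast
    qed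
  qed
  moreover have "\<not> P s" if lone: "s \<in># D - image_mset fst M" for s
  proof -
    have "D - image_mset fst M = image_mset fst (mset_set (A - fst ` R))"
      unfolding M1 mset_set_Diff[OF fin(1) RA]
      by (subst image_mset_Diff) (simp_all add: D subset_imp_msubset_mset_set fin RA)
    then obtain a where "a \<in> A - fst ` R" "s = fst a" using lone fin by auto
    then show ?thesis using R(4) unfolding A'_def by blast
  qed
  moreover have "\<not> Q t" if lone: "t \<in># E - image_mset snd M" for t
  proof -
    have "E - image_mset snd M = image_mset fst (mset_set (B - snd ` R))"
      unfolding M2 mset_set_Diff[OF fin(2) RB]
      by (subst image_mset_Diff) (simp_all add: E subset_imp_msubset_mset_set fin RB)
    then obtain a where "a \<in> B - snd ` R" "t = fst a" using lone fin by auto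
    then show ?thesis using R(5) unfolding B'_def by blast
  qed
  ultimately show ?thesis by (intro exI[of _ M]) auto
qed

definition l1_dist :: "nat \<times> nat \<Rightarrow> nat \<times> nat \<Rightarrow> int" where
  "l1_dist x y = \<bar>int (fst x) - int (fst y)\<bar> + \<bar>int (snd x) - int (snd y)\<bar>"

lemma lp_norm_1: "lp_norm 1 (x, y) = \<bar>x\<bar> + \<bar>y\<bar>"
  unfolding lp_norm_def one_ereal_def by simp

lemma bottleneck_dist_le:
  fixes D E :: "(nat \<times> nat) multiset"
  assumes M: "is_matching M D E"
    and pairs: "\<And>s t. (s, t) \<in># M \<Longrightarrow> l1_dist s t \<le> int r"
    and lone: "\<And>b d. (b, d) \<in># D - image_mset fst M \<Longrightarrow> d \<le> b + r \<and> b \<le> d"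
      "\<And>b d. (b, d) \<in># E - image_mset snd M \<Longrightarrow> d \<le> b + r \<and> b \<le> d"
  shows "bottleneck_dist 1 (image_mset (\<lambda>(b, d). (real b, real d)) D)
           (image_mset (\<lambda>(b, d). (real b, real d)) E) \<le> real r"
proof -
  define \<rho> :: "nat \<times> nat \<Rightarrow> real \<times> real" where "\<rho> = (\<lambda>(b, d). (real b, real d))"
  define M' where "M' = image_mset (map_prod \<rho> \<rho>) M"
  have fst: "image_mset fst M' = image_mset \<rho> (image_mset fst M)"
    and snd: "image_mset snd M' = image_mset \<rho> (image_mset snd M)"
    unfolding M'_def by (simp_all add: multiset.map_comp comp_def)
  have sub: "image_mset fst M \<subseteq># D" "image_mset snd M \<subseteq># E"
    using M unfolding is_matching_def by auto
  have match: "is_matching M' (image_mset \<rho> D) (image_mset \<rho> E)"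
    unfolding is_matching_def fst snd using sub by (simp add: image_mset_subseteq_mono)
  have cost: "matching_cost 1 M' (image_mset \<rho> D) (image_mset \<rho> E) \<le> real r"
  proof -
    have "lp_norm 1 (\<rho> u - \<rho> v) \<le> real r" if uv: "(u, v) \<in># M" for u v
    proof -
      have "lp_norm 1 (\<rho> u - \<rho> v) = real_of_int (l1_dist u v)"
        by (cases u; cases v) (simp add: \<rho>_def l1_dist_def lp_norm_1)
      then show ?thesis using pairs[OF uv] by linarith
    qed
    then have "lp_norm 1 (fst q - snd q) \<le> real r" if "q \<in># M'" for q
      using that unfolding M'_def by auto
    then have "\<forall>z\<in>(\<lambda>(s, t). lp_norm 1 (s - t)) ` set_mset M'. z \<le> real r"
      by (simp add: split_beta)
    moreover have "\<bar>y - x\<bar> / 2 powr (1 - real_of_ereal (1 / 1)) \<le> real r"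
      if xy: "(x, y) \<in># (image_mset \<rho> D - image_mset fst M') + (image_mset \<rho> E - image_mset snd M')" for x y
    proof -
      have "(x, y) \<in># image_mset \<rho> (D - image_mset fst M) + image_mset \<rho> (E - image_mset snd M)"
        using xy unfolding fst snd using sub by (simp add: image_mset_Diff)
      then have "\<exists>b d. x = real b \<and> y = real d \<and> d \<le> b + r \<and> b \<le> d"
        using lone unfolding \<rho>_def by auto
      then show ?thesis by (auto simp: one_ereal_def)
    qed
    then have "\<forall>z\<in>(\<lambda>(x, y). \<bar>y - x\<bar> / 2 powr (1 - real_of_ereal (1 / 1))) ` set_mset
        ((image_mset \<rho> D - image_mset fst M') + (image_mset \<rho> E - image_mset snd M')). z \<le> real r"
      by (metis (no_types, lifting) case_prod_conv imageE surj_pair)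
    ultimately show ?thesis unfolding matching_cost_def
      by (intro Max.boundedI) (auto simp del: set_mset_union)
  qed
  have bdd: "bdd_below {matching_cost 1 M (image_mset \<rho> D) (image_mset \<rho> E) | M.
      is_matching M (image_mset \<rho> D) (image_mset \<rho> E)}"
    by (rule bdd_belowI[of _ 0]) (auto simp: matching_cost_def)
  have "bottleneck_dist 1 (image_mset \<rho> D) (image_mset \<rho> E)
      \<le> matching_cost 1 M' (image_mset \<rho> D) (image_mset \<rho> E)"
    unfolding bottleneck_dist_def by (rule cInf_lower[OF _ bdd]) (use match in blast)
  then show ?thesis using cost unfolding \<rho>_def by (rule order_trans)
qed

section \<open>Linear maps and isomorphisms of zigzag modules\<close>

lemma linear_betweenD:
  assumes "linear_between s A t B f"
  shows "x \<in> A \<Longrightarrow> f x \<in> B" "x \<in> A \<Longrightarrow> y \<in> A \<Longrightarrow> f (x + y) = f x + f y"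
    "x \<in> A \<Longrightarrow> f (s c x) = t c (f x)"
  using assms unfolding linear_between_def by auto

lemma linear_betweenI:
  assumes "\<And>x. x \<in> A \<Longrightarrow> f x \<in> B" "\<And>x y. x \<in> A \<Longrightarrow> y \<in> A \<Longrightarrow> f (x + y) = f x + f y"
    "\<And>c x. x \<in> A \<Longrightarrow> f (s c x) = t c (f x)"
  shows "linear_between s A t B f"
  using assms unfolding linear_between_def by auto

lemma linear_between_compose:
  assumes f: "linear_between s A t B f" and g: "linear_between t B u C g"
  shows "linear_between s A u C (\<lambda>x. g (f x))"
  using linear_betweenD[OF f] linear_betweenD[OF g] by (intro linear_betweenI) simp_all

lemma linear_between_inverse:
  assumes "vector_space s" and A: "module.subspace s A"
    and f: "linear_between s A t B f" and bij: "bij_betw f A B"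
  shows "linear_between t B s A (inv_into A f)"
proof -
  interpret vector_space s by fact
  have inv: "inv_into A f y \<in> A" "f (inv_into A f y) = y" if "y \<in> B" for y
    using that bij by (auto simp: bij_betw_def inv_into_into f_inv_into_f)
  have inv': "inv_into A f (f x) = x" if "x \<in> A" for x
    using that bij by (simp add: bij_betw_def)
  show ?thesis
  proof (rule linear_betweenI)
    fix x y assume xy: "x \<in> B" "y \<in> B"
    have "inv_into A f (f (inv_into A f x + inv_into A f y)) = inv_into A f x + inv_into A f y"
      by (intro inv' subspace_add[OF A] inv xy)
    then show "inv_into A f (x + y) = inv_into A f x + inv_into A f y"
      using linear_betweenD(2)[OF f] inv xy by simp
  next
    fix c x assume x: "x \<in> B"
    have "inv_into A f (f (s c (inv_into A f x))) = s c (inv_into A f x)"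
      by (intro inv' subspace_scale[OF A] inv x)
    then show "inv_into A f (t c x) = s c (inv_into A f x)"
      using linear_betweenD(3)[OF f] inv x by simp
  qed (rule inv)
qed

lemma linear_between_sum:
  assumes s: "vector_space s" and t: "vector_space t" and A: "module.subspace s A"
    and f: "linear_between s A t B f" and u: "\<And>j. j \<in> S \<Longrightarrow> u j \<in> A"
  shows "f (\<Sum>j\<in>S. s (c j) (u j)) = (\<Sum>j\<in>S. t (c j) (f (u j)))"
proof -
  interpret s: vector_space s by fact
  interpret t: vector_space t by fact
  have 0: "f 0 = 0"
    using linear_betweenD(3)[OF f s.subspace_0[OF A], of 0] by simp
  show ?thesis using u
  proof (induction S rule: infinite_finite_induct)
    case (insert j S)
    then have "(\<Sum>j\<in>S. s (c j) (u j)) \<in> A"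
      by (intro s.subspace_sum[OF A] s.subspace_scale[OF A]) auto
    then show ?case
      using insert linear_betweenD(2,3)[OF f] by (simp add: s.subspace_scale[OF A])
  qed (simp_all add: 0)
qed

lemma fd_subspaceD: "fd_subspace s A \<Longrightarrow> module.subspace s A"
  unfolding fd_subspace_def by simp

lemma zigzag_moduleD:
  assumes "zigzag_module n V"
  shows "vector_space (zz_scale V)"
    "i \<in> {1..n} \<Longrightarrow> fd_subspace (zz_scale V) (zz_space V i)"
    "i \<in> {1..n} \<Longrightarrow> module.subspace (zz_scale V) (zz_space V i)"
    "i \<in> {1..<n} \<Longrightarrow>
      linear_between (zz_scale V) (zz_source V i) (zz_scale V) (zz_target V i) (zz_map V i)"
  using assms unfolding zigzag_module_def fd_subspace_def by auto

definition iso_family ::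
  "nat \<Rightarrow> ('a::field, 'v::ab_group_add) zigzag \<Rightarrow> ('a, 'w::ab_group_add) zigzag \<Rightarrow> (nat \<Rightarrow> 'v \<Rightarrow> 'w) \<Rightarrow> bool" where
  "iso_family n V W f \<longleftrightarrow> zz_morphism n V W f \<and> (\<forall>i\<in>{1..n}. bij_betw (f i) (zz_space V i) (zz_space W i))"

lemma zz_isoE:
  assumes "zz_iso n V W"
  obtains f where "iso_family n V W f"
  using assms unfolding zz_iso_def iso_family_def by blast

lemma iso_familyD:
  assumes f: "iso_family n V W f"
  shows "same_type n V W"
    "\<And>i. i \<in> {1..n} \<Longrightarrow> linear_between (zz_scale V) (zz_space V i) (zz_scale W) (zz_space W i) (f i)"
    "\<And>i. i \<in> {1..n} \<Longrightarrow> bij_betw (f i) (zz_space V i) (zz_space W i)"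
    "\<And>i x. i \<in> {1..<n} \<Longrightarrow> zz_dir V i = Forward \<Longrightarrow> x \<in> zz_space V i \<Longrightarrow>
       f (i + 1) (zz_map V i x) = zz_map W i (f i x)"
    "\<And>i x. i \<in> {1..<n} \<Longrightarrow> zz_dir V i = Backward \<Longrightarrow> x \<in> zz_space V (i + 1) \<Longrightarrow>
       f i (zz_map V i x) = zz_map W i (f (i + 1) x)"
proof -
  have f': "zz_morphism n V W f" "\<forall>i\<in>{1..n}. bij_betw (f i) (zz_space V i) (zz_space W i)"
    using f unfolding iso_family_def by auto
  show "f (i + 1) (zz_map V i x) = zz_map W i (f i x)"
    if "i \<in> {1..<n}" "zz_dir V i = Forward" "x \<in> zz_space V i" for i x
    using f'(1) that unfolding zz_morphism_def by (auto dest!: bspec[of _ _ i])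
  show "f i (zz_map V i x) = zz_map W i (f (i + 1) x)"
    if "i \<in> {1..<n}" "zz_dir V i = Backward" "x \<in> zz_space V (i + 1)" for i x
    using f'(1) that unfolding zz_morphism_def by (auto dest!: bspec[of _ _ i])
qed (use f in \<open>auto simp: zz_morphism_def iso_family_def\<close>)

lemma zz_isoI:
  assumes "same_type n V W"
    "\<And>i. i \<in> {1..n} \<Longrightarrow> linear_between (zz_scale V) (zz_space V i) (zz_scale W) (zz_space W i) (f i)"
    "\<And>i. i \<in> {1..n} \<Longrightarrow> bij_betw (f i) (zz_space V i) (zz_space W i)"
    "\<And>i x. i \<in> {1..<n} \<Longrightarrow> zz_dir V i = Forward \<Longrightarrow> x \<in> zz_space V i \<Longrightarrow>
       f (i + 1) (zz_map V i x) = zz_map W i (f i x)"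
    "\<And>i x. i \<in> {1..<n} \<Longrightarrow> zz_dir V i = Backward \<Longrightarrow> x \<in> zz_space V (i + 1) \<Longrightarrow>
       f i (zz_map V i x) = zz_map W i (f (i + 1) x)"
  shows "zz_iso n V W"
  unfolding zz_iso_def zz_morphism_def using assms
  by (intro exI[of _ f]) (auto split: direction.splits)

lemma same_type_dir: "same_type n V W \<Longrightarrow> i \<in> {1..<n} \<Longrightarrow> zz_dir W i = zz_dir V i"
  unfolding same_type_def by auto

lemma zz_iso_same_type: "zz_iso n V W \<Longrightarrow> same_type n V W"
  by (erule zz_isoE) (rule iso_familyD)

lemma zz_iso_trans:
  assumes "zz_iso n U V" "zz_iso n V W"
  shows "zz_iso n U W"
proof -
  from assms(1) obtain f where "iso_family n U V f" by (rule zz_isoE)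
  note f = iso_familyD[OF this]
  from assms(2) obtain g where "iso_family n V W g" by (rule zz_isoE)
  note g = iso_familyD[OF this]
  show ?thesis
  proof (rule zz_isoI[where f = "\<lambda>i x. g i (f i x)"])
    show "same_type n U W" using f(1) g(1) unfolding same_type_def by auto
    show "linear_between (zz_scale U) (zz_space U i) (zz_scale W) (zz_space W i) (\<lambda>x. g i (f i x))"
      if "i \<in> {1..n}" for i using f(2)[OF that] g(2)[OF that] by (rule linear_between_compose)
    show "bij_betw (\<lambda>x. g i (f i x)) (zz_space U i) (zz_space W i)" if "i \<in> {1..n}" for i
      using bij_betw_trans[OF f(3)[OF that] g(3)[OF that]] by (simp add: comp_def)
    show "g (i + 1) (f (i + 1) (zz_map U i x)) = zz_map W i (g i (f i x))"
      if i: "i \<in> {1..<n}" and d: "zz_dir U i = Forward" and x: "x \<in> zz_space U i" for i x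
    proof -
      have "f i x \<in> zz_space V i" using linear_betweenD(1)[OF f(2) x] i by simp
      then show ?thesis using f(4)[OF i d x] g(4)[OF i] d same_type_dir[OF f(1) i] by simp
    qed
    show "g i (f i (zz_map U i x)) = zz_map W i (g (i + 1) (f (i + 1) x))"
      if i: "i \<in> {1..<n}" and d: "zz_dir U i = Backward" and x: "x \<in> zz_space U (i + 1)" for i x
    proof -
      have "f (i + 1) x \<in> zz_space V (i + 1)" using linear_betweenD(1)[OF f(2) x] i by simp
      then show ?thesis using f(5)[OF i d x] g(5)[OF i] d same_type_dir[OF f(1) i] by simp
    qed
  qed
qed

lemma zz_map_in_target:
  assumes "zigzag_module n V" "i \<in> {1..<n}"
  shows "zz_dir V i = Forward \<Longrightarrow> x \<in> zz_space V i \<Longrightarrow> zz_map V i x \<in> zz_space V (i + 1)"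
    "zz_dir V i = Backward \<Longrightarrow> x \<in> zz_space V (i + 1) \<Longrightarrow> zz_map V i x \<in> zz_space V i"
  using linear_betweenD(1)[OF zigzag_moduleD(4)[OF assms], of x]
  by (simp_all add: zz_source_def zz_target_def)

lemma zz_iso_sym:
  assumes V: "zigzag_module n V" and "zz_iso n V W"
  shows "zz_iso n W V"
proof -
  from assms(2) obtain f where "iso_family n V W f" by (rule zz_isoE)
  note f = iso_familyD[OF this]
  define g where "g i = inv_into (zz_space V i) (f i)" for i
  have gV: "g i y \<in> zz_space V i" "f i (g i y) = y" if "i \<in> {1..n}" "y \<in> zz_space W i" for i y
    using f(3)[OF that(1)] that(2) unfolding g_def bij_betw_def
    by (auto simp: inv_into_into f_inv_into_f)
  have gf: "g i (f i x) = x" if "i \<in> {1..n}" "x \<in> zz_space V i" for i x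
    using f(3)[OF that(1)] that(2) unfolding g_def bij_betw_def by simp
  show ?thesis
  proof (rule zz_isoI[where f = g])
    show "same_type n W V" using f(1) unfolding same_type_def by auto
    show "linear_between (zz_scale W) (zz_space W i) (zz_scale V) (zz_space V i) (g i)"
      if "i \<in> {1..n}" for i unfolding g_def
      by (rule linear_between_inverse[OF zigzag_moduleD(1)[OF V] zigzag_moduleD(3)[OF V that]
            f(2)[OF that] f(3)[OF that]])
    show "bij_betw (g i) (zz_space W i) (zz_space V i)" if "i \<in> {1..n}" for i
      unfolding g_def by (rule bij_betw_inv_into[OF f(3)[OF that]])
    show "g (i + 1) (zz_map W i y) = zz_map V i (g i y)"
      if i: "i \<in> {1..<n}" and d: "zz_dir W i = Forward" and y: "y \<in> zz_space W i" for i y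
    proof -
      have d': "zz_dir V i = Forward" using same_type_dir[OF f(1) i] d by simp
      have i': "i \<in> {1..n}" "i + 1 \<in> {1..n}" using i by auto
      have "g (i + 1) (f (i + 1) (zz_map V i (g i y))) = zz_map V i (g i y)"
        by (rule gf[OF i'(2) zz_map_in_target(1)[OF V i d' gV(1)[OF i'(1) y]]])
      then show ?thesis using f(4)[OF i d' gV(1)[OF i'(1) y]] gV(2)[OF i'(1) y] by simp
    qed
    show "g i (zz_map W i y) = zz_map V i (g (i + 1) y)"
      if i: "i \<in> {1..<n}" and d: "zz_dir W i = Backward" and y: "y \<in> zz_space W (i + 1)" for i y
    proof -
      have d': "zz_dir V i = Backward" using same_type_dir[OF f(1) i] d by simp
      have i': "i \<in> {1..n}" "i + 1 \<in> {1..n}" using i by auto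
      have "g i (f i (zz_map V i (g (i + 1) y))) = zz_map V i (g (i + 1) y)"
        by (rule gf[OF i'(1) zz_map_in_target(2)[OF V i d' gV(1)[OF i'(2) y]]])
      then show ?thesis using f(5)[OF i d' gV(1)[OF i'(2) y]] gV(2)[OF i'(2) y] by simp
    qed
  qed
qed

section \<open>Coordinate spaces\<close>

abbreviation pointwise_scale :: "'a::field \<Rightarrow> ('j \<Rightarrow> 'a) \<Rightarrow> 'j \<Rightarrow> 'a" where
  "pointwise_scale \<equiv> (\<lambda>c x j. c * x j)"

definition coord_space :: "'j set \<Rightarrow> ('j \<Rightarrow> 'a::zero) set" where
  "coord_space S = {x. \<forall>j. x j \<noteq> 0 \<longrightarrow> j \<in> S}"

definition unit_vec :: "'j \<Rightarrow> 'j \<Rightarrow> 'a::zero_neq_one" where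
  "unit_vec j = (\<lambda>l. if l = j then 1 else 0)"

lemma vector_space_pointwise: "vector_space (pointwise_scale :: 'a::field \<Rightarrow> ('j \<Rightarrow> 'a) \<Rightarrow> 'j \<Rightarrow> 'a)"
  by unfold_locales (auto simp: fun_eq_iff algebra_simps)

lemma sum_fun_apply: "(\<Sum>i\<in>S. f i) x = (\<Sum>i\<in>S. f i x)"
  for f :: "'i \<Rightarrow> 'b \<Rightarrow> 'c::comm_monoid_add"
  by (induction S rule: infinite_finite_induct) auto

lemma coord_space_expand:
  assumes "finite S" "x \<in> coord_space S"
  shows "x = (\<Sum>j\<in>S. pointwise_scale (x j) (unit_vec j :: 'j \<Rightarrow> 'a::field))"
proof
  fix l
  have "(\<Sum>j\<in>S. x j * unit_vec j l) = (\<Sum>j\<in>S. if j = l then x j else 0)"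
    by (intro sum.cong refl) (auto simp: unit_vec_def)
  then show "x l = (\<Sum>j\<in>S. pointwise_scale (x j) (unit_vec j)) l"
    using assms by (auto simp: sum_fun_apply coord_space_def)
qed

lemma unit_vec_in_coord_space: "j \<in> S \<Longrightarrow> unit_vec j \<in> coord_space S"
  unfolding unit_vec_def coord_space_def by auto

lemma subspace_coord_space: "module.subspace pointwise_scale (coord_space S :: ('j \<Rightarrow> 'a::field) set)"
proof -
  interpret vector_space "pointwise_scale :: 'a \<Rightarrow> ('j \<Rightarrow> 'a) \<Rightarrow> 'j \<Rightarrow> 'a" by (rule vector_space_pointwise)
  show ?thesis by (rule subspaceI) (auto simp: coord_space_def, metis add.right_neutral)
qed

lemma span_unit_vecs:
  assumes "finite S"
  shows "module.span pointwise_scale (unit_vec ` S) = (coord_space S :: ('j \<Rightarrow> 'a::field) set)"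
proof -
  interpret vector_space "pointwise_scale :: 'a \<Rightarrow> ('j \<Rightarrow> 'a) \<Rightarrow> 'j \<Rightarrow> 'a" by (rule vector_space_pointwise)
  show ?thesis
  proof (rule span_subspace)
    show "unit_vec ` S \<subseteq> (coord_space S :: ('j \<Rightarrow> 'a) set)" using unit_vec_in_coord_space by auto
    show "coord_space S \<subseteq> span (unit_vec ` S)"
    proof
      fix x :: "'j \<Rightarrow> 'a" assume x: "x \<in> coord_space S"
      show "x \<in> span (unit_vec ` S)"
        by (subst coord_space_expand[OF assms x]) (intro span_sum span_scale span_base imageI)
    qed
  qed (rule subspace_coord_space)
qed

lemma fd_subspace_coord_space:
  "finite S \<Longrightarrow> fd_subspace pointwise_scale (coord_space S :: ('j \<Rightarrow> 'a::field) set)"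
  unfolding fd_subspace_def using subspace_coord_space span_unit_vecs by blast

lemma card_le_of_coord_space_injection:
  fixes f :: "('j \<Rightarrow> 'a::field) \<Rightarrow> 'k \<Rightarrow> 'a"
  assumes "finite S" "finite T"
    and f: "linear_between pointwise_scale (coord_space S) pointwise_scale (coord_space T) f"
    and inj: "inj_on f (coord_space S)"
  shows "card S \<le> card T"
proof -
  interpret j: vector_space "pointwise_scale :: 'a \<Rightarrow> ('j \<Rightarrow> 'a) \<Rightarrow> 'j \<Rightarrow> 'a" by (rule vector_space_pointwise)
  interpret k: vector_space "pointwise_scale :: 'a \<Rightarrow> ('k \<Rightarrow> 'a) \<Rightarrow> 'k \<Rightarrow> 'a" by (rule vector_space_pointwise)
  have inj_unit: "inj_on (unit_vec :: 'j \<Rightarrow> 'j \<Rightarrow> 'a) X" "inj_on (unit_vec :: 'k \<Rightarrow> 'k \<Rightarrow> 'a) Y" for X Y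
    by (rule inj_onI, simp add: unit_vec_def fun_eq_iff, metis zero_neq_one)+
  have inj': "inj_on (\<lambda>j. f (unit_vec j)) S"
  proof (rule inj_onI)
    fix i j assume ij: "i \<in> S" "j \<in> S" "f (unit_vec i) = f (unit_vec j)"
    then have "unit_vec i = (unit_vec j :: 'j \<Rightarrow> 'a)"
      by (intro inj_onD[OF inj] unit_vec_in_coord_space)
    then show "i = j" using inj_onD[OF inj_unit(1)] ij by blast
  qed
  have "k.independent ((\<lambda>j. f (unit_vec j)) ` S)"
  proof (rule k.independent_if_scalars_zero)
    fix u v assume sum0: "(\<Sum>v\<in>(\<lambda>j. f (unit_vec j)) ` S. pointwise_scale (u v) v) = 0"
      and "v \<in> (\<lambda>j. f (unit_vec j)) ` S"
    then obtain j where j: "j \<in> S" "v = f (unit_vec j)" by blast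
    define w where "w = (\<lambda>j. if j \<in> S then u (f (unit_vec j)) else 0)"
    have w: "w \<in> coord_space S" unfolding w_def coord_space_def by auto
    have 0: "(0 :: 'j \<Rightarrow> 'a) \<in> coord_space S" by (simp add: coord_space_def)
    have "f w = (\<Sum>j\<in>S. pointwise_scale (w j) (f (unit_vec j)))"
      by (subst coord_space_expand[OF assms(1) w])
        (rule linear_between_sum[OF vector_space_pointwise vector_space_pointwise
            subspace_coord_space f unit_vec_in_coord_space])
    also have "\<dots> = 0" using sum0 by (simp add: sum.reindex[OF inj'] w_def)
    also have "\<dots> = f 0"
      using linear_betweenD(3)[OF f 0, of 0] by (simp add: zero_fun_def)
    finally have "w = 0" using inj w 0 by (simp add: inj_on_def)
    then have "w j = 0" by simp
    then show "u v = 0" using j unfolding w_def by simp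
  qed (use assms in simp)
  moreover have "(\<lambda>j. f (unit_vec j)) ` S \<subseteq> k.span (unit_vec ` T)"
    unfolding span_unit_vecs[OF assms(2)]
    by (rule image_subsetI) (rule linear_betweenD(1)[OF f unit_vec_in_coord_space])
  ultimately have "card ((\<lambda>j. f (unit_vec j)) ` S) \<le> card (unit_vec ` T :: ('k \<Rightarrow> 'a) set)"
    by (intro conjunct2[OF k.independent_span_bound] finite_imageI assms(2))
  then show ?thesis by (simp add: card_image inj' inj_unit)
qed

section \<open>Sums of interval modules\<close>

text \<open>
  The index type is arbitrary, unlike in \<^const>\<open>interval_sum\<close>: bases, direct sums and reflections come with
  index sets of their own, and only the multiset of intervals matters up to isomorphism.
\<close>

definition bar_module ::
  "(nat \<Rightarrow> direction) \<Rightarrow> 'j set \<Rightarrow> ('j \<Rightarrow> nat \<times> nat) \<Rightarrow> ('a::field, 'j \<Rightarrow> 'a) zigzag" where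
  "bar_module \<tau> J iv = zz_family_sum \<tau> J (\<lambda>j. interval_module \<tau> (iv j))"

definition covers :: "nat \<times> nat \<Rightarrow> nat \<Rightarrow> bool" where
  "covers I i \<longleftrightarrow> fst I \<le> i \<and> i \<le> snd I"

lemma bar_module_simps [simp]:
  "zz_scale (bar_module \<tau> J iv) = pointwise_scale"
  "zz_dir (bar_module \<tau> J iv) = \<tau>"
  "zz_map (bar_module \<tau> J iv) i x = (\<lambda>j. if j \<in> J \<and> covers (iv j) i \<and> covers (iv j) (i + 1) then x j else 0)"
  "zz_space (bar_module \<tau> J iv) i = coord_space {j\<in>J. covers (iv j) i}"
  unfolding bar_module_def zz_family_sum_def interval_module_def coord_space_def covers_def
  by (auto simp: split_beta fun_eq_iff)

lemma bar_map_unit_vec: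
  "zz_map (bar_module \<tau> J iv) i (unit_vec j) =
    (if j \<in> J \<and> covers (iv j) i \<and> covers (iv j) (i + 1) then unit_vec j else 0)"
  by (auto simp: unit_vec_def fun_eq_iff)

lemma zigzag_module_bar_module:
  assumes "finite J"
  shows "zigzag_module n (bar_module \<tau> J iv :: ('a::field, 'j \<Rightarrow> 'a) zigzag)"
  unfolding zigzag_module_def
proof (intro conjI ballI)
  show "linear_between (zz_scale (bar_module \<tau> J iv)) (zz_source (bar_module \<tau> J iv) i)
     (zz_scale (bar_module \<tau> J iv)) (zz_target (bar_module \<tau> J iv) i)
     (zz_map (bar_module \<tau> J iv :: ('a, 'j \<Rightarrow> 'a) zigzag) i)" for i
    by (rule linear_betweenI)
      (auto simp: zz_source_def zz_target_def coord_space_def fun_eq_iff split: direction.splits)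
qed (use assms in \<open>simp_all add: vector_space_pointwise fd_subspace_coord_space\<close>)

lemma interval_sum_eq_bar_module:
  "interval_sum \<tau> D = bar_module \<tau> {(x, j). j < count D x} fst"
  unfolding interval_sum_def bar_module_def by (simp add: case_prod_unfold)

lemma zigzag_module_interval_sum: "zigzag_module n (interval_sum \<tau> D)"
  unfolding interval_sum_eq_bar_module by (rule zigzag_module_bar_module[OF finite_copies])

lemma bar_module_iso_direction:
  assumes "\<And>i. i \<in> {1..<n} \<Longrightarrow> \<tau> i = \<tau>' i"
  shows "zz_iso n (bar_module \<tau> J iv :: ('a::field, 'j \<Rightarrow> 'a) zigzag) (bar_module \<tau>' J iv :: ('a, 'j \<Rightarrow> 'a) zigzag)"
  by (rule zz_isoI[where f = "\<lambda>i x. x"])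
    (use assms in \<open>auto simp: same_type_def linear_between_def bij_betw_def\<close>)

lemma bar_module_iso_reindex:
  fixes iv :: "'j \<Rightarrow> nat \<times> nat" and iv' :: "'k \<Rightarrow> nat \<times> nat"
  assumes bij: "bij_betw \<sigma> J J'" and iv: "\<And>j. j \<in> J \<Longrightarrow> iv' (\<sigma> j) = iv j"
  shows "zz_iso n (bar_module \<tau> J iv :: ('a::field, 'j \<Rightarrow> 'a) zigzag) (bar_module \<tau> J' iv' :: ('a, 'k \<Rightarrow> 'a) zigzag)"
proof -
  define \<rho> where "\<rho> = inv_into J \<sigma>"
  have \<rho>: "\<rho> k \<in> J" "\<sigma> (\<rho> k) = k" "iv (\<rho> k) = iv' k" if "k \<in> J'" for k
  proof -
    show "\<rho> k \<in> J" "\<sigma> (\<rho> k) = k"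
      using bij that unfolding \<rho>_def by (auto simp: bij_betw_def inv_into_into f_inv_into_f)
    then show "iv (\<rho> k) = iv' k" using iv by metis
  qed
  have \<sigma>: "\<sigma> j \<in> J'" "\<rho> (\<sigma> j) = j" if "j \<in> J" for j
    using bij that unfolding \<rho>_def by (auto simp: bij_betw_def)
  define f :: "('j \<Rightarrow> 'a) \<Rightarrow> 'k \<Rightarrow> 'a" where "f x = (\<lambda>k. if k \<in> J' then x (\<rho> k) else 0)" for x
  define g :: "('k \<Rightarrow> 'a) \<Rightarrow> 'j \<Rightarrow> 'a" where "g y = (\<lambda>j. if j \<in> J then y (\<sigma> j) else 0)" for y
  show ?thesis
  proof (rule zz_isoI[where f = "\<lambda>i. f"])
    show "bij_betw f (zz_space (bar_module \<tau> J iv) i) (zz_space (bar_module \<tau> J' iv') i)" for i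
      by (rule bij_betw_byWitness[where f' = g])
        (auto simp: f_def g_def coord_space_def fun_eq_iff \<rho> \<sigma> iv split: if_splits)
  qed (auto simp: same_type_def f_def linear_between_def coord_space_def fun_eq_iff \<rho> \<sigma> iv split: if_splits)
qed

lemma bar_module_iso_of_image_mset_eq:
  fixes iv :: "'j \<Rightarrow> nat \<times> nat" and iv' :: "'k \<Rightarrow> nat \<times> nat"
  assumes fin: "finite J" "finite J'"
    and eq: "image_mset iv (mset_set J) = image_mset iv' (mset_set J')"
  shows "zz_iso n (bar_module \<tau> J iv :: ('a::field, 'j \<Rightarrow> 'a) zigzag) (bar_module \<tau> J' iv' :: ('a, 'k \<Rightarrow> 'a) zigzag)"
proof -
  have "card {s\<in>J. iv s = x} \<le> card {t\<in>J'. iv' t = x}" for x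
    using eq fin by (simp flip: count_image_mset_set)
  then obtain F where F: "inj_on F J" "F ` J \<subseteq> J'" "\<forall>j\<in>J. iv' (F j) = iv j"
    using fibrewise_injection[OF fin] by blast
  have "card J = card J'" using arg_cong[OF eq, of size] by simp
  then have "F ` J = J'" using F(1,2) fin(2) by (metis card_image card_subset_eq)
  then have "bij_betw F J J'" using F(1) unfolding bij_betw_def by simp
  then show ?thesis using F(3) by (intro bar_module_iso_reindex) auto
qed

lemma bar_module_iso_sum:
  fixes V :: "('a::field, 'v::ab_group_add) zigzag" and W :: "('a, 'w::ab_group_add) zigzag"
    and iv :: "'j \<Rightarrow> nat \<times> nat" and kv :: "'k \<Rightarrow> nat \<times> nat"
  assumes V: "zz_iso n (bar_module \<tau> J iv :: ('a, 'j \<Rightarrow> 'a) zigzag) V"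
    and W: "zz_iso n (bar_module \<tau> K kv :: ('a, 'k \<Rightarrow> 'a) zigzag) W"
  shows "zz_iso n (bar_module \<tau> (J <+> K) (case_sum iv kv) :: ('a, 'j + 'k \<Rightarrow> 'a) zigzag) (zz_sum V W)"
proof -
  let ?V = "bar_module \<tau> J iv :: ('a, 'j \<Rightarrow> 'a) zigzag"
  let ?W = "bar_module \<tau> K kv :: ('a, 'k \<Rightarrow> 'a) zigzag"
  let ?S = "bar_module \<tau> (J <+> K) (case_sum iv kv) :: ('a, 'j + 'k \<Rightarrow> 'a) zigzag"
  from V obtain f where "iso_family n ?V V f" by (rule zz_isoE)
  note f = iso_familyD[OF this]
  from W obtain g where "iso_family n ?W W g" by (rule zz_isoE)
  note g = iso_familyD[OF this]
  define h where "h i x = (f i (\<lambda>j. x (Inl j)), g i (\<lambda>k. x (Inr k)))" for i and x :: "'j + 'k \<Rightarrow> 'a"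
  define split where "split x = ((\<lambda>j. x (Inl j)), (\<lambda>k. x (Inr k)))" for x :: "'j + 'k \<Rightarrow> 'a"
  have parts: "(\<lambda>j. x (Inl j)) \<in> zz_space ?V i" "(\<lambda>k. x (Inr k)) \<in> zz_space ?W i"
    if "x \<in> zz_space ?S i" for x i
    using that by (auto simp: coord_space_def)
  have map: "(\<lambda>j. zz_map ?S i x (Inl j)) = zz_map ?V i (\<lambda>j. x (Inl j))"
    "(\<lambda>k. zz_map ?S i x (Inr k)) = zz_map ?W i (\<lambda>k. x (Inr k))" for i x by auto
  show ?thesis
  proof (rule zz_isoI[where f = h])
    show "same_type n ?S (zz_sum V W)" using f(1) unfolding same_type_def zz_sum_def by simp
  next
    fix i assume i: "i \<in> {1..n}"
    show "linear_between (zz_scale ?S) (zz_space ?S i) (zz_scale (zz_sum V W)) (zz_space (zz_sum V W) i) (h i)"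
    proof (rule linear_betweenI)
      show "h i x \<in> zz_space (zz_sum V W) i" if "x \<in> zz_space ?S i" for x
        using linear_betweenD(1)[OF f(2)[OF i] parts(1)[OF that]]
          linear_betweenD(1)[OF g(2)[OF i] parts(2)[OF that]] by (simp add: h_def zz_sum_def)
      show "h i (x + y) = h i x + h i y" if "x \<in> zz_space ?S i" "y \<in> zz_space ?S i" for x y
        using linear_betweenD(2)[OF f(2)[OF i] parts(1)[OF that(1)] parts(1)[OF that(2)]]
          linear_betweenD(2)[OF g(2)[OF i] parts(2)[OF that(1)] parts(2)[OF that(2)]]
        by (simp add: h_def plus_fun_def)
      show "h i (zz_scale ?S c x) = zz_scale (zz_sum V W) c (h i x)" if "x \<in> zz_space ?S i" for c x
        using linear_betweenD(3)[OF f(2)[OF i] parts(1)[OF that], of c]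
          linear_betweenD(3)[OF g(2)[OF i] parts(2)[OF that], of c]
        by (simp add: h_def zz_sum_def)
    qed
    have "bij_betw split (zz_space ?S i) (zz_space ?V i \<times> zz_space ?W i)"
      by (rule bij_betw_byWitness[where f' = "\<lambda>(x, y). case_sum x y"])
        (auto simp: split_def coord_space_def fun_eq_iff split: sum.splits)
    moreover have "bij_betw (map_prod (f i) (g i)) (zz_space ?V i \<times> zz_space ?W i) (zz_space V i \<times> zz_space W i)"
      by (rule bij_betw_map_prod[OF f(3)[OF i] g(3)[OF i]])
    ultimately have "bij_betw (map_prod (f i) (g i) \<circ> split) (zz_space ?S i) (zz_space V i \<times> zz_space W i)"
      by (rule bij_betw_trans)
    moreover have "map_prod (f i) (g i) \<circ> split = h i" by (simp add: fun_eq_iff h_def split_def)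
    ultimately show "bij_betw (h i) (zz_space ?S i) (zz_space (zz_sum V W) i)"
      by (simp add: zz_sum_def)
  next
    fix i x assume i: "i \<in> {1..<n}" and d: "zz_dir ?S i = Forward" and x: "x \<in> zz_space ?S i"
    have "zz_dir ?V i = Forward" "zz_dir ?W i = Forward" using d by simp_all
    from f(4)[OF i this(1) parts(1)[OF x]] g(4)[OF i this(2) parts(2)[OF x]]
    show "h (i + 1) (zz_map ?S i x) = zz_map (zz_sum V W) i (h i x)"
      unfolding h_def map by (simp add: zz_sum_def)
  next
    fix i x assume i: "i \<in> {1..<n}" and d: "zz_dir ?S i = Backward" and x: "x \<in> zz_space ?S (i + 1)"
    have "zz_dir ?V i = Backward" "zz_dir ?W i = Backward" using d by simp_all
    from f(5)[OF i this(1) parts(1)[OF x]] g(5)[OF i this(2) parts(2)[OF x]]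
    show "h i (zz_map ?S i x) = zz_map (zz_sum V W) i (h (i + 1) x)"
      unfolding h_def map by (simp add: zz_sum_def)
  qed
qed

definition valid_bar :: "nat \<Rightarrow> nat \<times> nat \<Rightarrow> bool" where
  "valid_bar n I \<longleftrightarrow> 1 \<le> fst I \<and> fst I \<le> snd I \<and> snd I \<le> n"

text \<open>
  The isomorphism starts at the sum of intervals, which is known to be a zigzag module, so that it can be
  inverted without assumptions on \<open>V\<close>.
\<close>

definition barcode :: "nat \<Rightarrow> ('a::field, 'v::ab_group_add) zigzag \<Rightarrow> (nat \<times> nat) multiset \<Rightarrow> bool" where
  "barcode n V D \<longleftrightarrow> (\<forall>I\<in>#D. valid_bar n I) \<and>
     zz_iso n (interval_sum (zz_dir V) D :: ('a, 'a univ) zigzag) V"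

lemma barcodeI:
  fixes V :: "('a::field, 'v::ab_group_add) zigzag" and iv :: "'j \<Rightarrow> nat \<times> nat"
  assumes fin: "finite J" and valid: "\<And>j. j \<in> J \<Longrightarrow> valid_bar n (iv j)"
    and iso: "zz_iso n (bar_module \<tau> J iv :: ('a, 'j \<Rightarrow> 'a) zigzag) V"
  shows "barcode n V (image_mset iv (mset_set J))"
proof -
  let ?D = "image_mset iv (mset_set J)"
  have "zz_iso n (bar_module (zz_dir V) {(x, j). j < count ?D x} fst :: ('a, 'a univ) zigzag)
      (bar_module (zz_dir V) J iv :: ('a, 'j \<Rightarrow> 'a) zigzag)"
    by (rule bar_module_iso_of_image_mset_eq[OF finite_copies fin image_fst_copies])
  also have dir: "zz_iso n (bar_module (zz_dir V) J iv :: ('a, 'j \<Rightarrow> 'a) zigzag)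
      (bar_module \<tau> J iv :: ('a, 'j \<Rightarrow> 'a) zigzag)"
    by (rule bar_module_iso_direction) (use same_type_dir[OF zz_iso_same_type[OF iso]] in simp)
  finally (zz_iso_trans) have "zz_iso n (interval_sum (zz_dir V) ?D :: ('a, 'a univ) zigzag) V"
    unfolding interval_sum_eq_bar_module using zz_iso_trans iso by blast
  then show ?thesis unfolding barcode_def using valid fin by simp
qed

section \<open>Uniqueness of the interval decomposition\<close>

text \<open>
  There is a homomorphism from the interval module of \<open>I\<close> to that of \<open>K\<close> that is non-zero at the left endpoint
  of \<open>I\<close>.  It is constant on the intersection of the intervals; the conditions are its commuting
  squares at the two ends of the intersection.
\<close>

definition hom_bar :: "(nat \<Rightarrow> direction) \<Rightarrow> nat \<times> nat \<Rightarrow> nat \<times> nat \<Rightarrow> bool" where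
  "hom_bar \<tau> I K \<longleftrightarrow> covers K (fst I) \<and> (fst K < fst I \<longrightarrow> \<tau> (fst I - 1) = Forward) \<and>
     (snd I < snd K \<longrightarrow> \<tau> (snd I) = Backward) \<and> (snd K < snd I \<longrightarrow> \<tau> (snd K) = Forward)"

definition compatible_at :: "('a, 'v) zigzag \<Rightarrow> nat \<Rightarrow> (nat \<Rightarrow> 'v) \<Rightarrow> bool" where
  "compatible_at V i x \<longleftrightarrow> (if zz_dir V i = Forward then zz_map V i (x i) = x (i + 1)
     else zz_map V i (x (i + 1)) = x i)"

text \<open>
  Homomorphisms from the interval module of \<open>I\<close> to \<open>V\<close> are compatible families of vectors over \<open>I\<close> that are
  mapped to zero by the arrows leaving \<open>I\<close>; collected are their values at the left endpoint.
\<close>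

definition hom_values :: "nat \<Rightarrow> ('a, 'v::zero) zigzag \<Rightarrow> nat \<times> nat \<Rightarrow> 'v set" where
  "hom_values n V I = {v. \<exists>x. v = x (fst I) \<and>
     (\<forall>i. fst I \<le> i \<longrightarrow> i \<le> snd I \<longrightarrow> x i \<in> zz_space V i) \<and>
     (\<forall>i. fst I \<le> i \<longrightarrow> i < snd I \<longrightarrow> compatible_at V i x) \<and>
     (1 < fst I \<longrightarrow> zz_dir V (fst I - 1) = Backward \<longrightarrow> zz_map V (fst I - 1) (x (fst I)) = 0) \<and>
     (snd I < n \<longrightarrow> zz_dir V (snd I) = Forward \<longrightarrow> zz_map V (snd I) (x (snd I)) = 0)}"

lemma hom_valuesE:
  assumes "v \<in> hom_values n V (b, d)"
  obtains x where "v = x b" "\<And>i. b \<le> i \<Longrightarrow> i \<le> d \<Longrightarrow> x i \<in> zz_space V i"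
      "\<And>i. b \<le> i \<Longrightarrow> i < d \<Longrightarrow> compatible_at V i x"
      "1 < b \<Longrightarrow> zz_dir V (b - 1) = Backward \<Longrightarrow> zz_map V (b - 1) (x b) = 0"
      "d < n \<Longrightarrow> zz_dir V d = Forward \<Longrightarrow> zz_map V d (x d) = 0"
  using assms unfolding hom_values_def fst_conv snd_conv mem_Collect_eq by blast

lemma hom_valuesI:
  assumes "v = x b" "\<And>i. b \<le> i \<Longrightarrow> i \<le> d \<Longrightarrow> x i \<in> zz_space V i"
      "\<And>i. b \<le> i \<Longrightarrow> i < d \<Longrightarrow> compatible_at V i x"
      "1 < b \<Longrightarrow> zz_dir V (b - 1) = Backward \<Longrightarrow> zz_map V (b - 1) (x b) = 0"
      "d < n \<Longrightarrow> zz_dir V d = Forward \<Longrightarrow> zz_map V d (x d) = 0"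
  shows "v \<in> hom_values n V (b, d)"
  using assms unfolding hom_values_def fst_conv snd_conv mem_Collect_eq by blast

lemma direction_neq: "d \<noteq> Forward \<longleftrightarrow> d = Backward" "d \<noteq> Backward \<longleftrightarrow> d = Forward"
  by (cases d; simp)+

text \<open>
  Coordinatewise, a vector extends to a homomorphism exactly on those summands that receive one.
\<close>

lemma hom_values_bar_module:
  fixes J :: "'j set"
  assumes iv: "\<And>j. j \<in> J \<Longrightarrow> valid_bar n (iv j)" and I: "valid_bar n I"
  shows "hom_values n (bar_module \<tau> J iv :: ('a::field, 'j \<Rightarrow> 'a) zigzag) I =
    coord_space {j\<in>J. hom_bar \<tau> I (iv j)}"
proof (intro equalityI subsetI)
  let ?V = "bar_module \<tau> J iv :: ('a, 'j \<Rightarrow> 'a) zigzag"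
  obtain b d where bd: "I = (b, d)" by (cases I)
  have bd1: "1 \<le> b" "b \<le> d" "d \<le> n" using I unfolding bd valid_bar_def by auto
  {
    fix v assume "v \<in> hom_values n ?V I"
    then obtain x where x: "v = x b" "\<And>i. b \<le> i \<Longrightarrow> i \<le> d \<Longrightarrow> x i \<in> zz_space ?V i"
      "\<And>i. b \<le> i \<Longrightarrow> i < d \<Longrightarrow> compatible_at ?V i x"
      "1 < b \<Longrightarrow> zz_dir ?V (b - 1) = Backward \<Longrightarrow> zz_map ?V (b - 1) (x b) = 0"
      "d < n \<Longrightarrow> zz_dir ?V d = Forward \<Longrightarrow> zz_map ?V d (x d) = 0"
      unfolding bd by (rule hom_valuesE) blast
    have "j \<in> J \<and> hom_bar \<tau> I (iv j)" if vj: "v j \<noteq> 0" for j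
    proof -
      have j: "j \<in> J" "covers (iv j) b"
        using x(2)[of b] vj bd1 unfolding x(1) by (auto simp: coord_space_def)
      obtain b' d' where bd': "iv j = (b', d')" by (cases "iv j")
      have bd1': "1 \<le> b'" "b' \<le> d'" "d' \<le> n" "b' \<le> b" "b \<le> d'"
        using iv[OF j(1)] j(2) unfolding bd' valid_bar_def covers_def by auto
      have const: "x i j = v j" if "b \<le> i" "i \<le> d" "i \<le> d'" for i
        using that
      proof (induction i rule: dec_induct)
        case (step i)
        have "compatible_at ?V i x" using x(3) step by simp
        then have "x (i + 1) j = x i j"
          using j(1) step.prems step.hyps bd1'
          by (auto simp: compatible_at_def fun_eq_iff bd' covers_def split: if_splits
              dest!: spec[of _ j])
        then show ?case using step by simp
      qed (simp add: x(1))
      have "\<tau> (b - 1) = Forward" if "b' < b"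
      proof (rule ccontr)
        assume "\<tau> (b - 1) \<noteq> Forward"
        then have "zz_map ?V (b - 1) (x b) = 0" using x(4) that bd1' by (simp add: direction_neq)
        then have "zz_map ?V (b - 1) (x b) j = 0" by simp
        moreover have "b' \<le> b - 1 \<and> b - 1 \<le> d'" using that bd1' by linarith
        ultimately show False using j that bd1' vj unfolding x(1)[symmetric] by (simp add: bd' covers_def)
      qed
      moreover have "\<tau> d = Backward" if "d < d'"
      proof (rule ccontr)
        assume "\<tau> d \<noteq> Backward"
        then have "zz_map ?V d (x d) = 0" using x(5) that bd1' by (simp add: direction_neq)
        then have "zz_map ?V d (x d) j = 0" by simp
        then show False using j that bd1 bd1' vj const[of d] by (simp add: bd' covers_def)
      qed
      moreover have "\<tau> d' = Forward" if "d' < d"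
      proof (rule ccontr)
        assume "\<tau> d' \<noteq> Forward"
        then have "zz_map ?V d' (x (d' + 1)) = x d'"
          using x(3)[of d'] that bd1' by (simp add: compatible_at_def)
        then have "zz_map ?V d' (x (d' + 1)) j = x d' j" by simp
        then show False using that bd1' vj const[of d'] by (simp add: bd' covers_def)
      qed
      ultimately show ?thesis using j unfolding hom_bar_def bd bd' by simp
    qed
    then show "v \<in> coord_space {j\<in>J. hom_bar \<tau> I (iv j)}" unfolding coord_space_def by blast
  }
  fix v :: "'j \<Rightarrow> 'a" assume v: "v \<in> coord_space {j\<in>J. hom_bar \<tau> I (iv j)}"
  define x where "x i = (\<lambda>j. if covers (iv j) i then v j else 0)" for i
  have hom: "j \<in> J" "covers (iv j) b" "fst (iv j) < b \<Longrightarrow> \<tau> (b - 1) = Forward"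
    "d < snd (iv j) \<Longrightarrow> \<tau> d = Backward" "snd (iv j) < d \<Longrightarrow> \<tau> (snd (iv j)) = Forward"
    if "v j \<noteq> 0" for j
    using v that unfolding coord_space_def hom_bar_def bd by auto
  have "x b = v" using hom(2) unfolding x_def by (auto simp: fun_eq_iff)
  moreover have "x i \<in> zz_space ?V i" for i
    using hom(1) by (auto simp: x_def coord_space_def)
  moreover have "compatible_at ?V i x" if i: "b \<le> i" "i < d" for i
  proof (cases "\<tau> i")
    case Forward
    have "zz_map ?V i (x i) j = x (i + 1) j" for j
      using hom(1,2)[of j] i by (cases "v j = 0") (auto simp: x_def covers_def)
    then show ?thesis using Forward unfolding compatible_at_def by (auto simp: fun_eq_iff)
  next
    case Backward
    have "zz_map ?V i (x (i + 1)) j = x i j" for j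
    proof (cases "v j = 0 \<or> \<not> covers (iv j) i \<or> covers (iv j) (i + 1)")
      case True
      then show ?thesis using hom(1)[of j] by (auto simp: x_def)
    next
      case False
      then have "snd (iv j) = i" by (auto simp: covers_def)
      then show ?thesis using hom(5)[of j] False i Backward by simp
    qed
    then show ?thesis using Backward unfolding compatible_at_def by (auto simp: fun_eq_iff)
  qed
  moreover have "zz_map ?V (b - 1) (x b) = 0" if "1 < b" "\<tau> (b - 1) = Backward"
  proof -
    have "fst (iv j) < b" if "fst (iv j) \<le> b - 1" for j using that \<open>1 < b\<close> by linarith
    then show ?thesis using hom(3) that by (auto simp: fun_eq_iff x_def covers_def)
  qed
  moreover have "zz_map ?V d (x d) = 0" if "\<tau> d = Forward"
    using hom(4) that by (auto simp: fun_eq_iff x_def covers_def Suc_le_eq)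
  ultimately show "v \<in> hom_values n ?V I"
    unfolding bd by (intro hom_valuesI[of v x]) (simp_all del: bar_module_simps(3,4))
qed

text \<open>
  An isomorphism carries homomorphisms to homomorphisms, hence embeds one space of values into the other.
\<close>

lemma card_hom_bar_le:
  fixes iv :: "'j \<Rightarrow> nat \<times> nat" and iv' :: "'k \<Rightarrow> nat \<times> nat"
  assumes fin: "finite J" "finite J'"
    and iv: "\<And>j. j \<in> J \<Longrightarrow> valid_bar n (iv j)" and iv': "\<And>j. j \<in> J' \<Longrightarrow> valid_bar n (iv' j)"
    and I: "valid_bar n I"
    and iso: "zz_iso n (bar_module \<tau> J iv :: ('a::field, 'j \<Rightarrow> 'a) zigzag)
      (bar_module \<tau> J' iv' :: ('a, 'k \<Rightarrow> 'a) zigzag)"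
  shows "card {j\<in>J. hom_bar \<tau> I (iv j)} \<le> card {j\<in>J'. hom_bar \<tau> I (iv' j)}"
proof -
  let ?V = "bar_module \<tau> J iv :: ('a, 'j \<Rightarrow> 'a) zigzag"
  let ?W = "bar_module \<tau> J' iv' :: ('a, 'k \<Rightarrow> 'a) zigzag"
  obtain b d where bd: "I = (b, d)" by (cases I)
  have bd1: "1 \<le> b" "b \<le> d" "d \<le> n" using I unfolding bd valid_bar_def by auto
  from iso obtain f where "iso_family n ?V ?W f" by (rule zz_isoE)
  note f = iso_familyD[OF this]
  have f0: "f i 0 = 0" if "i \<in> {1..n}" for i
  proof -
    have "(0 :: 'j \<Rightarrow> 'a) \<in> zz_space ?V i" by (simp add: coord_space_def)
    from linear_betweenD(3)[OF f(2)[OF that] this, of 0] show ?thesis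
      by (simp add: zero_fun_def)
  qed
  have preserved: "f b v \<in> hom_values n ?W I" if v: "v \<in> hom_values n ?V I" for v
  proof -
    from v obtain x where x: "v = x b" and xV: "\<And>i. b \<le> i \<Longrightarrow> i \<le> d \<Longrightarrow> x i \<in> zz_space ?V i"
      and x': "\<And>i. b \<le> i \<Longrightarrow> i < d \<Longrightarrow> compatible_at ?V i x"
      "1 < b \<Longrightarrow> zz_dir ?V (b - 1) = Backward \<Longrightarrow> zz_map ?V (b - 1) (x b) = 0"
      "d < n \<Longrightarrow> zz_dir ?V d = Forward \<Longrightarrow> zz_map ?V d (x d) = 0"
      unfolding bd by (rule hom_valuesE) blast
    have "f i (x i) \<in> zz_space ?W i" if "b \<le> i" "i \<le> d" for i
      by (rule linear_betweenD(1)[OF f(2) xV]) (use that bd1 in auto)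
    moreover have "compatible_at ?W i (\<lambda>i. f i (x i))" if i: "b \<le> i" "i < d" for i
    proof (cases "\<tau> i")
      case Forward
      then show ?thesis using f(4)[of i "x i"] x'(1)[of i] xV[of i] i bd1
        by (simp add: compatible_at_def del: bar_module_simps(3,4))
    next
      case Backward
      then show ?thesis using f(5)[of i "x (i + 1)"] x'(1)[of i] xV[of "i + 1"] i bd1
        by (simp add: compatible_at_def del: bar_module_simps(3,4))
    qed
    moreover have "zz_map ?W (b - 1) (f b (x b)) = 0" if "1 < b" "\<tau> (b - 1) = Backward"
    proof -
      have "b - 1 \<in> {1..<n}" "b - 1 \<in> {1..n}" using that bd1 by auto
      then show ?thesis using f(5)[of "b - 1" "x b"] x'(2) xV[of b] that bd1 f0[of "b - 1"]
        by (simp del: bar_module_simps(3,4))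
    qed
    moreover have "zz_map ?W d (f d (x d)) = 0" if "d < n" "\<tau> d = Forward"
      using f(4)[of d "x d"] x'(3) xV[of d] that bd1 f0[of "d + 1"]
      by (simp del: bar_module_simps(3,4))
    ultimately show ?thesis unfolding bd x
      by (intro hom_valuesI[where x = "\<lambda>i. f i (x i)"]) (simp_all del: bar_module_simps(3,4))
  qed
  have b: "b \<in> {1..n}" using bd1 by simp
  have sub: "coord_space {j\<in>J. hom_bar \<tau> I (iv j)} \<subseteq> zz_space ?V b"
    by (auto simp: coord_space_def hom_bar_def bd)
  have valV: "hom_values n ?V I = coord_space {j\<in>J. hom_bar \<tau> I (iv j)}"
    by (rule hom_values_bar_module[OF iv I])
  have valW: "hom_values n ?W I = coord_space {j\<in>J'. hom_bar \<tau> I (iv' j)}"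
    by (rule hom_values_bar_module[OF iv' I])
  have "linear_between pointwise_scale (coord_space {j\<in>J. hom_bar \<tau> I (iv j)})
     pointwise_scale (coord_space {j\<in>J'. hom_bar \<tau> I (iv' j)}) (f b)"
  proof (rule linear_betweenI)
    show "f b x \<in> coord_space {j\<in>J'. hom_bar \<tau> I (iv' j)}"
      if "x \<in> coord_space {j\<in>J. hom_bar \<tau> I (iv j)}" for x
      using preserved[of x] that unfolding valV valW .
    show "f b (x + y) = f b x + f b y"
      if "x \<in> coord_space {j\<in>J. hom_bar \<tau> I (iv j)}" "y \<in> coord_space {j\<in>J. hom_bar \<tau> I (iv j)}"
      for x y using linear_betweenD(2)[OF f(2)[OF b]] sub that by blast
    show "f b (pointwise_scale c x) = pointwise_scale c (f b x)"
      if "x \<in> coord_space {j\<in>J. hom_bar \<tau> I (iv j)}" for c x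
      using linear_betweenD(3)[OF f(2)[OF b], of x c] sub that unfolding bar_module_simps(1) by blast
  qed
  moreover have "inj_on (f b) (coord_space {j\<in>J. hom_bar \<tau> I (iv j)})"
    using f(3)[OF b] sub unfolding bij_betw_def by (blast intro: inj_on_subset)
  ultimately show ?thesis
    using fin by (intro card_le_of_coord_space_injection) simp_all
qed

text \<open>
  Apart from the diagonal, \<^const>\<open>hom_bar\<close> only relates \<open>I\<close> to intervals that are smaller for the key \<open>\<mu>\<close> below,
  so the multiplicities can be recovered by induction along \<open>\<mu>\<close>.
\<close>

lemma multiset_eq_of_hom_bar_sizes:
  assumes valid: "\<And>I. I \<in># D \<Longrightarrow> valid_bar n I" "\<And>I. I \<in># D' \<Longrightarrow> valid_bar n I"
    and eq: "\<And>I. valid_bar n I \<Longrightarrow>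
      size (filter_mset (hom_bar \<tau> I) D) = size (filter_mset (hom_bar \<tau> I) D')"
  shows "D = D'"
proof (rule ccontr)
  \<comment> \<open>Two right ends are compared by the arrow just after the shorter interval; the offset \<open>2 * (n + 1)\<close> keeps the two kinds apart.\<close>
  define l where "l d = (if \<tau> d = Forward then d else 2 * (n + 1) - d)" for d
  \<comment> \<open>The lexicographic key: \<open>l\<close> is less than \<open>2 * n + 3\<close>.\<close>
  define \<mu> where "\<mu> I = fst I * (2 * n + 3) + l (snd I)" for I
  assume "D \<noteq> D'"
  then obtain I0 where "count D I0 \<noteq> count D' I0" by (metis multiset_eqI)
  from ex_has_least_nat[of "\<lambda>I. count D I \<noteq> count D' I", OF this, of \<mu>]
  obtain I where I: "count D I \<noteq> count D' I"
    and least: "\<And>K. count D K \<noteq> count D' K \<Longrightarrow> \<mu> I \<le> \<mu> K" by blast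
  have val: "valid_bar n K" if "count D K \<noteq> count D' K" for K
    using that valid[of K] by (metis not_in_iff)
  have less: "\<mu> K < \<mu> I" if hom: "hom_bar \<tau> I K" and K: "K \<noteq> I" "valid_bar n K" for K
  proof -
    have bI: "snd I \<le> n" "snd K \<le> n" using val[OF I] K unfolding valid_bar_def by auto
    have le: "fst K \<le> fst I" using hom unfolding hom_bar_def covers_def by simp
    show ?thesis
    proof (cases "fst K = fst I")
      case True
      then have ne: "snd K \<noteq> snd I" using K(1) by (metis prod.expand)
      have "l (snd K) < l (snd I)"
      proof (cases "snd I < snd K")
        case True
        then have "\<tau> (snd I) = Backward" using hom unfolding hom_bar_def by simp
        then show ?thesis using True bI unfolding l_def by auto
      next
        case False
        then have "\<tau> (snd K) = Forward" "snd K < snd I" using hom ne unfolding hom_bar_def by auto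
        then show ?thesis using bI unfolding l_def by auto
      qed
      then show ?thesis using True unfolding \<mu>_def by simp
    next
      case False
      then have "(fst K + 1) * (2 * n + 3) \<le> fst I * (2 * n + 3)" using le by (intro mult_le_mono1) simp
      moreover have "l (snd K) \<le> 2 * n + 2" using bI unfolding l_def by auto
      ultimately show ?thesis unfolding \<mu>_def by (simp add: algebra_simps)
    qed
  qed
  let ?P = "\<lambda>K. hom_bar \<tau> I K \<and> K \<noteq> I"
  have self: "hom_bar \<tau> I I" using val[OF I] unfolding hom_bar_def covers_def valid_bar_def by simp
  \<comment> \<open>The first summand is the diagonal entry; the second one agrees for \<open>D\<close> and \<open>D'\<close> by minimality of \<open>I\<close>.\<close>
  have split: "size (filter_mset (hom_bar \<tau> I) E) = count E I + size (filter_mset ?P E)" for E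
  proof -
    have "filter_mset (hom_bar \<tau> I) E = replicate_mset (count E I) I + filter_mset ?P E"
      using self by (intro multiset_eqI) auto
    then show ?thesis by simp
  qed
  have "filter_mset ?P D = filter_mset ?P D'"
  proof (rule multiset_eqI)
    fix K
    have "count D K = count D' K" if "?P K"
    proof (rule ccontr)
      assume "count D K \<noteq> count D' K"
      then show False using least[of K] less[of K] val[of K] that by simp
    qed
    then show "count (filter_mset ?P D) K = count (filter_mset ?P D') K" by simp
  qed
  then show False using eq[OF val[OF I]] I unfolding split by simp
qed

theorem bars_unique:
  fixes iv :: "'j \<Rightarrow> nat \<times> nat" and iv' :: "'k \<Rightarrow> nat \<times> nat"
  assumes fin: "finite J" "finite J'"
    and iv: "\<And>j. j \<in> J \<Longrightarrow> valid_bar n (iv j)" and iv': "\<And>j. j \<in> J' \<Longrightarrow> valid_bar n (iv' j)"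
    and iso: "zz_iso n (bar_module \<tau> J iv :: ('a::field, 'j \<Rightarrow> 'a) zigzag)
      (bar_module \<tau> J' iv' :: ('a, 'k \<Rightarrow> 'a) zigzag)"
  shows "image_mset iv (mset_set J) = image_mset iv' (mset_set J')"
proof (rule multiset_eq_of_hom_bar_sizes)
  fix I assume I: "valid_bar n I"
  have "size (filter_mset (hom_bar \<tau> I) (image_mset h (mset_set S))) = card {j\<in>S. hom_bar \<tau> I (h j)}"
    if "finite S" for h :: "'x \<Rightarrow> nat \<times> nat" and S
    using that by (simp add: filter_mset_image_mset)
  note sizes = this
  have "card {j\<in>J. hom_bar \<tau> I (iv j)} = card {j\<in>J'. hom_bar \<tau> I (iv' j)}"
    using card_hom_bar_le[OF fin iv iv' I iso]
      card_hom_bar_le[OF fin(2,1) iv' iv I zz_iso_sym[OF zigzag_module_bar_module[OF fin(1)] iso]]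
    by simp
  then show "size (filter_mset (hom_bar \<tau> I) (image_mset iv (mset_set J))) =
      size (filter_mset (hom_bar \<tau> I) (image_mset iv' (mset_set J')))"
    unfolding sizes[OF fin(1)] sizes[OF fin(2)] .
qed (use fin iv iv' in auto)

lemma dgm_eqI:
  fixes V :: "('a::field, 'v::ab_group_add) zigzag"
  assumes "barcode n V D"
  shows "dgm n V = D"
  unfolding dgm_def
proof (rule the_equality)
  have D: "\<forall>I\<in>#D. valid_bar n I"
    and iso: "zz_iso n (interval_sum (zz_dir V) D :: ('a, 'a univ) zigzag) V"
    using assms unfolding barcode_def by auto
  show "(\<forall>(b, d)\<in>#D. 1 \<le> b \<and> b \<le> d \<and> d \<le> n) \<and>
      zz_iso n V (interval_sum (zz_dir V) D :: ('a, 'a univ) zigzag)"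
    using D zz_iso_sym[OF zigzag_module_interval_sum iso] by (auto simp: valid_bar_def)
  fix E assume E: "(\<forall>(b, d)\<in>#E. 1 \<le> b \<and> b \<le> d \<and> d \<le> n) \<and>
      zz_iso n V (interval_sum (zz_dir V) E :: ('a, 'a univ) zigzag)"
  then have E': "\<forall>I\<in>#E. valid_bar n I" by (auto simp: valid_bar_def)
  have "zz_iso n (interval_sum (zz_dir V) D :: ('a, 'a univ) zigzag)
      (interval_sum (zz_dir V) E :: ('a, 'a univ) zigzag)"
    using zz_iso_trans[OF iso] E by blast
  then have "image_mset fst (mset_set {(x, j). j < count D x}) =
      image_mset fst (mset_set {(x, j). j < count E x})"
    unfolding interval_sum_eq_bar_module
  proof (rule bars_unique[OF finite_copies finite_copies, rotated 2])
    have mem: "x \<in># F" if "j < count F x" for x j and F :: "(nat \<times> nat) multiset"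
      using that by (metis not_in_iff not_less_zero)
    show "valid_bar n (fst y)" if "y \<in> {(x, j). j < count D x}" for y
      using that D mem by auto
    show "valid_bar n (fst y)" if "y \<in> {(x, j). j < count E x}" for y
      using that E' mem by auto
  qed
  then show "E = D" unfolding image_fst_copies by simp
qed

section \<open>Finite families of vectors\<close>

text \<open>
  Bases are indexed families, because the vectors at different indices of a module have to be recognised as
  parts of the same interval summand.
\<close>

locale ambient_space = vector_space scale
  for scale :: "'a::field \<Rightarrow> 'b::ab_group_add \<Rightarrow> 'b" (infixr "*s" 75)
begin

definition indep_family :: "'j set \<Rightarrow> ('j \<Rightarrow> 'b) \<Rightarrow> bool" where
  "indep_family J e \<longleftrightarrow> (\<forall>c. (\<Sum>j\<in>J. c j *s e j) = 0 \<longrightarrow> (\<forall>j\<in>J. c j = 0))"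

definition basis_family :: "'j set \<Rightarrow> ('j \<Rightarrow> 'b) \<Rightarrow> 'b set \<Rightarrow> bool" where
  "basis_family J e A \<longleftrightarrow> finite J \<and> indep_family J e \<and> A = span (e ` J)"

lemma indep_familyD: "indep_family J e \<Longrightarrow> (\<Sum>j\<in>J. c j *s e j) = 0 \<Longrightarrow> j \<in> J \<Longrightarrow> c j = 0"
  unfolding indep_family_def by blast

lemma span_image_finite:
  assumes "finite J"
  shows "span (e ` J) = range (\<lambda>c. \<Sum>j\<in>J. c j *s e j)"
proof (intro equalityI subsetI)
  fix x assume "x \<in> span (e ` J)"
  then obtain u where x: "x = (\<Sum>v\<in>e ` J. u v *s v)" using assms by (auto simp: span_finite)
  obtain J' where J': "J' \<subseteq> J" "inj_on e J'" "e ` J' = e ` J"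
    by (metis subset_image_inj order_refl)
  define c where "c j = (if j \<in> J' then u (e j) else 0)" for j
  have "x = (\<Sum>j\<in>J'. u (e j) *s e j)" unfolding x J'(3)[symmetric] using J'(2) by (simp add: sum.reindex)
  also have "\<dots> = (\<Sum>j\<in>J. c j *s e j)"
    unfolding c_def using assms J'(1) by (intro sum.mono_neutral_cong_left) auto
  finally show "x \<in> range (\<lambda>c. \<Sum>j\<in>J. c j *s e j)" by blast
qed (auto intro!: span_sum span_scale span_base[OF imageI])

lemma indep_family_imp:
  assumes fin: "finite J" and ind: "indep_family J e"
  shows "inj_on e J" "independent (e ` J)"
proof -
  show inj: "inj_on e J"
  proof (rule inj_onI, rule ccontr)
    fix i j assume ij: "i \<in> J" "j \<in> J" "e i = e j" "i \<noteq> j"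
    define c :: "'c \<Rightarrow> 'a" where "c l = (if l = i then 1 else if l = j then - 1 else 0)" for l
    have "(\<Sum>l\<in>J. c l *s e l) = (\<Sum>l\<in>{i, j}. c l *s e l)"
      using fin ij by (intro sum.mono_neutral_right) (auto simp: c_def)
    also have "\<dots> = 0" using ij by (simp add: c_def)
    finally have "c i = 0" by (rule indep_familyD[OF ind _ ij(1)])
    then show False by (simp add: c_def)
  qed
  show "independent (e ` J)"
  proof (rule independent_if_scalars_zero)
    fix u v assume sum0: "(\<Sum>v\<in>e ` J. u v *s v) = 0" and "v \<in> e ` J"
    then obtain j where "j \<in> J" "v = e j" by blast
    then show "u v = 0"
      using indep_familyD[OF ind, of "\<lambda>j. u (e j)" j] sum0 by (simp add: sum.reindex[OF inj])
  qed (use fin in simp)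
qed

lemma indep_familyI:
  assumes "finite J" "inj_on e J" "independent (e ` J)"
  shows "indep_family J e"
  unfolding indep_family_def
proof (intro allI impI ballI)
  fix c j assume c: "(\<Sum>j\<in>J. c j *s e j) = 0" and j: "j \<in> J"
  have "(\<Sum>v\<in>e ` J. c (inv_into J e v) *s v) = 0"
    using c assms(2) by (simp add: sum.reindex inv_into_f_f)
  then have "c (inv_into J e (e j)) = 0"
    by (rule independentD[OF assms(3), rotated 2]) (use assms(1) j in auto)
  then show "c j = 0" using assms(2) j by (simp add: inv_into_f_f)
qed

lemma basis_family_mem: "basis_family J e A \<Longrightarrow> j \<in> J \<Longrightarrow> e j \<in> A"
  unfolding basis_family_def by (auto intro: span_base)

lemma basis_family_cong:
  "(\<And>j. j \<in> J \<Longrightarrow> e j = e' j) \<Longrightarrow> basis_family J e A \<longleftrightarrow> basis_family J e' A"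
  unfolding basis_family_def indep_family_def
  by (simp cong: sum.cong image_cong)

lemma basis_family_expand:
  assumes "basis_family J e A" "x \<in> A"
  obtains c where "x = (\<Sum>j\<in>J. c j *s e j)"
  using assms unfolding basis_family_def by (auto simp: span_image_finite)

lemma indep_family_subset:
  assumes "indep_family J e" "finite J" "Q \<subseteq> J"
  shows "indep_family Q e"
proof -
  have "(\<Sum>j\<in>Q. c j *s e j) = (\<Sum>j\<in>J. (if j \<in> Q then c j else 0) *s e j)" for c
    using assms(2,3) by (intro sum.mono_neutral_cong_left) auto
  then show ?thesis unfolding indep_family_def
    using indep_familyD[OF assms(1), of "\<lambda>j. if j \<in> Q then _ j else 0"] assms(3)
    by (metis (no_types, lifting) subsetD)
qed

lemma basis_family_extend:
  fixes e :: "nat \<Rightarrow> 'b"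
  assumes A: "subspace A" "A \<subseteq> span B0" "finite B0"
    and Q: "finite Q" "indep_family Q e" "e ` Q \<subseteq> A" and J: "finite J" "Q \<subseteq> J"
  obtains N y where "finite N" "N \<inter> J = {}" "\<And>j. j \<in> Q \<Longrightarrow> y j = e j" "basis_family (Q \<union> N) y A"
proof -
  have inj: "inj_on e Q" and ind: "independent (e ` Q)" using indep_family_imp[OF Q(1,2)] by auto
  obtain B where B: "e ` Q \<subseteq> B" "B \<subseteq> A" "independent B" "A \<subseteq> span B"
    using maximal_independent_subset_extend[OF Q(3) ind] by blast
  have finB: "finite B" using independent_span_bound[OF A(3) B(3)] B(2) A(2) by blast
  obtain N where N: "finite N" "card N = card (B - e ` Q)" "N \<subseteq> - J"
    using infinite_arbitrarily_large[of "- J" "card (B - e ` Q)"] J(1) by (auto simp: Compl_eq_Diff_UNIV infinite_UNIV_nat)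
  obtain z where z: "bij_betw z N (B - e ` Q)"
    using finite_same_card_bij[OF N(1) _ N(2)] finB by auto
  define y where "y j = (if j \<in> N then z j else e j)" for j
  have disj: "N \<inter> J = {}" using N(3) by auto
  have yN: "y ` N = B - e ` Q" using z unfolding y_def bij_betw_def by auto
  have yQ: "y j = e j" if "j \<in> Q" for j using that disj J(2) unfolding y_def by auto
  then have yQ': "y ` Q = e ` Q" by auto
  have "bij_betw y (Q \<union> N) (e ` Q \<union> (B - e ` Q))"
  proof (rule bij_betw_combine)
    show "bij_betw y Q (e ` Q)" using inj yQ yQ' unfolding bij_betw_def by (simp cong: inj_on_cong)
    show "bij_betw y N (B - e ` Q)" using z by (simp add: y_def cong: bij_betw_cong)
  qed auto
  moreover have "e ` Q \<union> (B - e ` Q) = B" using B(1) by auto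
  ultimately have "inj_on y (Q \<union> N)" "y ` (Q \<union> N) = B" unfolding bij_betw_def by auto
  then have "basis_family (Q \<union> N) y A"
    unfolding basis_family_def using Q(1) N(1) B span_subspace[OF B(2,4) A(1)] by (auto intro!: indep_familyI)
  then show thesis using that N(1) disj yQ by blast
qed

text \<open>
  Spanning follows by induction along \<open>\<rho>\<close>; independence follows since a spanning family of as many members as
  the dimension is independent.
\<close>

lemma basis_family_triangular:
  fixes \<rho> :: "'j \<Rightarrow> nat"
  assumes e: "basis_family J e A" and c: "\<And>j l. c j l \<noteq> 0 \<Longrightarrow> \<rho> l < \<rho> j"
  shows "basis_family J (\<lambda>j. e j + (\<Sum>l\<in>J. c j l *s e l)) A"
proof -
  define e' where "e' j = e j + (\<Sum>l\<in>J. c j l *s e l)" for j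
  have fin: "finite J" and ind: "indep_family J e" and A: "A = span (e ` J)"
    using e unfolding basis_family_def by auto
  have "e' ` J \<subseteq> span (e ` J)" unfolding e'_def by (auto intro!: span_add span_sum span_scale span_base[OF imageI])
  moreover have "e j \<in> span (e' ` J)" if "j \<in> J" for j
    using that
  proof (induction "\<rho> j" arbitrary: j rule: less_induct)
    case less
    have "c j l *s e l \<in> span (e' ` J)" if "l \<in> J" for l
      using less.hyps[of l] c[of j l] that by (cases "c j l = 0") (auto intro: span_zero span_scale)
    then have "e' j - (\<Sum>l\<in>J. c j l *s e l) \<in> span (e' ` J)"
      using less.prems by (intro span_diff span_sum span_base[OF imageI]) auto
    then show ?case unfolding e'_def by simp
  qed
  ultimately have sp: "span (e' ` J) = A"
    unfolding A by (metis image_subsetI span_minimal span_span subset_antisym subspace_span)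
  obtain B where B: "B \<subseteq> e' ` J" "independent B" "e' ` J \<subseteq> span B"
    using maximal_independent_subset[of "e' ` J"] by blast
  have "span B = A"
    using B sp by (metis span_minimal span_mono span_span subset_antisym subspace_span)
  then have "card B = dim A" using dim_span_eq_card_independent[OF B(2)] by simp
  also have "\<dots> = card J"
    unfolding A using dim_span_eq_card_independent[OF indep_family_imp(2)[OF fin ind]]
      card_image[OF indep_family_imp(1)[OF fin ind]] by simp
  finally have card: "card B = card J" .
  have "card (e' ` J) \<le> card J" "card B \<le> card (e' ` J)"
    using fin B(1) by (auto intro: card_image_le card_mono)
  then have cardJ: "card (e' ` J) = card J" using card by simp
  have "B = e' ` J" using fin B(1) card cardJ by (intro card_subset_eq) simp_all
  then have "indep_family J e'" using fin B(2) cardJ by (auto intro!: indep_familyI eq_card_imp_inj_on)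
  then show ?thesis unfolding basis_family_def e'_def[symmetric] using fin sp by simp
qed

text \<open>
  Gaussian elimination: \<open>P\<close> consists of the leading positions of the vectors in \<open>K\<close>, and the changed vector at such a
  position is a vector of \<open>K\<close> with that leading position.
\<close>

lemma triangular_change_adapted_to_subspace:
  fixes \<rho> :: "'j \<Rightarrow> nat"
  assumes e: "basis_family T e A" and K: "subspace K" "K \<subseteq> A" and inj: "inj_on \<rho> T"
  obtains c P where "P \<subseteq> T" "\<And>j l. c j l \<noteq> 0 \<Longrightarrow> j \<in> T \<and> l \<in> T \<and> \<rho> l < \<rho> j"
    "\<And>j. j \<in> P \<Longrightarrow> e j + (\<Sum>l\<in>T. c j l *s e l) \<in> K"
    "K \<subseteq> span ((\<lambda>j. e j + (\<Sum>l\<in>T. c j l *s e l)) ` P)"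
proof -
  have fin: "finite T" using e unfolding basis_family_def by auto
  define good where "good j c \<longleftrightarrow> (\<forall>l. c l \<noteq> 0 \<longrightarrow> l \<in> T \<and> \<rho> l < \<rho> j) \<and> e j + (\<Sum>l\<in>T. c l *s e l) \<in> K" for j c
  define P where "P = {j\<in>T. \<exists>c. good j c}"
  define c where "c j = (if j \<in> P then SOME c. good j c else (\<lambda>_. 0))" for j
  define x where "x j = e j + (\<Sum>l\<in>T. c j l *s e l)" for j
  have good: "good j (c j)" if "j \<in> P" for j
    using that someI_ex[of "good j"] unfolding P_def c_def by auto
  \<comment> \<open>By induction on a bound \<open>t\<close> for the leading position of a vector in \<open>K\<close>.\<close>
  have "(\<Sum>l\<in>T. a l *s e l) \<in> span (x ` P)"
    if "\<And>l. l \<in> T \<Longrightarrow> a l \<noteq> 0 \<Longrightarrow> \<rho> l < t" "(\<Sum>l\<in>T. a l *s e l) \<in> K" for t a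
    using that
  proof (induction t arbitrary: a)
    case 0
    then have "(\<Sum>l\<in>T. a l *s e l) = 0" by (intro sum.neutral) auto
    then show ?case by (simp add: span_zero)
  next
    case (Suc t)
    show ?case
    proof (cases "\<exists>j\<in>T. a j \<noteq> 0 \<and> \<rho> j = t")
      case False
      then have "\<rho> l < t" if "l \<in> T" "a l \<noteq> 0" for l
        using Suc.prems(1)[OF that] that by (metis less_antisym)
      then show ?thesis using Suc.IH[of a] Suc.prems(2) by blast
    next
      case True
      then obtain j where j: "j \<in> T" "a j \<noteq> 0" "\<rho> j = t" by blast
      have lower: "\<rho> l < t" if "l \<in> T" "a l \<noteq> 0" "l \<noteq> j" for l
        using Suc.prems(1)[OF that(1,2)] inj_onD[OF inj _ that(1) j(1)] j(3) that(3)
        by (metis less_antisym)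
      define b where "b l = (if l \<in> T \<and> l \<noteq> j then a l / a j else 0)" for l
      have split: "(\<Sum>l\<in>T. f l) = f j + (\<Sum>l\<in>T - {j}. f l)" for f :: "'j \<Rightarrow> 'b"
        using fin j(1) by (simp add: sum.remove)
      have "(1 / a j) *s (\<Sum>l\<in>T. a l *s e l) = (\<Sum>l\<in>T. (a l / a j) *s e l)"
        by (simp add: scale_sum_right)
      also have "\<dots> = e j + (\<Sum>l\<in>T. b l *s e l)"
        using j(2) by (simp add: split b_def)
      finally have "good j b"
        unfolding good_def using lower j(3) subspace_scale[OF K(1) Suc.prems(2), of "1 / a j"]
        by (auto simp: b_def)
      then have P: "j \<in> P" using j(1) unfolding P_def by blast
      note g = good[OF P, unfolded good_def]
      \<comment> \<open>The coefficients after subtracting \<open>a j *s x j\<close>, which cancels the leading term.\<close>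
      define a' where "a' l = (if l = j then 0 else a l - a j * c j l)" for l
      have cj: "c j j = 0" using g by blast
      have eq: "(\<Sum>l\<in>T. a l *s e l) = (\<Sum>l\<in>T. a' l *s e l) + a j *s x j"
        unfolding x_def
        by (simp add: split a'_def cj scale_right_distrib scale_sum_right scale_left_diff_distrib
            sum_subtractf)
      have xK: "x j \<in> K" using g unfolding x_def by blast
      have "(\<Sum>l\<in>T. a' l *s e l) = (\<Sum>l\<in>T. a l *s e l) - a j *s x j" using eq by simp
      then have "(\<Sum>l\<in>T. a' l *s e l) \<in> K"
        using subspace_diff[OF K(1) Suc.prems(2) subspace_scale[OF K(1) xK]] by simp
      moreover have "\<rho> l < t" if "l \<in> T" "a' l \<noteq> 0" for l
      proof (cases "a l = 0")
        case True
        then have "c j l \<noteq> 0" using that(2) unfolding a'_def by (auto split: if_splits)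
        then show ?thesis using g j(3) by blast
      next
        case False
        then show ?thesis using lower that unfolding a'_def by (auto split: if_splits)
      qed
      ultimately have "(\<Sum>l\<in>T. a' l *s e l) \<in> span (x ` P)" using Suc.IH[of a'] by blast
      then show ?thesis unfolding eq by (intro span_add span_scale span_base[OF imageI] P)
    qed
  qed
  note main = this
  have "k \<in> span (x ` P)" if k: "k \<in> K" for k
  proof -
    obtain a where a: "k = (\<Sum>l\<in>T. a l *s e l)" using basis_family_expand[OF e] K(2) k by blast
    have "\<rho> l < Suc (Max (\<rho> ` T))" if "l \<in> T" for l using fin that by (simp add: le_imp_less_Suc)
    then show ?thesis using main[of a "Suc (Max (\<rho> ` T))"] k unfolding a by blast
  qed
  moreover have "j \<in> T \<and> l \<in> T \<and> \<rho> l < \<rho> j" if "c j l \<noteq> 0" for j l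
  proof -
    have "j \<in> P" using that unfolding c_def by (auto split: if_splits)
    then show ?thesis using good[of j] that unfolding good_def P_def by blast
  qed
  moreover have "x j \<in> K" if "j \<in> P" for j using good[OF that] unfolding good_def x_def by blast
  ultimately show thesis using that[of P c] unfolding P_def x_def by blast
qed

lemma linear_between_0:
  assumes "linear_between scale A scale B p" "subspace A"
  shows "p 0 = 0"
  using linear_betweenD(3)[OF assms(1) subspace_0[OF assms(2)], of 0] by simp

lemma linear_between_family_sum:
  assumes "linear_between scale A scale B p" "subspace A" "\<And>j. j \<in> S \<Longrightarrow> u j \<in> A"
  shows "p (\<Sum>j\<in>S. c j *s u j) = (\<Sum>j\<in>S. c j *s p (u j))"
  by (rule linear_between_sum[OF vector_space_axioms vector_space_axioms assms(2,1,3)])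

text \<open>
  The step across a forward arrow: the basis vectors in the kernel die, the images of the others stay
  independent, and new vectors complete them to a basis.
\<close>

lemma basis_family_image:
  fixes x :: "nat \<Rightarrow> 'b"
  assumes p: "linear_between scale A scale B p" and x: "basis_family T x A"
    and P: "P \<subseteq> T" and ker: "{v\<in>A. p v = 0} \<subseteq> span (x ` P)"
    and B: "subspace B" "B \<subseteq> span B0" "finite B0" and J: "finite J" "T \<subseteq> J"
  obtains N y where "finite N" "N \<inter> J = {}" "\<And>j. j \<in> T - P \<Longrightarrow> y j = p (x j)"
    "basis_family ((T - P) \<union> N) y B"
proof -
  have fin: "finite T" and ind: "indep_family T x" and A: "A = span (x ` T)"
    using x unfolding basis_family_def by auto
  have subA: "subspace A" unfolding A by simp
  have mem: "x j \<in> A" if "j \<in> T" for j using basis_family_mem[OF x that] .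
  have "indep_family (T - P) (\<lambda>j. p (x j))"
    unfolding indep_family_def
  proof (intro allI impI ballI)
    fix c j assume c: "(\<Sum>j\<in>T - P. c j *s p (x j)) = 0" and j: "j \<in> T - P"
    have "p (\<Sum>j\<in>T - P. c j *s x j) = 0"
      using linear_between_family_sum[OF p subA, of "T - P" x c] mem c by simp
    moreover have "(\<Sum>j\<in>T - P. c j *s x j) \<in> A"
      by (intro subspace_sum[OF subA] subspace_scale[OF subA] mem) auto
    ultimately have "(\<Sum>j\<in>T - P. c j *s x j) \<in> span (x ` P)" using ker by blast
    then obtain a where a: "(\<Sum>j\<in>T - P. c j *s x j) = (\<Sum>j\<in>P. a j *s x j)"
      using span_image_finite[OF finite_subset[OF P fin], of x] by auto
    define d where "d j = (if j \<in> P then - a j else c j)" for j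
    have "(\<Sum>j\<in>T. d j *s x j) = (\<Sum>j\<in>T - P. d j *s x j) + (\<Sum>j\<in>P. d j *s x j)"
      by (rule sum.subset_diff[OF P fin])
    also have "\<dots> = 0" using a by (simp add: d_def sum_negf)
    finally have "d j = 0" using j by (intro indep_familyD[OF ind]) auto
    then show "c j = 0" using j by (simp add: d_def)
  qed
  moreover have "(\<lambda>j. p (x j)) ` (T - P) \<subseteq> B"
    using linear_betweenD(1)[OF p] mem by auto
  ultimately show thesis
    using basis_family_extend[OF B, of "T - P" "\<lambda>j. p (x j)" J] fin J that by blast
qed

text \<open>
  The step across a backward arrow: the basis vectors in the image lift along \<open>p\<close>, the others end, and a basis of
  the kernel is newly born.
\<close>

lemma basis_family_preimage:
  fixes x :: "nat \<Rightarrow> 'b"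
  assumes p: "linear_between scale B scale A p" and x: "basis_family T x A"
    and P: "P \<subseteq> T" "\<And>j. j \<in> P \<Longrightarrow> x j \<in> p ` B" and im: "p ` B \<subseteq> span (x ` P)"
    and B: "subspace B" "B \<subseteq> span B0" "finite B0" and J: "finite J" "T \<subseteq> J"
  obtains N y where "finite N" "N \<inter> J = {}" "\<And>j. j \<in> P \<Longrightarrow> p (y j) = x j"
    "\<And>j. j \<in> N \<Longrightarrow> p (y j) = 0" "basis_family (P \<union> N) y B"
proof -
  have finT: "finite T" and ind: "indep_family T x" using x unfolding basis_family_def by auto
  have fin: "finite P" using finT P(1) finite_subset by blast
  define K where "K = {v\<in>B. p v = 0}"
  have K: "subspace K"
    unfolding K_def using linear_betweenD(2,3)[OF p] linear_between_0[OF p B(1)]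
    by (intro subspaceI) (auto simp: subspace_0[OF B(1)] subspace_add[OF B(1)] subspace_scale[OF B(1)])
  have "K \<subseteq> span B0" using B(2) unfolding K_def by blast
  then obtain N z where N: "finite N" "N \<inter> J = {}" "basis_family N z K"
    using basis_family_extend[OF K _ B(3), of "{}" undefined J] J(1) by (auto simp: indep_family_def)
  have disj: "P \<inter> N = {}" using N(2) P(1) J(2) by blast
  have "\<exists>v. v \<in> B \<and> p v = x j" if "j \<in> P" for j using P(2)[OF that] by auto
  then obtain w where w: "\<And>j. j \<in> P \<Longrightarrow> w j \<in> B" "\<And>j. j \<in> P \<Longrightarrow> p (w j) = x j" by metis
  define y where "y j = (if j \<in> N then z j else w j)" for j
  have yP: "y j \<in> B" "p (y j) = x j" if "j \<in> P" for j using w that disj unfolding y_def by auto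
  have yK: "y j \<in> K" if "j \<in> N" for j using basis_family_mem[OF N(3) that] that unfolding y_def by simp
  then have yN: "y j \<in> B" "p (y j) = 0" if "j \<in> N" for j using that unfolding K_def by auto
  have mem: "y j \<in> B" if "j \<in> P \<union> N" for j using yP yN that by blast
  have Ny: "basis_family N y K" using N(3) by (rule basis_family_cong[THEN iffD1, rotated]) (simp add: y_def)
  have psum: "p (\<Sum>j\<in>P \<union> N. c j *s y j) = (\<Sum>j\<in>P. c j *s x j)" for c
  proof -
    have "p (\<Sum>j\<in>P \<union> N. c j *s y j) = (\<Sum>j\<in>P \<union> N. c j *s p (y j))"
      by (rule linear_between_family_sum[OF p B(1) mem])
    also have "\<dots> = (\<Sum>j\<in>P. c j *s x j)"
      using fin N(1) disj by (simp add: sum.union_disjoint yP yN)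
    finally show ?thesis .
  qed
  have indP: "indep_family P x" by (rule indep_family_subset[OF ind finT P(1)])
  have "indep_family (P \<union> N) y"
    unfolding indep_family_def
  proof (intro allI impI)
    fix c assume c: "(\<Sum>j\<in>P \<union> N. c j *s y j) = 0"
    then have "(\<Sum>j\<in>P. c j *s x j) = 0" using psum[of c] linear_between_0[OF p B(1)] by simp
    then have cP: "c j = 0" if "j \<in> P" for j using indep_familyD[OF indP] that by blast
    then have "(\<Sum>j\<in>N. c j *s y j) = 0"
      using c fin N(1) disj by (simp add: sum.union_disjoint)
    then have "c j = 0" if "j \<in> N" for j
      using indep_familyD[of N y c j] Ny that unfolding basis_family_def by blast
    then show "\<forall>j\<in>P \<union> N. c j = 0" using cP by blast
  qed
  moreover have "span (y ` (P \<union> N)) = B"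
  proof (rule span_subspace)
    show "B \<subseteq> span (y ` (P \<union> N))"
    proof
      fix v assume v: "v \<in> B"
      then have "p v \<in> span (x ` P)" using im by blast
      then obtain a where a: "p v = (\<Sum>j\<in>P. a j *s x j)" using span_image_finite[OF fin, of x] by auto
      define u where "u = (\<Sum>j\<in>P. a j *s y j)"
      have u: "u \<in> B" unfolding u_def by (intro subspace_sum[OF B(1)] subspace_scale[OF B(1)] yP)
      have "p u = p v"
        using linear_between_family_sum[OF p B(1), of P y a] yP by (simp add: u_def a)
      moreover have "p (v - u) + p u = p v"
        using linear_betweenD(2)[OF p subspace_diff[OF B(1) v u] u] by simp
      ultimately have "v - u \<in> K" unfolding K_def using subspace_diff[OF B(1) v u] by auto
      then have "v - u \<in> span (y ` N)" using Ny unfolding basis_family_def by blast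
      then have 1: "v - u \<in> span (y ` (P \<union> N))" by (rule subsetD[OF span_mono, rotated]) auto
      have 2: "u \<in> span (y ` (P \<union> N))" unfolding u_def by (intro span_sum span_scale span_base[OF imageI]) auto
      show "v \<in> span (y ` (P \<union> N))" using span_add[OF 1 2] by simp
    qed
  qed (use mem B(1) in auto)
  ultimately have "basis_family (P \<union> N) y B" unfolding basis_family_def using fin N(1) by simp
  then show thesis using that N(1,2) yP(2) yN(2) by blast
qed

end

section \<open>Existence of the interval decomposition\<close>

text \<open>
  For each \<open>j\<close>, the vectors \<open>e j i\<close> with \<open>i\<close> in the interval of \<open>j\<close> span one interval summand.  They are zero elsewhere,
  so that linear combinations of whole summands can be formed index by index.
\<close>

definition interval_basis ::
  "nat \<Rightarrow> ('a::field, 'v::ab_group_add) zigzag \<Rightarrow> nat set \<Rightarrow> (nat \<Rightarrow> nat \<times> nat) \<Rightarrow> (nat \<Rightarrow> nat \<Rightarrow> 'v) \<Rightarrow> bool" where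
  "interval_basis n V J iv e \<longleftrightarrow> finite J \<and> (\<forall>j\<in>J. valid_bar n (iv j)) \<and>
     (\<forall>j i. \<not> covers (iv j) i \<longrightarrow> e j i = 0) \<and>
     (\<forall>i\<in>{1..n}. ambient_space.basis_family (zz_scale V) {j\<in>J. covers (iv j) i} (\<lambda>j. e j i) (zz_space V i)) \<and>
     (\<forall>i\<in>{1..<n}. \<forall>j\<in>J. zz_dir V i = Forward \<longrightarrow> covers (iv j) i \<longrightarrow> zz_map V i (e j i) = e j (i + 1)) \<and>
     (\<forall>i\<in>{1..<n}. \<forall>j\<in>J. zz_dir V i = Backward \<longrightarrow> covers (iv j) (i + 1) \<longrightarrow> zz_map V i (e j (i + 1)) = e j i)"

lemma interval_basisD:
  assumes "interval_basis n V J iv e"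
  shows "finite J" "\<And>j. j \<in> J \<Longrightarrow> valid_bar n (iv j)" "\<And>j i. \<not> covers (iv j) i \<Longrightarrow> e j i = 0"
    "\<And>i. i \<in> {1..n} \<Longrightarrow>
      ambient_space.basis_family (zz_scale V) {j\<in>J. covers (iv j) i} (\<lambda>j. e j i) (zz_space V i)"
    "\<And>i j. i \<in> {1..<n} \<Longrightarrow> j \<in> J \<Longrightarrow> zz_dir V i = Forward \<Longrightarrow> covers (iv j) i \<Longrightarrow>
      zz_map V i (e j i) = e j (i + 1)"
    "\<And>i j. i \<in> {1..<n} \<Longrightarrow> j \<in> J \<Longrightarrow> zz_dir V i = Backward \<Longrightarrow> covers (iv j) (i + 1) \<Longrightarrow>
      zz_map V i (e j (i + 1)) = e j i"
  using assms unfolding interval_basis_def by blast+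

lemma ambient_space_zz_scale: "zigzag_module n V \<Longrightarrow> ambient_space (zz_scale V)"
  unfolding ambient_space_def by (rule zigzag_moduleD(1))

lemma interval_basis_imp_iso:
  fixes V :: "('a::field, 'v::ab_group_add) zigzag"
  assumes V: "zigzag_module n V" and e: "interval_basis n V J iv e"
  shows "zz_iso n (bar_module (zz_dir V) J iv :: ('a, nat \<Rightarrow> 'a) zigzag) V"
proof -
  let ?B = "bar_module (zz_dir V) J iv :: ('a, nat \<Rightarrow> 'a) zigzag"
  interpret ambient_space "zz_scale V" by (rule ambient_space_zz_scale[OF V])
  note fin = interval_basisD(1)[OF e] and valid = interval_basisD(2)[OF e] and zero = interval_basisD(3)[OF e]
    and basis = interval_basisD(4)[OF e] and fwd = interval_basisD(5)[OF e] and bwd = interval_basisD(6)[OF e]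
  define g where "g i x = (\<Sum>j\<in>J. zz_scale V (x j) (e j i))" for i and x :: "nat \<Rightarrow> 'a"
  have g_active: "g i x = (\<Sum>j\<in>{j\<in>J. covers (iv j) i}. zz_scale V (x j) (e j i))" for i x
    unfolding g_def using fin by (intro sum.mono_neutral_right) (auto simp: zero)
  have sub: "subspace (zz_space V i)" if "i \<in> {1..n}" for i by (rule zigzag_moduleD(3)[OF V that])
  have mem: "e j i \<in> zz_space V i" if "i \<in> {1..n}" "j \<in> J" for i j
    using basis_family_mem[OF basis[OF that(1)]] that zero[of j i] subspace_0[OF sub[OF that(1)]]
    by (cases "covers (iv j) i") auto
  have lin: "linear_between pointwise_scale (zz_space ?B i) (zz_scale V) (zz_space V i) (g i)"
    if i: "i \<in> {1..n}" for i
    by (rule linear_betweenI)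
      (auto simp: g_def scale_left_distrib sum.distrib scale_sum_right
        intro!: subspace_sum[OF sub[OF i]] subspace_scale[OF sub[OF i]] mem[OF i])
  have map_g: "p (g i x) = g i' (\<lambda>j. if j \<in> J \<and> covers (iv j) i \<and> covers (iv j) i' then x j else 0)"
    if i: "i \<in> {1..n}" and p: "linear_between (zz_scale V) (zz_space V i) (zz_scale V) (zz_space V i') p"
      and pe: "\<And>j. j \<in> J \<Longrightarrow> covers (iv j) i \<Longrightarrow> p (e j i) = e j i'" and x: "x \<in> zz_space ?B i" for p i i' x
  proof -
    have "p (g i x) = (\<Sum>j\<in>J. zz_scale V (x j) (p (e j i)))"
      unfolding g_def by (rule linear_between_family_sum[OF p sub[OF i] mem[OF i]])
    also have "\<dots> = g i' (\<lambda>j. if j \<in> J \<and> covers (iv j) i \<and> covers (iv j) i' then x j else 0)"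
      unfolding g_def
    proof (rule sum.cong[OF HOL.refl])
      fix j assume j: "j \<in> J"
      show "zz_scale V (x j) (p (e j i)) =
          zz_scale V (if j \<in> J \<and> covers (iv j) i \<and> covers (iv j) i' then x j else 0) (e j i')"
      proof (cases "covers (iv j) i")
        case True
        then show ?thesis using pe[OF j True] j zero[of j i'] by auto
      next
        case False
        then have "x j = 0" using x by (auto simp: coord_space_def)
        then show ?thesis by simp
      qed
    qed
    finally show ?thesis .
  qed
  show ?thesis
  proof (rule zz_isoI[where f = g])
    show "same_type n ?B V" by (simp add: same_type_def)
  next
    fix i assume i: "i \<in> {1..n}"
    show "linear_between (zz_scale ?B) (zz_space ?B i) (zz_scale V) (zz_space V i) (g i)"
      using lin[OF i] by simp
    show "bij_betw (g i) (zz_space ?B i) (zz_space V i)"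
      unfolding bij_betw_def
    proof
      show "inj_on (g i) (zz_space ?B i)"
      proof (rule inj_onI)
        fix x y assume xy: "x \<in> zz_space ?B i" "y \<in> zz_space ?B i" "g i x = g i y"
        have "(\<Sum>j\<in>{j\<in>J. covers (iv j) i}. zz_scale V (x j - y j) (e j i)) = 0"
          using xy(3) by (simp add: g_active scale_left_diff_distrib sum_subtractf)
        then have "x j - y j = 0" if "j \<in> {j\<in>J. covers (iv j) i}" for j
          by (rule indep_familyD[rotated]) (use basis[OF i] that in \<open>auto simp: basis_family_def\<close>)
        moreover have "x j = 0 \<and> y j = 0" if "j \<notin> {j\<in>J. covers (iv j) i}" for j
          using xy(1,2) that unfolding bar_module_simps coord_space_def by blast
        ultimately show "x = y" by (intro ext) (metis eq_iff_diff_eq_0)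
      qed
      show "g i ` zz_space ?B i = zz_space V i"
      proof (intro equalityI subsetI)
        fix v assume v: "v \<in> zz_space V i"
        then obtain c where c: "v = (\<Sum>j\<in>{j\<in>J. covers (iv j) i}. zz_scale V (c j) (e j i))"
          by (rule basis_family_expand[OF basis[OF i]])
        define x where "x j = (if j \<in> {j\<in>J. covers (iv j) i} then c j else 0)" for j
        have "v = g i x" unfolding c g_active by (intro sum.cong) (auto simp: x_def)
        moreover have "x \<in> zz_space ?B i" by (auto simp: x_def coord_space_def)
        ultimately show "v \<in> g i ` zz_space ?B i" by blast
      qed (use linear_betweenD(1)[OF lin[OF i]] in blast)
    qed
  next
    fix i x assume i: "i \<in> {1..<n}" and d: "zz_dir ?B i = Forward" and x: "x \<in> zz_space ?B i"
    have "zz_map V i (g i x) = g (i + 1) (\<lambda>j. if j \<in> J \<and> covers (iv j) i \<and> covers (iv j) (i + 1) then x j else 0)"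
      by (rule map_g[OF _ _ _ x])
        (use i d zigzag_moduleD(4)[OF V i] fwd[OF i] in \<open>simp_all add: zz_source_def zz_target_def\<close>)
    then show "g (i + 1) (zz_map ?B i x) = zz_map V i (g i x)" by simp
  next
    fix i x assume i: "i \<in> {1..<n}" and d: "zz_dir ?B i = Backward" and x: "x \<in> zz_space ?B (i + 1)"
    have "zz_map V i (g (i + 1) x) = g i (\<lambda>j. if j \<in> J \<and> covers (iv j) (i + 1) \<and> covers (iv j) i then x j else 0)"
      by (rule map_g[OF _ _ _ x])
        (use i d zigzag_moduleD(4)[OF V i] bwd[OF i] in \<open>simp_all add: zz_source_def zz_target_def\<close>)
    then show "g i (zz_map ?B i x) = zz_map V i (g (i + 1) x)" by (simp add: conj_commute)
  qed
qed

text \<open>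
  For intervals with a common right end, there is a non-zero homomorphism from the one born at \<open>b\<close> to the one
  born at \<open>b'\<close> if and only if \<open>birth_rank \<tau> b' \<le> birth_rank \<tau> b\<close>: for \<open>b \<noteq> b'\<close>, this is decided by the
  arrow just before the shorter interval, and the later birth has the larger absolute value.
\<close>

definition birth_rank :: "(nat \<Rightarrow> direction) \<Rightarrow> nat \<Rightarrow> int" where
  "birth_rank \<tau> b = (if \<tau> (b - 1) = Forward then int b else - int b)"

lemma finite_linear_refinement:
  fixes r :: "'j \<Rightarrow> int"
  assumes "finite T"
  shows "\<exists>\<rho> :: 'j \<Rightarrow> nat. inj_on \<rho> T \<and> (\<forall>i\<in>T. \<forall>j\<in>T. \<rho> i < \<rho> j \<longrightarrow> r i \<le> r j)"
  using assms
proof (induction T rule: finite_ranking_induct[where f = r])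
  case (insert x S)
  then obtain \<rho> :: "'j \<Rightarrow> nat" where \<rho>: "inj_on \<rho> S" "\<And>i j. i \<in> S \<Longrightarrow> j \<in> S \<Longrightarrow> \<rho> i < \<rho> j \<Longrightarrow> r i \<le> r j"
    by blast
  show ?case
  proof (cases "x \<in> S")
    case True
    then show ?thesis using insert.IH by (simp add: insert_absorb)
  next
    case False
    define m where "m = Suc (Max (\<rho> ` S))"
    have m: "\<rho> i < m" if "i \<in> S" for i
      unfolding m_def using insert.hyps(1) that by (simp add: le_imp_less_Suc)
    define \<rho>' where "\<rho>' = \<rho>(x := m)"
    have old: "\<rho>' i = \<rho> i" if "i \<in> S" for i using False that unfolding \<rho>'_def by auto
    have new: "\<rho>' x = m" unfolding \<rho>'_def by simp
    have "inj_on \<rho>' S" using \<rho>(1) old by (simp cong: inj_on_cong)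
    moreover have "m \<notin> \<rho>' ` S" using m old by force
    ultimately have "inj_on \<rho>' (insert x S)" using new False by simp
    moreover have "r i \<le> r j" if "i \<in> insert x S" "j \<in> insert x S" "\<rho>' i < \<rho>' j" for i j
      using that insert.hyps(2) \<rho>(2) m[of j] old new by auto
    ultimately show ?thesis by blast
  qed
qed auto

text \<open>
  A basis vector at \<open>n\<close> may be changed by those of smaller rank, since the homomorphisms between the interval
  modules extend the change to all earlier indices.
\<close>

lemma interval_basis_adapt:
  fixes V :: "('a::field, 'v::ab_group_add) zigzag"
  assumes V: "zigzag_module n V" and n: "1 \<le> n" and e: "interval_basis n V J iv e"
    and K: "module.subspace (zz_scale V) K" "K \<subseteq> zz_space V n"
  obtains e' P where "interval_basis n V J iv e'" "P \<subseteq> {j\<in>J. covers (iv j) n}"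
    "\<And>j. j \<in> P \<Longrightarrow> e' j n \<in> K" "K \<subseteq> module.span (zz_scale V) ((\<lambda>j. e' j n) ` P)"
proof -
  interpret ambient_space "zz_scale V" by (rule ambient_space_zz_scale[OF V])
  let ?s = "zz_scale V"
  define T where "T = {j\<in>J. covers (iv j) n}"
  define r where "r j = birth_rank (zz_dir V) (fst (iv j))" for j
  note fin = interval_basisD(1)[OF e] and valid = interval_basisD(2)[OF e] and zero = interval_basisD(3)[OF e]
    and basis = interval_basisD(4)[OF e] and fwd = interval_basisD(5)[OF e] and bwd = interval_basisD(6)[OF e]
  have finT: "finite T" unfolding T_def using fin by simp
  obtain \<rho> :: "nat \<Rightarrow> nat" where \<rho>: "inj_on \<rho> T" "\<And>i j. i \<in> T \<Longrightarrow> j \<in> T \<Longrightarrow> \<rho> i < \<rho> j \<Longrightarrow> r i \<le> r j"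
    using finite_linear_refinement[OF finT, of r] by blast
  have basisT: "basis_family T (\<lambda>j. e j n) (zz_space V n)"
    using basis[of n] n unfolding T_def by simp
  obtain c P where P: "P \<subseteq> T" and c: "\<And>j l. c j l \<noteq> 0 \<Longrightarrow> j \<in> T \<and> l \<in> T \<and> \<rho> l < \<rho> j"
    and PK: "\<And>j. j \<in> P \<Longrightarrow> e j n + (\<Sum>l\<in>T. ?s (c j l) (e l n)) \<in> K"
    and KP: "K \<subseteq> span ((\<lambda>j. e j n + (\<Sum>l\<in>T. ?s (c j l) (e l n))) ` P)"
    by (rule triangular_change_adapted_to_subspace[OF basisT K \<rho>(1)]) blast
  have cr: "r l \<le> r j" "j \<in> T" "l \<in> T" "\<rho> l < \<rho> j" if "c j l \<noteq> 0" for j l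
    using c[OF that] \<rho>(2)[of l j] by auto
  define d where "d j i = (\<Sum>l\<in>T. ?s (c j l) (e l i))" for j i
  define e' where "e' j i = (if covers (iv j) i then e j i + d j i else 0)" for j i
  have bars: "1 \<le> fst (iv j)" "fst (iv j) \<le> n" "snd (iv j) = n" if "j \<in> T" for j
    using valid[of j] that unfolding T_def valid_bar_def covers_def by auto
  have coversT: "covers (iv j) i \<longleftrightarrow> fst (iv j) \<le> i \<and> i \<le> n" if "j \<in> T" for j i
    using bars(3)[OF that] by (simp add: covers_def)
  have d0: "d j i = 0" if "j \<notin> T" for j i
    unfolding d_def using cr(2)[of j] that by (intro sum.neutral) (metis scale_zero_left)
  have sub: "subspace (zz_space V i)" if "i \<in> {1..n}" for i by (rule zigzag_moduleD(3)[OF V that])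
  have mem: "e j i \<in> zz_space V i" if "i \<in> {1..n}" "j \<in> J" for i j
    using basis_family_mem[OF basis[OF that(1)]] that zero[of j i] subspace_0[OF sub[OF that(1)]]
    by (cases "covers (iv j) i") auto
  have memT: "e j i \<in> zz_space V i" if "i \<in> {1..n}" "j \<in> T" for i j
    using mem[OF that(1)] that(2) unfolding T_def by blast
  have dmem: "d j i \<in> zz_space V i" if "i \<in> {1..n}" for j i
    unfolding d_def by (intro subspace_sum[OF sub[OF that]] subspace_scale[OF sub[OF that]] memT[OF that])
  have basis': "basis_family {j\<in>J. covers (iv j) i} (\<lambda>j. e' j i) (zz_space V i)" if i: "i \<in> {1..n}" for i
  proof -
    let ?J = "{j\<in>J. covers (iv j) i}"
    have "basis_family ?J (\<lambda>j. e j i + (\<Sum>l\<in>?J. ?s (c j l) (e l i))) (zz_space V i)"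
      by (rule basis_family_triangular[where \<rho> = \<rho>, OF basis[OF i]]) (use cr(4) in blast)
    moreover have "(\<Sum>l\<in>?J. ?s (c j l) (e l i)) = d j i" for j
    proof -
      have "(\<Sum>l\<in>?J. ?s (c j l) (e l i)) = (\<Sum>l\<in>J. ?s (c j l) (e l i))"
        using fin zero by (intro sum.mono_neutral_left) auto
      also have "\<dots> = d j i"
        unfolding d_def using fin cr(3)[of j] by (intro sum.mono_neutral_right) (auto simp: T_def)
      finally show ?thesis .
    qed
    ultimately have "basis_family ?J (\<lambda>j. e j i + d j i) (zz_space V i)" by simp
    then show ?thesis
      by (rule basis_family_cong[THEN iffD1, rotated]) (simp add: e'_def)
  qed
  have fwd': "zz_map V i (e' j i) = e' j (i + 1)"
    if i: "i \<in> {1..<n}" and j: "j \<in> J" and dir: "zz_dir V i = Forward" and cov: "covers (iv j) i" for i j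
  proof -
    have p: "linear_between ?s (zz_space V i) ?s (zz_space V (i + 1)) (zz_map V i)"
      using zigzag_moduleD(4)[OF V i] dir by (simp add: zz_source_def zz_target_def)
    have i': "i \<in> {1..n}" "i + 1 \<in> {1..n}" using i by auto
    have "zz_map V i (d j i) = (\<Sum>l\<in>T. ?s (c j l) (zz_map V i (e l i)))"
      unfolding d_def by (rule linear_between_family_sum[OF p sub[OF i'(1)] memT[OF i'(1)]])
    also have "\<dots> = d j (i + 1)"
      unfolding d_def
    proof (rule sum.cong[OF HOL.refl])
      fix l assume l: "l \<in> T"
      show "?s (c j l) (zz_map V i (e l i)) = ?s (c j l) (e l (i + 1))"
      proof (cases "c j l = 0 \<or> covers (iv l) i")
        case True
        then show ?thesis using fwd[OF i _ dir, of l] l unfolding T_def by auto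
      next
        case False
        have jT: "j \<in> T" and "r l \<le> r j" using cr[of j l] False by auto
        \<comment> \<open>A birth at \<open>i + 1\<close>, after a forward arrow, has a larger rank than the earlier birth of \<open>j\<close>.\<close>
        have "e l (i + 1) = 0"
        proof (rule zero, rule notI)
          assume "covers (iv l) (i + 1)"
          then have "fst (iv l) = i + 1"
            using False l i by (auto simp: coversT)
          moreover have "fst (iv j) \<le> i" using cov jT by (simp add: coversT)
          ultimately show False using \<open>r l \<le> r j\<close> dir unfolding r_def birth_rank_def
            by (auto split: if_splits)
        qed
        moreover have "e l i = 0" using zero False by blast
        ultimately show ?thesis using linear_between_0[OF p sub[OF i'(1)]] by simp
      qed
    qed
    finally have "zz_map V i (e' j i) = e j (i + 1) + d j (i + 1)"
      using linear_betweenD(2)[OF p mem[OF i'(1) j] dmem[OF i'(1)]] fwd[OF i j dir cov] cov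
      by (simp add: e'_def)
    also have "\<dots> = e' j (i + 1)"
    proof (cases "covers (iv j) (i + 1)")
      case False
      then have "j \<notin> T" using cov i by (auto simp: coversT)
      then show ?thesis using False zero d0 by (simp add: e'_def)
    qed (simp add: e'_def)
    finally show ?thesis .
  qed
  have bwd': "zz_map V i (e' j (i + 1)) = e' j i"
    if i: "i \<in> {1..<n}" and j: "j \<in> J" and dir: "zz_dir V i = Backward" and cov: "covers (iv j) (i + 1)" for i j
  proof -
    have p: "linear_between ?s (zz_space V (i + 1)) ?s (zz_space V i) (zz_map V i)"
      using zigzag_moduleD(4)[OF V i] dir by (simp add: zz_source_def zz_target_def)
    have i': "i \<in> {1..n}" "i + 1 \<in> {1..n}" using i by auto
    have "zz_map V i (d j (i + 1)) = (\<Sum>l\<in>T. ?s (c j l) (zz_map V i (e l (i + 1))))"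
      unfolding d_def by (rule linear_between_family_sum[OF p sub[OF i'(2)] memT[OF i'(2)]])
    also have "\<dots> = d j i"
      unfolding d_def
    proof (rule sum.cong[OF HOL.refl])
      fix l assume l: "l \<in> T"
      show "?s (c j l) (zz_map V i (e l (i + 1))) = ?s (c j l) (e l i)"
      proof (cases "covers (iv l) (i + 1)")
        case True
        then show ?thesis using bwd[OF i _ dir, of l] l unfolding T_def by auto
      next
        case False
        then have "\<not> covers (iv l) i" using l i by (auto simp: coversT)
        then show ?thesis using False zero linear_between_0[OF p sub[OF i'(2)]] by simp
      qed
    qed
    finally have "zz_map V i (e' j (i + 1)) = e j i + d j i"
      using linear_betweenD(2)[OF p mem[OF i'(2) j] dmem[OF i'(2)]] bwd[OF i j dir cov] cov
      by (simp add: e'_def)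
    also have "\<dots> = e' j i"
    proof (cases "covers (iv j) i")
      case False
      have "?s (c j l) (e l i) = 0" if l: "l \<in> T" for l
      proof (cases "c j l = 0 \<or> \<not> covers (iv l) i")
        case True
        then show ?thesis using zero by auto
      next
        case False': False
        have jT: "j \<in> T" and "r l \<le> r j" using cr[of j l] False' by auto
        \<comment> \<open>Then \<open>j\<close> is born later than \<open>l\<close> and after a backward arrow, hence has the smaller rank.\<close>
        have "fst (iv j) = i + 1" using cov False jT by (auto simp: coversT)
        moreover have "fst (iv l) \<le> i" using False' l by (simp add: coversT)
        ultimately show ?thesis using \<open>r l \<le> r j\<close> dir unfolding r_def birth_rank_def
          by (auto split: if_splits)
      qed
      then have "d j i = 0" unfolding d_def by (intro sum.neutral) blast
      then show ?thesis using False zero by (simp add: e'_def)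
    qed (simp add: e'_def)
    finally show ?thesis .
  qed
  have e'n: "e' j n = e j n + (\<Sum>l\<in>T. ?s (c j l) (e l n))" if "j \<in> P" for j
    using that P unfolding e'_def d_def T_def by auto
  show thesis
  proof (rule that[of e' P])
    show "interval_basis n V J iv e'"
      unfolding interval_basis_def using fin valid basis' fwd' bwd' by (auto simp: e'_def)
    show "P \<subseteq> {j\<in>J. covers (iv j) n}" using P unfolding T_def .
    show "e' j n \<in> K" if "j \<in> P" for j using PK[OF that] e'n[OF that] by simp
    show "K \<subseteq> span ((\<lambda>j. e' j n) ` P)" using KP e'n by (simp cong: image_cong)
  qed
qed

text \<open>
  \<open>Q\<close> are the intervals that continue to the new index, \<open>N\<close> the ones born there.
\<close>

lemma interval_basis_Suc:
  fixes V :: "('a::field, 'v::ab_group_add) zigzag"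
  assumes V: "zigzag_module (Suc n) V" and n: "1 \<le> n" and e: "interval_basis n V J iv e"
    and Q: "Q \<subseteq> {j\<in>J. covers (iv j) n}" and N: "finite N" "N \<inter> J = {}"
    and y: "ambient_space.basis_family (zz_scale V) (Q \<union> N) y (zz_space V (Suc n))"
    and fwd_n: "\<And>j. zz_dir V n = Forward \<Longrightarrow> j \<in> J \<Longrightarrow> covers (iv j) n \<Longrightarrow>
      zz_map V n (e j n) = (if j \<in> Q then y j else 0)"
    and bwd_n: "\<And>j. zz_dir V n = Backward \<Longrightarrow> j \<in> Q \<union> N \<Longrightarrow>
      zz_map V n (y j) = (if j \<in> Q then e j n else 0)"
  shows "\<exists>J' iv' e'. interval_basis (Suc n) V J' iv' e'"
proof -
  interpret ambient_space "zz_scale V" by (rule ambient_space_zz_scale[OF V])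
  note fin = interval_basisD(1)[OF e] and valid = interval_basisD(2)[OF e] and zero = interval_basisD(3)[OF e]
    and basis = interval_basisD(4)[OF e] and fwd = interval_basisD(5)[OF e] and bwd = interval_basisD(6)[OF e]
  define iv' where "iv' j = (if j \<in> N then (Suc n, Suc n) else if j \<in> Q then (fst (iv j), Suc n) else iv j)" for j
  define e' where "e' j i = (if \<not> covers (iv' j) i then 0 else if i = Suc n then y j else e j i)" for j i
  have QJ: "j \<in> J" "snd (iv j) = n" "j \<notin> N" if "j \<in> Q" for j
  proof -
    show j: "j \<in> J" and "j \<notin> N" using Q N(2) that by auto
    show "snd (iv j) = n" using valid[OF j] Q that by (auto simp: valid_bar_def covers_def)
  qed
  have cov_old: "covers (iv' j) i \<longleftrightarrow> covers (iv j) i" if "j \<in> J" "i \<le> n" for i j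
    using that QJ[of j] N(2) unfolding iv'_def covers_def by auto
  have cov_N: "covers (iv' j) i \<longleftrightarrow> i = Suc n" if "j \<in> N" for i j
    using that unfolding iv'_def covers_def by auto
  have cov_new: "covers (iv' j) (Suc n) \<longleftrightarrow> j \<in> Q \<union> N" if "j \<in> J \<union> N" for j
    using that valid[of j] QJ[of j] unfolding iv'_def covers_def valid_bar_def by auto
  have old: "e' j i = e j i" if "j \<in> J" "i \<le> n" for j i
    using that zero[of j i] unfolding e'_def by (auto simp: cov_old)
  have e'_new: "e' j (Suc n) = (if j \<in> Q \<union> N then y j else 0)" if "j \<in> J \<union> N" for j
    using cov_new[OF that] by (simp add: e'_def)
  have "interval_basis (Suc n) V (J \<union> N) iv' e'"
    unfolding interval_basis_def
  proof (intro conjI ballI allI impI)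
    show "finite (J \<union> N)" using fin N(1) by simp
    show "valid_bar (Suc n) (iv' j)" if "j \<in> J \<union> N" for j
      using that valid[of j] QJ[of j] unfolding iv'_def valid_bar_def by auto
    show "e' j i = 0" if "\<not> covers (iv' j) i" for j i using that by (simp add: e'_def)
  next
    fix i assume i: "i \<in> {1..Suc n}"
    show "basis_family {j\<in>J \<union> N. covers (iv' j) i} (\<lambda>j. e' j i) (zz_space V i)"
    proof (cases "i = Suc n")
      case True
      have "{j\<in>J \<union> N. covers (iv' j) i} = Q \<union> N" using True cov_new QJ(1) by blast
      moreover have "basis_family (Q \<union> N) (\<lambda>j. e' j i) (zz_space V i)"
        using y unfolding True by (rule basis_family_cong[THEN iffD1, rotated]) (use e'_new QJ(1) in auto)
      ultimately show ?thesis by simp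
    next
      case False
      then have i': "i \<in> {1..n}" "i \<le> n" using i by auto
      have "{j\<in>J \<union> N. covers (iv' j) i} = {j\<in>J. covers (iv j) i}"
        using cov_old[OF _ i'(2)] cov_N False by blast
      moreover have "basis_family {j\<in>J. covers (iv j) i} (\<lambda>j. e' j i) (zz_space V i)"
        using basis[OF i'(1)] by (rule basis_family_cong[THEN iffD1, rotated]) (use old i'(2) in auto)
      ultimately show ?thesis by simp
    qed
  next
    fix i j assume i: "i \<in> {1..<Suc n}" and j: "j \<in> J \<union> N" and dir: "zz_dir V i = Forward"
      and cov: "covers (iv' j) i"
    have jJ: "j \<in> J" using cov_N[of j i] cov i j by auto
    have in': "i \<le> n" using i by simp
    have cov': "covers (iv j) i" using cov cov_old[OF jJ in'] by simp
    show "zz_map V i (e' j i) = e' j (i + 1)"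
    proof (cases "i = n")
      case True
      then show ?thesis using fwd_n[of j] dir jJ cov' old[OF jJ, of n] e'_new[OF j] N(2) by auto
    next
      case False
      then have "i \<in> {1..<n}" using i by auto
      then show ?thesis using fwd[OF _ jJ dir cov'] old[OF jJ, of i] old[OF jJ, of "i + 1"] by simp
    qed
  next
    fix i j assume i: "i \<in> {1..<Suc n}" and j: "j \<in> J \<union> N" and dir: "zz_dir V i = Backward"
      and cov: "covers (iv' j) (i + 1)"
    show "zz_map V i (e' j (i + 1)) = e' j i"
    proof (cases "i = n")
      case True
      then have jQ: "j \<in> Q \<union> N" using cov cov_new[OF j] by simp
      have "e' j n = (if j \<in> Q then e j n else 0)"
        using jQ QJ(1) old[of j n] cov_N[of j n] QJ(3) by (auto simp: e'_def)
      then show ?thesis using True bwd_n[of j] dir jQ e'_new[OF j] by simp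
    next
      case False
      then have i': "i \<in> {1..<n}" using i by auto
      have jJ: "j \<in> J" using cov_N[of j "i + 1"] cov i' j by auto
      have "covers (iv j) (i + 1)" using cov cov_old[OF jJ, of "i + 1"] i' by simp
      then show ?thesis using bwd[OF i' jJ dir] old[OF jJ, of i] old[OF jJ, of "i + 1"] i' by simp
    qed
  qed
  then show ?thesis by blast
qed

lemma zigzag_module_Suc: "zigzag_module (Suc n) V \<Longrightarrow> zigzag_module n V"
  unfolding zigzag_module_def by auto

lemma interval_basis_exists:
  fixes V :: "('a::field, 'v::ab_group_add) zigzag"
  assumes "zigzag_module n V"
  shows "\<exists>J iv e. interval_basis n V J iv e"
  using assms
proof (induction n)
  case 0
  have "interval_basis 0 V {} (\<lambda>_. (1, 0)) (\<lambda>_ _. 0)" by (simp add: interval_basis_def)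
  then show ?case by blast
next
  case (Suc n)
  interpret ambient_space "zz_scale V" by (rule ambient_space_zz_scale[OF Suc.prems])
  let ?B = "zz_space V (Suc n)"
  have B: "subspace ?B" using zigzag_moduleD(3)[OF Suc.prems, of "Suc n"] by simp
  obtain B0 where B0: "?B \<subseteq> span B0" "finite B0"
    using zigzag_moduleD(2)[OF Suc.prems, of "Suc n"] unfolding fd_subspace_def by auto
  \<comment> \<open>A module of length one has no arrow to cross, so any basis will do.\<close>
  show ?case
  proof (cases "n = 0")
    case True
    obtain N :: "nat set" and y where N: "finite N" "basis_family N y ?B"
      by (rule basis_family_extend[OF B B0, of "{}" undefined "{}"]) (auto simp: indep_family_def)
    have y: "basis_family N (\<lambda>j. if i = 1 then y j else 0) ?B" if "i = 1" for i :: nat using N(2) that by simp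
    have "interval_basis 1 V N (\<lambda>_. (1, 1)) (\<lambda>j i. if i = 1 then y j else 0)"
      unfolding interval_basis_def using N True y by (auto simp: covers_def valid_bar_def)
    then show ?thesis using True by auto
  next
    case False
    then have n: "1 \<le> n" "n \<in> {1..n}" "n \<in> {1..<Suc n}" by auto
    have V': "zigzag_module n V" by (rule zigzag_module_Suc[OF Suc.prems])
    obtain J iv e where e: "interval_basis n V J iv e" using Suc.IH[OF V'] by blast
    have A: "subspace (zz_space V n)" by (rule zigzag_moduleD(3)[OF V' n(2)])
    let ?T = "{j\<in>J. covers (iv j) n}"
    show ?thesis
    proof (cases "zz_dir V n")
      case Forward
      let ?K = "{v\<in>zz_space V n. zz_map V n v = 0}"
      have p: "linear_between (zz_scale V) (zz_space V n) (zz_scale V) ?B (zz_map V n)"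
        using zigzag_moduleD(4)[OF Suc.prems n(3)] Forward by (simp add: zz_source_def zz_target_def)
      have K: "subspace ?K"
        using linear_betweenD(2,3)[OF p] linear_between_0[OF p A]
        by (intro subspaceI) (auto simp: subspace_0[OF A] subspace_add[OF A] subspace_scale[OF A])
      have "?K \<subseteq> zz_space V n" by blast
      then obtain e' P where e': "interval_basis n V J iv e'" "P \<subseteq> ?T"
        "\<And>j. j \<in> P \<Longrightarrow> e' j n \<in> ?K" "?K \<subseteq> span ((\<lambda>j. e' j n) ` P)"
        by (rule interval_basis_adapt[OF V' n(1) e K]) blast
      have fin: "finite J" and basis: "basis_family ?T (\<lambda>j. e' j n) (zz_space V n)"
        using e'(1) n(2) unfolding interval_basis_def by auto
      obtain N y where N: "finite N" "N \<inter> J = {}" "\<And>j. j \<in> ?T - P \<Longrightarrow> y j = zz_map V n (e' j n)"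
        "basis_family ((?T - P) \<union> N) y ?B"
        by (rule basis_family_image[OF p basis e'(2,4) B B0 fin]) blast+
      show ?thesis
      proof (rule interval_basis_Suc[OF Suc.prems n(1) e'(1) _ N(1,2,4)])
        show "zz_map V n (e' j n) = (if j \<in> ?T - P then y j else 0)" if "j \<in> J" "covers (iv j) n" for j
          using that N(3)[of j] e'(3)[of j] by auto
      qed (use Forward in auto)
    next
      case Backward
      let ?K = "zz_map V n ` ?B"
      have p: "linear_between (zz_scale V) ?B (zz_scale V) (zz_space V n) (zz_map V n)"
        using zigzag_moduleD(4)[OF Suc.prems n(3)] Backward by (simp add: zz_source_def zz_target_def)
      have K: "subspace ?K"
      proof (rule subspaceI)
        show "0 \<in> ?K" using linear_between_0[OF p B] subspace_0[OF B] by (metis imageI)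
        show "x + y \<in> ?K" if "x \<in> ?K" "y \<in> ?K" for x y
          using that linear_betweenD(2)[OF p, symmetric] subspace_add[OF B] by auto
        show "zz_scale V c x \<in> ?K" if "x \<in> ?K" for c x
          using that linear_betweenD(3)[OF p, symmetric] subspace_scale[OF B] by auto
      qed
      have "?K \<subseteq> zz_space V n" using linear_betweenD(1)[OF p] by blast
      then obtain e' P where e': "interval_basis n V J iv e'" "P \<subseteq> ?T"
        "\<And>j. j \<in> P \<Longrightarrow> e' j n \<in> ?K" "?K \<subseteq> span ((\<lambda>j. e' j n) ` P)"
        by (rule interval_basis_adapt[OF V' n(1) e K]) blast
      have fin: "finite J" and basis: "basis_family ?T (\<lambda>j. e' j n) (zz_space V n)"
        using e'(1) n(2) unfolding interval_basis_def by auto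
      obtain N y where N: "finite N" "N \<inter> J = {}" "\<And>j. j \<in> P \<Longrightarrow> zz_map V n (y j) = e' j n"
        "\<And>j. j \<in> N \<Longrightarrow> zz_map V n (y j) = 0" "basis_family (P \<union> N) y ?B"
        by (rule basis_family_preimage[OF p basis e'(2,3,4) B B0 fin]) blast+
      show ?thesis
        by (rule interval_basis_Suc[OF Suc.prems n(1) e'(1,2) N(1,2,5)])
          (use Backward N(3,4) in auto)
    qed
  qed
qed

theorem barcode_exists:
  fixes V :: "('a::field, 'v::ab_group_add) zigzag"
  assumes "zigzag_module n V"
  shows "\<exists>D. barcode n V D"
proof -
  obtain J iv e where e: "interval_basis n V J iv e" using interval_basis_exists[OF assms] by blast
  then have "finite J" "\<And>j. j \<in> J \<Longrightarrow> valid_bar n (iv j)" unfolding interval_basis_def by auto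
  from barcodeI[OF this interval_basis_imp_iso[OF assms e]] show ?thesis by blast
qed

lemma barcode_dgm: "zigzag_module n V \<Longrightarrow> barcode n V (dgm n V)"
  using barcode_exists dgm_eqI by metis

section \<open>Arrow reversals and direct summands\<close>

text \<open>
  If the map at \<open>k\<close> is bijective, every interval covers both \<open>k\<close> and \<open>k + 1\<close> or neither of them.  So the map is the
  identity on coordinates, and so is its inverse.
\<close>

lemma bar_module_reverse_arrow:
  fixes V :: "('a::field, 'v::ab_group_add) zigzag" and iv :: "'j \<Rightarrow> nat \<times> nat"
  assumes iso: "zz_iso n (bar_module \<tau> J iv :: ('a, 'j \<Rightarrow> 'a) zigzag) V"
    and k: "1 \<le> k" "k < n" and bij: "bij_betw (zz_map V k) (zz_source V k) (zz_target V k)"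
  shows "\<exists>\<tau>'. zz_iso n (bar_module \<tau>' J iv :: ('a, 'j \<Rightarrow> 'a) zigzag) (reverse_arrow k V)"
proof -
  let ?B = "bar_module \<tau> J iv :: ('a, 'j \<Rightarrow> 'a) zigzag"
  from iso obtain f where "iso_family n ?B V f" by (rule zz_isoE)
  note f = iso_familyD[OF this]
  have dir: "zz_dir V i = \<tau> i" if "i \<in> {1..<n}" for i using same_type_dir[OF f(1) that] by simp
  \<comment> \<open>\<open>a\<close> and \<open>b\<close> are the indices of the source and the target of the arrow.\<close>
  define a where "a = (if \<tau> k = Forward then k else k + 1)"
  define b where "b = (if \<tau> k = Forward then k + 1 else k)"
  have kn: "k \<in> {1..<n}" using k by simp
  have ab: "a \<in> {1..n}" "b \<in> {1..n}" using k unfolding a_def b_def by auto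
  have src: "zz_source V k = zz_space V a" and tgt: "zz_target V k = zz_space V b"
    using dir[OF kn] unfolding zz_source_def zz_target_def a_def b_def by (auto split: direction.splits)
  have comm: "f b (zz_map ?B k x) = zz_map V k (f a x)" if "x \<in> zz_space ?B a" for x
    using f(4)[OF kn, of x] f(5)[OF kn, of x] that unfolding a_def b_def
    by (cases "\<tau> k") (simp_all del: bar_module_simps(3,4))
  have inj: "inj_on (zz_map V k) (zz_space V a)" and im: "zz_map V k ` zz_space V a = zz_space V b"
    using bij unfolding src tgt bij_betw_def by auto
  have fa: "inj_on (f a) (zz_space ?B a)" "f a ` zz_space ?B a = zz_space V a"
    and fb: "inj_on (f b) (zz_space ?B b)" "f b ` zz_space ?B b = zz_space V b"
    using f(3)[OF ab(1)] f(3)[OF ab(2)] unfolding bij_betw_def by auto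
  have faV: "f a x \<in> zz_space V a" if "x \<in> zz_space ?B a" for x using fa(2) that by blast
  have mapB: "zz_map ?B k x = (\<lambda>j. if j \<in> J \<and> covers (iv j) a \<and> covers (iv j) b then x j else 0)" for x
    unfolding a_def b_def by (auto simp: fun_eq_iff)
  have mapBb: "zz_map ?B k x \<in> zz_space ?B b" if "x \<in> zz_space ?B a" for x
    unfolding mapB by (simp add: coord_space_def)
  have both: "covers (iv j) a \<longleftrightarrow> covers (iv j) b" if j: "j \<in> J" for j
  proof
    assume a: "covers (iv j) a"
    let ?x = "unit_vec j :: 'j \<Rightarrow> 'a"
    show "covers (iv j) b"
    proof (rule ccontr)
      assume b: "\<not> covers (iv j) b"
      have x: "?x \<in> zz_space ?B a" using a j by (simp add: unit_vec_in_coord_space)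
      have 0: "0 \<in> zz_space ?B a" by (simp add: coord_space_def)
      have "zz_map ?B k ?x = zz_map ?B k 0" unfolding mapB using b by (auto simp: unit_vec_def fun_eq_iff)
      then have "zz_map V k (f a ?x) = zz_map V k (f a 0)" using comm[OF x] comm[OF 0] by simp
      then have "f a ?x = f a 0" using inj_onD[OF inj] faV[OF x] faV[OF 0] by blast
      then have "?x = 0" by (rule inj_onD[OF fa(1) _ x 0])
      then have "?x j = 0" by simp
      then show False by (simp add: unit_vec_def)
    qed
  next
    assume b: "covers (iv j) b"
    let ?y = "unit_vec j :: 'j \<Rightarrow> 'a"
    have y: "?y \<in> zz_space ?B b" using b j by (simp add: unit_vec_in_coord_space)
    then have "f b ?y \<in> zz_map V k ` f a ` zz_space ?B a" using fb(2) im fa(2) by blast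
    then obtain x where x: "x \<in> zz_space ?B a" "f b ?y = zz_map V k (f a x)" by blast
    then have "f b ?y = f b (zz_map ?B k x)" using comm by simp
    then have "?y = zz_map ?B k x" by (rule inj_onD[OF fb(1) _ y mapBb[OF x(1)]])
    then have "?y j = zz_map ?B k x j" by simp
    then show "covers (iv j) a" unfolding mapB by (auto simp: unit_vec_def split: if_splits)
  qed
  have same: "zz_space ?B a = zz_space ?B b" using both by (simp cong: conj_cong)
  have mapB_id: "zz_map ?B k x = x" if "x \<in> zz_space ?B a" for x
    using that both unfolding mapB by (auto simp: fun_eq_iff coord_space_def)
  define e where "e = (case \<tau> k of Forward \<Rightarrow> Backward | Backward \<Rightarrow> Forward)"
  define \<tau>' where "\<tau>' = \<tau>(k := e)"
  let ?B' = "bar_module \<tau>' J iv :: ('a, 'j \<Rightarrow> 'a) zigzag"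
  let ?V' = "reverse_arrow k V"
  have sB: "zz_space ?B' = zz_space ?B" "zz_map ?B' = zz_map ?B" by (auto simp: fun_eq_iff)
  have sV: "zz_space ?V' = zz_space V" "zz_scale ?V' = zz_scale V"
    "zz_dir ?V' = (zz_dir V)(k := e)" "i \<noteq> k \<Longrightarrow> zz_map ?V' i = zz_map V i" for i
    using dir[OF kn] by (auto simp: reverse_arrow_def e_def)
  have new: "f a (zz_map ?B k x) = zz_map ?V' k (f b x)" if "x \<in> zz_space ?B b" for x
  proof -
    have x: "x \<in> zz_space ?B a" using that same by simp
    have fbx: "f b x = zz_map V k (f a x)" using comm[OF x] mapB_id[OF x] by simp
    have "zz_map ?V' k (f b x) = inv_into (zz_space V a) (zz_map V k) (f b x)"
      by (simp add: reverse_arrow_def src)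
    also have "\<dots> = f a x" unfolding fbx by (rule inv_into_f_f[OF inj faV[OF x]])
    finally show ?thesis using mapB_id[OF x] by simp
  qed
  have "zz_iso n ?B' ?V'"
  proof (rule zz_isoI[where f = f])
    show "same_type n ?B' ?V'" unfolding same_type_def sV using dir by (simp add: \<tau>'_def)
    show "linear_between (zz_scale ?B') (zz_space ?B' i) (zz_scale ?V') (zz_space ?V' i) (f i)"
      if "i \<in> {1..n}" for i using f(2)[OF that] unfolding sB sV by simp
    show "bij_betw (f i) (zz_space ?B' i) (zz_space ?V' i)" if "i \<in> {1..n}" for i
      using f(3)[OF that] unfolding sB sV .
  next
    fix i x assume i: "i \<in> {1..<n}" "zz_dir ?B' i = Forward" "x \<in> zz_space ?B' i"
    show "f (i + 1) (zz_map ?B' i x) = zz_map ?V' i (f i x)"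
    proof (cases "i = k")
      case True
      then have "a = k + 1" "b = k"
        using i(2) unfolding a_def b_def \<tau>'_def e_def by (auto split: direction.splits)
      then show ?thesis using new[of x] i(3) True unfolding sB by simp
    next
      case False
      then show ?thesis using f(4)[OF i(1), of x] i(2,3) sV(4)[OF False] unfolding sB by (simp add: \<tau>'_def)
    qed
  next
    fix i x assume i: "i \<in> {1..<n}" "zz_dir ?B' i = Backward" "x \<in> zz_space ?B' (i + 1)"
    show "f i (zz_map ?B' i x) = zz_map ?V' i (f (i + 1) x)"
    proof (cases "i = k")
      case True
      then have "a = k" "b = k + 1"
        using i(2) unfolding a_def b_def \<tau>'_def e_def by (auto split: direction.splits)
      then show ?thesis using new[of x] i(3) True unfolding sB by simp
    next
      case False
      then show ?thesis using f(5)[OF i(1), of x] i(2,3) sV(4)[OF False] unfolding sB by (simp add: \<tau>'_def)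
    qed
  qed
  then show ?thesis by blast
qed

lemma bar_module_arrow_reversals:
  fixes V :: "('a::field, 'v::ab_group_add) zigzag" and iv :: "'j \<Rightarrow> nat \<times> nat"
  assumes "arrow_reversals n V V'" and "zz_iso n (bar_module \<tau> J iv :: ('a, 'j \<Rightarrow> 'a) zigzag) V"
  shows "\<exists>\<tau>'. zz_iso n (bar_module \<tau>' J iv :: ('a, 'j \<Rightarrow> 'a) zigzag) V'"
  using assms
proof (induction rule: arrow_reversals.induct)
  case (step V' k)
  then show ?case using bar_module_reverse_arrow by blast
qed blast

lemma zz_iso_refl: "zz_iso n V V"
  by (rule zz_isoI[where f = "\<lambda>i x. x"])
    (auto simp: same_type_def linear_between_def bij_betw_def)

lemma mset_set_Plus:
  assumes "finite A" "finite B"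
  shows "mset_set (A <+> B) = image_mset Inl (mset_set A) + image_mset Inr (mset_set B)"
  unfolding Plus_def using assms by (subst mset_set_Union) (auto simp: image_mset_mset_set)

text \<open>
  Arrow reversals do not change the intervals, and the complementary summand contributes the intervals \<open>E\<close>; by
  uniqueness the diagram of \<open>W\<close> is \<open>D + E\<close>.
\<close>

lemma dgm_mono_of_sub_equiv:
  fixes W :: "('a::field, 'w::ab_group_add) zigzag"
  assumes D: "\<And>I. I \<in># D \<Longrightarrow> valid_bar n I" and W: "zigzag_module n W"
    and sub: "sub_equiv n (interval_sum \<tau> D :: ('a, 'a univ) zigzag) W"
  shows "D \<subseteq># dgm n W"
proof -
  let ?C = "\<lambda>D. {(x, j). j < count D x} :: ((nat \<times> nat) \<times> nat) set"
  obtain W' :: "('a, 'a univ) zigzag" and V' :: "('a, 'a univ) zigzag" and U :: "('a, 'w) zigzag"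
    where V': "arrow_reversals n (interval_sum \<tau> D :: ('a, 'a univ) zigzag) V'" "zz_iso n V' W'"
      and U: "zigzag_module n U" "same_type n W' U" and iso: "zz_iso n W (zz_sum W' U)"
    using sub unfolding sub_equiv_def zz_equiv_def summand_def by blast
  obtain \<tau>' where "zz_iso n (bar_module \<tau>' (?C D) fst :: ('a, 'a univ) zigzag) V'"
    using bar_module_arrow_reversals[OF V'(1), unfolded interval_sum_eq_bar_module, OF zz_iso_refl] by blast
  then have W': "zz_iso n (bar_module \<tau>' (?C D) fst :: ('a, 'a univ) zigzag) W'"
    by (rule zz_iso_trans[OF _ V'(2)])
  define E where "E = dgm n U"
  have E: "\<And>I. I \<in># E \<Longrightarrow> valid_bar n I" "zz_iso n (bar_module (zz_dir U) (?C E) fst :: ('a, 'a univ) zigzag) U"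
    using barcode_dgm[OF U(1)] unfolding barcode_def interval_sum_eq_bar_module E_def by auto
  have "zz_iso n (bar_module \<tau>' (?C E) fst :: ('a, 'a univ) zigzag)
      (bar_module (zz_dir U) (?C E) fst :: ('a, 'a univ) zigzag)"
    by (rule bar_module_iso_direction)
      (use same_type_dir[OF U(2)] same_type_dir[OF zz_iso_same_type[OF W']] in simp)
  then have U': "zz_iso n (bar_module \<tau>' (?C E) fst :: ('a, 'a univ) zigzag) U"
    by (rule zz_iso_trans[OF _ E(2)])
  let ?J = "?C D <+> ?C E" and ?iv = "case_sum fst fst :: _ \<Rightarrow> nat \<times> nat"
  have "zz_iso n (bar_module \<tau>' ?J ?iv :: ('a, ((nat \<times> nat) \<times> nat) + ((nat \<times> nat) \<times> nat) \<Rightarrow> 'a) zigzag) W"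
    by (rule zz_iso_trans[OF bar_module_iso_sum[OF W' U'] zz_iso_sym[OF W iso]])
  moreover have "valid_bar n (?iv j)" if "j \<in> ?J" for j
  proof -
    have mem: "x \<in># F" if "i < count F x" for x i and F :: "(nat \<times> nat) multiset"
      using that by (metis not_in_iff not_less_zero)
    show ?thesis using that D E(1) mem by auto
  qed
  ultimately have "barcode n W (image_mset ?iv (mset_set ?J))"
    by (intro barcodeI) (simp_all add: finite_copies)
  moreover have "image_mset ?iv (mset_set ?J) = D + E"
    by (simp add: mset_set_Plus finite_copies multiset.map_comp comp_def image_fst_copies)
  ultimately show ?thesis using dgm_eqI by (metis mset_subset_eq_add_left)
qed

section \<open>Limits and colimits of sums of intervals\<close>

text \<open>
  The dimension, zero or one, of the limit or colimit at \<open>k\<close> of a single interval module.  The arrows at \<open>k - 1\<close> and \<open>k\<close>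
  have the directions \<open>p\<close> and \<open>q\<close>, and \<open>a\<close>, \<open>m\<close>, \<open>c\<close> tell whether the interval covers \<open>k - 1\<close>, \<open>k\<close>, \<open>k + 1\<close>.  For arrows of the
  same direction the limit is the space at their start and the colimit the space at their end.  The limit of two
  outgoing and the colimit of two incoming arrows at \<open>k\<close> is the middle space.  What remains is a pullback or
  pushout: it is a line if both outer indices are covered, or one of them but not the middle.
\<close>

definition apex_covered :: "universal_kind \<Rightarrow> direction \<Rightarrow> direction \<Rightarrow> bool \<Rightarrow> bool \<Rightarrow> bool \<Rightarrow> bool" where
  "apex_covered u p q a m c \<longleftrightarrow>
     (if p = q then (if (u = Limit_Functor) = (p = Forward) then a else c)
      else if (u = Limit_Functor) = (p = Forward) then a \<and> c \<or> (a \<or> c) \<and> \<not> m else m)"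

definition apex_covered_at :: "universal_kind \<Rightarrow> (nat \<Rightarrow> direction) \<Rightarrow> nat \<Rightarrow> nat \<times> nat \<Rightarrow> bool" where
  "apex_covered_at u \<tau> k I \<longleftrightarrow>
     apex_covered u (\<tau> (k - 1)) (\<tau> k) (covers I (k - 1)) (covers I k) (covers I (k + 1))"

text \<open>
  If exactly one neighbour of \<open>k\<close> is covered, the endpoint next to \<open>k\<close> is determined by whether \<open>k\<close> is covered afterwards.
\<close>

definition reflect_bar :: "universal_kind \<Rightarrow> (nat \<Rightarrow> direction) \<Rightarrow> nat \<Rightarrow> nat \<times> nat \<Rightarrow> nat \<times> nat" where
  "reflect_bar u \<tau> k I =
     (if covers I (k - 1) = covers I (k + 1) then I
      else if covers I (k - 1) then (fst I, if apex_covered_at u \<tau> k I then k else k - 1)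
      else (if apex_covered_at u \<tau> k I then k else k + 1, snd I))"

lemma apex_covered_const: "a = c \<Longrightarrow> m = a \<Longrightarrow> apex_covered u p q a m c = a"
  unfolding apex_covered_def by auto

lemma apex_covered_imp: "a \<and> c \<longrightarrow> m \<Longrightarrow> m \<longrightarrow> a \<or> c \<Longrightarrow> apex_covered u p q a m c \<Longrightarrow> a \<or> c"
  unfolding apex_covered_def by (auto split: if_splits)

text \<open>
  By convexity, and because a non-simple interval is not \<open>{k}\<close>, five patterns of coverage around \<open>k\<close> are left besides
  the empty one.
\<close>

lemma interval_neighbours:
  assumes "fst I < snd I" "1 \<le> k"
  shows "covers I (k - 1) \<and> covers I (k + 1) \<longrightarrow> covers I k"
    "covers I k \<longrightarrow> covers I (k - 1) \<or> covers I (k + 1)"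
proof -
  have "k - 1 + 1 = k" using assms(2) by simp
  then show "covers I (k - 1) \<and> covers I (k + 1) \<longrightarrow> covers I k"
    "covers I k \<longrightarrow> covers I (k - 1) \<or> covers I (k + 1)"
    using assms unfolding covers_def by linarith+
qed

lemma covers_reflect_bar:
  assumes I: "fst I < snd I" and k: "1 \<le> k"
  shows "covers (reflect_bar u \<tau> k I) i \<longleftrightarrow> (if i = k then apex_covered_at u \<tau> k I else covers I i)"
proof (cases "covers I (k - 1) = covers I (k + 1)")
  case True
  then have "covers I k = covers I (k - 1)" using interval_neighbours[OF I k] by auto
  then show ?thesis using True apex_covered_const[OF True] unfolding reflect_bar_def apex_covered_at_def by auto
next
  case False
  then show ?thesis using I k unfolding reflect_bar_def covers_def by auto
qed

lemma valid_bar_reflect_bar: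
  assumes I: "valid_bar n I" "fst I < snd I" and k: "1 \<le> k" "k \<le> n"
  shows "valid_bar n (reflect_bar u \<tau> k I)"
  using assms unfolding reflect_bar_def valid_bar_def covers_def by auto

lemma l1_dist_reflect_bar:
  assumes I: "fst I < snd I" and k: "1 \<le> k"
  shows "l1_dist I (reflect_bar u \<tau> k I) \<le> 1"
  using assms unfolding reflect_bar_def l1_dist_def covers_def by auto

text \<open>
  A cone over one interval summand: \<open>A\<close>, \<open>M\<close>, \<open>C\<close> are coordinates of its three legs at a vector, and \<open>H\<close> the coordinate of the
  mediating map, which can be read off from either outer leg that is covered.
\<close>

lemma limit_coordinate:
  fixes A M C :: "'b::zero"
  assumes "a \<and> c \<longrightarrow> m" "m \<longrightarrow> a \<or> c"
    and "A \<noteq> 0 \<longrightarrow> a" "M \<noteq> 0 \<longrightarrow> m" "C \<noteq> 0 \<longrightarrow> c"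
    and "p = Forward \<Longrightarrow> (if a \<and> m then A else 0) = M" "p = Backward \<Longrightarrow> (if a \<and> m then M else 0) = A"
    and "q = Forward \<Longrightarrow> (if m \<and> c then M else 0) = C" "q = Backward \<Longrightarrow> (if m \<and> c then C else 0) = M"
    and H: "H = (if apex_covered Limit_Functor p q a m c then if a then A else C else 0)"
  shows "(if a then H else 0) = A" "(if m then H else 0) = M" "(if c then H else 0) = C"
  using assms(1-9) unfolding H apex_covered_def
  by (cases p; cases q; cases a; cases m; cases c; auto)+

text \<open>
  Dually, \<open>A\<close>, \<open>M\<close>, \<open>C\<close> are the images of a basis vector under the legs of a cocone, and \<open>H\<close> is its image under the mediating map.
\<close>

lemma colimit_coordinate:
  fixes A M C :: "'b::zero"
  assumes "a \<and> c \<longrightarrow> m" "m \<longrightarrow> a \<or> c"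
    and "p = Forward \<Longrightarrow> a \<Longrightarrow> (if m then M else 0) = A" "p = Backward \<Longrightarrow> m \<Longrightarrow> (if a then A else 0) = M"
    and "q = Forward \<Longrightarrow> m \<Longrightarrow> (if c then C else 0) = M" "q = Backward \<Longrightarrow> c \<Longrightarrow> (if m then M else 0) = C"
    and H: "H = (if apex_covered Colimit_Functor p q a m c then if a then A else C else 0)"
  shows "a \<Longrightarrow> H = A" "m \<Longrightarrow> H = M" "c \<Longrightarrow> H = C"
  using assms(1-6) unfolding H apex_covered_def
  by (cases p; cases q; cases a; cases m; cases c; auto)+

lemma is_limitI_bar_module:
  fixes iv :: "'j \<Rightarrow> nat \<times> nat" and \<tau> k J
  defines "V \<equiv> bar_module \<tau> J iv :: ('a::field, 'j \<Rightarrow> 'a) zigzag"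
    and "L \<equiv> coord_space {j\<in>J. apex_covered_at Limit_Functor \<tau> k (iv j)} :: ('j \<Rightarrow> 'a) set"
    and "\<pi> \<equiv> \<lambda>i x j. if covers (iv j) i then x j else (0 :: 'a)"
  assumes fin: "finite J" and iv: "\<And>j. j \<in> J \<Longrightarrow> fst (iv j) < snd (iv j)" and k: "1 \<le> k"
  shows "is_limit V k L \<pi>"
proof -
  let ?apex_covered = "\<lambda>j. apex_covered_at Limit_Functor \<tau> k (iv j)"
  note nb = interval_neighbours[OF iv k]
  have k1: "k - 1 + 1 = k" "Suc (k - 1) = k" "Suc (k - Suc 0) = k" using k by simp_all
  have V: "zz_scale V = pointwise_scale" "zz_dir V = \<tau>"
    "zz_map V i x = (\<lambda>j. if j \<in> J \<and> covers (iv j) i \<and> covers (iv j) (i + 1) then x j else 0)"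
    "zz_space V i = coord_space {j\<in>J. covers (iv j) i}" for i x
    unfolding V_def by (rule bar_module_simps)+
  have L: "x \<in> L \<longleftrightarrow> (\<forall>j. x j \<noteq> 0 \<longrightarrow> j \<in> J \<and> ?apex_covered j)" for x
    unfolding L_def coord_space_def by simp
  have comm: "(\<tau> i = Forward \<longrightarrow> covers (iv j) (i + 1) \<longrightarrow> covers (iv j) i) \<and>
      (\<tau> i = Backward \<longrightarrow> covers (iv j) i \<longrightarrow> covers (iv j) (i + 1))"
    if "i \<in> {k - 1, k}" "j \<in> J" "?apex_covered j" for i j
    using that(1,3) nb[OF that(2)] unfolding apex_covered_at_def apex_covered_def
    by (cases "\<tau> (k - 1)"; cases "\<tau> k") (auto simp: k1)
  have "is_cone V k L \<pi>"
    unfolding is_cone_def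
  proof (intro conjI ballI)
    show "fd_subspace (zz_scale V) L"
      unfolding V L_def by (rule fd_subspace_coord_space) (use fin in simp)
    show "linear_between (zz_scale V) L (zz_scale V) (zz_space V i) (\<pi> i)" for i
      by (rule linear_betweenI) (auto simp: V L coord_space_def \<pi>_def fun_eq_iff)
    show "case zz_dir V i of Forward \<Rightarrow> zz_map V i (\<pi> i x) = \<pi> (i + 1) x
        | Backward \<Rightarrow> zz_map V i (\<pi> (i + 1) x) = \<pi> i x"
      if i: "i \<in> {k - 1, k}" and x: "x \<in> L" for i x
    proof (cases "\<tau> i")
      case Forward
      have "zz_map V i (\<pi> i x) j = \<pi> (i + 1) x j" for j
        using comm[OF i, of j] x Forward by (cases "x j = 0") (auto simp: V L \<pi>_def)
      then show ?thesis using Forward by (simp add: V(2) fun_eq_iff)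
    next
      case Backward
      have "zz_map V i (\<pi> (i + 1) x) j = \<pi> i x j" for j
        using comm[OF i, of j] x Backward by (cases "x j = 0") (auto simp: V L \<pi>_def)
      then show ?thesis using Backward by (simp add: V(2) fun_eq_iff)
    qed
  qed
  moreover have "\<exists>h. linear_between (zz_scale V) X (zz_scale V) L h \<and>
             (\<forall>i\<in>{k - 1, k, k + 1}. \<forall>x\<in>X. \<pi> i (h x) = \<phi> i x) \<and>
             (\<forall>h'. linear_between (zz_scale V) X (zz_scale V) L h' \<and>
                   (\<forall>i\<in>{k - 1, k, k + 1}. \<forall>x\<in>X. \<pi> i (h' x) = \<phi> i x)
                   \<longrightarrow> (\<forall>x\<in>X. h' x = h x))" if cone: "is_cone V k X \<phi>" for X \<phi>
  proof -
    define h where "h x j = (if j \<in> J \<and> ?apex_covered j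
      then if covers (iv j) (k - 1) then \<phi> (k - 1) x j else \<phi> (k + 1) x j else 0)" for x j
    have lin: "linear_between pointwise_scale X pointwise_scale (zz_space V i) (\<phi> i)"
      if "i \<in> {k - 1, k, k + 1}" for i
      using cone that unfolding is_cone_def V(1) by blast
    have fwd: "zz_map V i (\<phi> i x) = \<phi> (i + 1) x" if "i \<in> {k - 1, k}" "x \<in> X" "\<tau> i = Forward" for i x
      using cone that unfolding is_cone_def V(2) by (auto dest!: bspec[of _ _ i])
    have bwd: "zz_map V i (\<phi> (i + 1) x) = \<phi> i x" if "i \<in> {k - 1, k}" "x \<in> X" "\<tau> i = Backward" for i x
      using cone that unfolding is_cone_def V(2) by (auto dest!: bspec[of _ _ i])
    have supp: "j \<in> J \<and> covers (iv j) i" if "i \<in> {k - 1, k, k + 1}" "x \<in> X" "\<phi> i x j \<noteq> 0" for i x j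
      using linear_betweenD(1)[OF lin[OF that(1)] that(2)] that(3) unfolding V coord_space_def by blast
    have legs: "\<pi> i (h x) = \<phi> i x" if i: "i \<in> {k - 1, k, k + 1}" and x: "x \<in> X" for i x
    proof
      fix j
      show "\<pi> i (h x) j = \<phi> i x j"
      proof (cases "j \<in> J")
        case False
        then show ?thesis using supp[OF i x, of j] by (auto simp: \<pi>_def h_def)
      next
        case True
        note j = True
        have rel: "\<tau> (k - 1) = Forward \<Longrightarrow> (if covers (iv j) (k - 1) \<and> covers (iv j) k then \<phi> (k - 1) x j else 0) = \<phi> k x j"
          "\<tau> (k - 1) = Backward \<Longrightarrow> (if covers (iv j) (k - 1) \<and> covers (iv j) k then \<phi> k x j else 0) = \<phi> (k - 1) x j"
          "\<tau> k = Forward \<Longrightarrow> (if covers (iv j) k \<and> covers (iv j) (k + 1) then \<phi> k x j else 0) = \<phi> (k + 1) x j"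
          "\<tau> k = Backward \<Longrightarrow> (if covers (iv j) k \<and> covers (iv j) (k + 1) then \<phi> (k + 1) x j else 0) = \<phi> k x j"
          using fwd[of "k - 1" x] bwd[of "k - 1" x] fwd[of k x] bwd[of k x] x j
          unfolding V k1 by (auto simp: fun_eq_iff k1 dest!: spec[of _ j])
        have H: "h x j = (if apex_covered Limit_Functor (\<tau> (k - 1)) (\<tau> k) (covers (iv j) (k - 1)) (covers (iv j) k)
            (covers (iv j) (k + 1)) then if covers (iv j) (k - 1) then \<phi> (k - 1) x j else \<phi> (k + 1) x j else 0)"
          using j by (simp add: h_def apex_covered_at_def)
        have sup: "\<phi> (k - 1) x j \<noteq> 0 \<longrightarrow> covers (iv j) (k - 1)" "\<phi> k x j \<noteq> 0 \<longrightarrow> covers (iv j) k"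
          "\<phi> (k + 1) x j \<noteq> 0 \<longrightarrow> covers (iv j) (k + 1)"
          using supp[of _ x j] x by auto
        from limit_coordinate[OF nb[OF j] sup rel H] show ?thesis using i by (auto simp: \<pi>_def)
      qed
    qed
    have "linear_between pointwise_scale X pointwise_scale L h"
    proof (rule linear_betweenI)
      show "h x \<in> L" for x by (auto simp: L h_def)
      show "h (x + y) = h x + h y" if "x \<in> X" "y \<in> X" for x y
        using linear_betweenD(2)[OF lin that] by (auto simp: h_def fun_eq_iff)
      show "h (pointwise_scale c x) = pointwise_scale c (h x)" if "x \<in> X" for c x
        using linear_betweenD(3)[OF lin that, of _ c] by (auto simp: h_def fun_eq_iff)
    qed
    moreover have "h' x = h x" if h': "linear_between pointwise_scale X pointwise_scale L h'"
        "\<forall>i\<in>{k - 1, k, k + 1}. \<forall>x\<in>X. \<pi> i (h' x) = \<phi> i x" and x: "x \<in> X" for h' x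
    proof
      fix j
      show "h' x j = h x j"
      proof (cases "j \<in> J \<and> ?apex_covered j")
        case True
        then have "covers (iv j) (k - 1) \<or> covers (iv j) (k + 1)"
          using apex_covered_imp[OF nb] unfolding apex_covered_at_def by blast
        moreover have "\<pi> (k - 1) (h' x) j = \<phi> (k - 1) x j" "\<pi> (k + 1) (h' x) j = \<phi> (k + 1) x j"
          using h'(2) x by simp_all
        ultimately show ?thesis using True unfolding h_def \<pi>_def by (auto split: if_splits)
      next
        case False
        have "h' x \<in> L" by (rule linear_betweenD(1)[OF h'(1) x])
        then have "h' x j = 0" using False unfolding L by blast
        then show ?thesis using False by (auto simp: h_def)
      qed
    qed
    ultimately show ?thesis unfolding V(1) using legs by (intro exI[of _ h]) blast
  qed
  ultimately show ?thesis unfolding is_limit_def by blast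
qed

lemma is_colimitI_bar_module:
  fixes iv :: "'j \<Rightarrow> nat \<times> nat" and \<tau> k J
  defines "V \<equiv> bar_module \<tau> J iv :: ('a::field, 'j \<Rightarrow> 'a) zigzag"
    and "C \<equiv> coord_space {j\<in>J. apex_covered_at Colimit_Functor \<tau> k (iv j)} :: ('j \<Rightarrow> 'a) set"
    and "\<iota> \<equiv> \<lambda>(i::nat) x j. if apex_covered_at Colimit_Functor \<tau> k (iv j) then x j else (0 :: 'a)"
  assumes fin: "finite J" and iv: "\<And>j. j \<in> J \<Longrightarrow> fst (iv j) < snd (iv j)" and k: "1 \<le> k"
  shows "is_colimit V k C \<iota>"
proof -
  let ?apex_covered = "\<lambda>j. apex_covered_at Colimit_Functor \<tau> k (iv j)"
  note nb = interval_neighbours[OF iv k]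
  have k1: "k - 1 + 1 = k" "Suc (k - 1) = k" "Suc (k - Suc 0) = k" using k by simp_all
  have V: "zz_scale V = pointwise_scale" "zz_dir V = \<tau>"
    "zz_map V i x = (\<lambda>j. if j \<in> J \<and> covers (iv j) i \<and> covers (iv j) (i + 1) then x j else 0)"
    "zz_space V i = coord_space {j\<in>J. covers (iv j) i}" for i x
    unfolding V_def by (rule bar_module_simps)+
  have C: "x \<in> C \<longleftrightarrow> (\<forall>j. x j \<noteq> 0 \<longrightarrow> j \<in> J \<and> ?apex_covered j)" for x
    unfolding C_def coord_space_def by simp
  have comm: "(\<tau> i = Forward \<longrightarrow> covers (iv j) i \<longrightarrow> covers (iv j) (i + 1)) \<and>
      (\<tau> i = Backward \<longrightarrow> covers (iv j) (i + 1) \<longrightarrow> covers (iv j) i)"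
    if "i \<in> {k - 1, k}" "j \<in> J" "?apex_covered j" for i j
    using that(1,3) nb[OF that(2)] unfolding apex_covered_at_def apex_covered_def
    by (cases "\<tau> (k - 1)"; cases "\<tau> k") (auto simp: k1)
  have "is_cocone V k C \<iota>"
    unfolding is_cocone_def
  proof (intro conjI ballI)
    show "fd_subspace (zz_scale V) C"
      unfolding V C_def by (rule fd_subspace_coord_space) (use fin in simp)
    show "linear_between (zz_scale V) (zz_space V i) (zz_scale V) C (\<iota> i)" for i
      by (rule linear_betweenI) (auto simp: V C coord_space_def \<iota>_def fun_eq_iff)
    show "case zz_dir V i of Forward \<Rightarrow> \<forall>x\<in>zz_space V i. \<iota> (i + 1) (zz_map V i x) = \<iota> i x
        | Backward \<Rightarrow> \<forall>x\<in>zz_space V (i + 1). \<iota> i (zz_map V i x) = \<iota> (i + 1) x"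
      if i: "i \<in> {k - 1, k}" for i
    proof (cases "\<tau> i")
      case Forward
      have "\<iota> (i + 1) (zz_map V i x) j = \<iota> i x j" if "x \<in> zz_space V i" for x j
        using comm[OF i, of j] that Forward by (cases "x j = 0") (auto simp: V coord_space_def \<iota>_def)
      then show ?thesis using Forward by (simp add: V(2) fun_eq_iff)
    next
      case Backward
      have "\<iota> i (zz_map V i x) j = \<iota> (i + 1) x j" if "x \<in> zz_space V (i + 1)" for x j
        using comm[OF i, of j] that Backward by (cases "x j = 0") (auto simp: V coord_space_def \<iota>_def)
      then show ?thesis using Backward by (simp add: V(2) fun_eq_iff)
    qed
  qed
  moreover have "\<exists>h. linear_between (zz_scale V) C (zz_scale V) X h \<and>
             (\<forall>i\<in>{k - 1, k, k + 1}. \<forall>x\<in>zz_space V i. h (\<iota> i x) = \<phi> i x) \<and>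
             (\<forall>h'. linear_between (zz_scale V) C (zz_scale V) X h' \<and>
                   (\<forall>i\<in>{k - 1, k, k + 1}. \<forall>x\<in>zz_space V i. h' (\<iota> i x) = \<phi> i x)
                   \<longrightarrow> (\<forall>x\<in>C. h' x = h x))" if cocone: "is_cocone V k X \<phi>" for X \<phi>
  proof -
    interpret vector_space "pointwise_scale :: 'a \<Rightarrow> ('j \<Rightarrow> 'a) \<Rightarrow> 'j \<Rightarrow> 'a"
      by (rule vector_space_pointwise)
    have X: "subspace X" using cocone unfolding is_cocone_def V(1) by (blast intro: fd_subspaceD)
    define u where "u j = (if ?apex_covered j
      then if covers (iv j) (k - 1) then \<phi> (k - 1) (unit_vec j) else \<phi> (k + 1) (unit_vec j) else 0)" for j
    define h where "h y = (\<Sum>j\<in>J. pointwise_scale (y j) (u j))" for y :: "'j \<Rightarrow> 'a"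
    have lin: "linear_between pointwise_scale (zz_space V i) pointwise_scale X (\<phi> i)"
      if "i \<in> {k - 1, k, k + 1}" for i
      using cocone that unfolding is_cocone_def V(1) by blast
    have fwd: "\<phi> (i + 1) (zz_map V i x) = \<phi> i x"
      if "i \<in> {k - 1, k}" "\<tau> i = Forward" "x \<in> zz_space V i" for i x
      using cocone that unfolding is_cocone_def V(2) by (auto dest!: bspec[of _ _ i])
    have bwd: "\<phi> i (zz_map V i x) = \<phi> (i + 1) x"
      if "i \<in> {k - 1, k}" "\<tau> i = Backward" "x \<in> zz_space V (i + 1)" for i x
      using cocone that unfolding is_cocone_def V(2) by (auto dest!: bspec[of _ _ i])
    have subV: "subspace (zz_space V i)" for i unfolding V by (rule subspace_coord_space)
    have \<phi>0: "\<phi> i 0 = 0" if "i \<in> {k - 1, k, k + 1}" for i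
      using linear_betweenD(3)[OF lin[OF that] subspace_0[OF subV], of 0] by (simp add: zero_fun_def)
    have unit: "unit_vec j \<in> zz_space V i" if "j \<in> J" "covers (iv j) i" for i j
      unfolding V by (rule unit_vec_in_coord_space) (use that in simp)
    have map_unit: "zz_map V i (unit_vec j) = (if covers (iv j) i \<and> covers (iv j) (i + 1) then unit_vec j else 0)"
      if "j \<in> J" for i j using that unfolding V_def bar_map_unit_vec by simp
    have val: "u j = \<phi> i (unit_vec j)" if j: "j \<in> J" and i: "i \<in> {k - 1, k, k + 1}" "covers (iv j) i" for i j
    proof -
      let ?A = "\<phi> (k - 1) (unit_vec j)" and ?M = "\<phi> k (unit_vec j)" and ?C = "\<phi> (k + 1) (unit_vec j)"
      have rel: "\<tau> (k - 1) = Forward \<Longrightarrow> covers (iv j) (k - 1) \<Longrightarrow> (if covers (iv j) k then ?M else 0) = ?A"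
        "\<tau> (k - 1) = Backward \<Longrightarrow> covers (iv j) k \<Longrightarrow> (if covers (iv j) (k - 1) then ?A else 0) = ?M"
        "\<tau> k = Forward \<Longrightarrow> covers (iv j) k \<Longrightarrow> (if covers (iv j) (k + 1) then ?C else 0) = ?M"
        "\<tau> k = Backward \<Longrightarrow> covers (iv j) (k + 1) \<Longrightarrow> (if covers (iv j) k then ?M else 0) = ?C"
      proof -
        assume "\<tau> (k - 1) = Forward" "covers (iv j) (k - 1)"
        then show "(if covers (iv j) k then ?M else 0) = ?A"
          using fwd[of "k - 1" "unit_vec j"] unit[OF j, of "k - 1"] map_unit[OF j, of "k - 1"] \<phi>0[of k]
          by (simp add: k1 split: if_splits)
      next
        assume "\<tau> (k - 1) = Backward" "covers (iv j) k"
        then show "(if covers (iv j) (k - 1) then ?A else 0) = ?M"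
          using bwd[of "k - 1" "unit_vec j"] unit[OF j, of k] map_unit[OF j, of "k - 1"] \<phi>0[of "k - 1"]
          by (simp add: k1 split: if_splits)
      next
        assume "\<tau> k = Forward" "covers (iv j) k"
        then show "(if covers (iv j) (k + 1) then ?C else 0) = ?M"
          using fwd[of k "unit_vec j"] unit[OF j, of k] map_unit[OF j, of k] \<phi>0[of "k + 1"]
          by (simp split: if_splits)
      next
        assume "\<tau> k = Backward" "covers (iv j) (k + 1)"
        then show "(if covers (iv j) k then ?M else 0) = ?C"
          using bwd[of k "unit_vec j"] unit[OF j, of "k + 1"] map_unit[OF j, of k] \<phi>0[of k]
          by (simp split: if_splits)
      qed
      have H: "u j = (if apex_covered Colimit_Functor (\<tau> (k - 1)) (\<tau> k) (covers (iv j) (k - 1)) (covers (iv j) k)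
          (covers (iv j) (k + 1)) then if covers (iv j) (k - 1) then ?A else ?C else 0)"
        by (simp add: u_def apex_covered_at_def)
      from colimit_coordinate[OF nb[OF j] rel H] show ?thesis using i by auto
    qed
    have outer: "covers (iv j) (k - 1) \<or> covers (iv j) (k + 1)"
      if "j \<in> J" "?apex_covered j" for j
      using apex_covered_imp[OF nb[OF that(1)]] that(2) unfolding apex_covered_at_def by blast
    have uX: "u j \<in> X" if j: "j \<in> J" for j
    proof (cases "?apex_covered j")
      case True
      then consider "covers (iv j) (k - 1)" | "covers (iv j) (k + 1)" using outer[OF j] by blast
      then show ?thesis
      proof cases
        case 1
        then show ?thesis using val[OF j _ 1] linear_betweenD(1)[OF lin unit[OF j 1]] by simp
      next
        case 2
        then show ?thesis using val[OF j _ 2] linear_betweenD(1)[OF lin unit[OF j 2]] by simp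
      qed
    next
      case False
      then show ?thesis using subspace_0[OF X] by (simp add: u_def)
    qed
    have legs: "h (\<iota> i x) = \<phi> i x" if i: "i \<in> {k - 1, k, k + 1}" and x: "x \<in> zz_space V i" for i x
    proof -
      let ?S = "{j\<in>J. covers (iv j) i}"
      have "h (\<iota> i x) = (\<Sum>j\<in>J. pointwise_scale (x j) (u j))"
        unfolding h_def by (rule sum.cong) (auto simp: \<iota>_def u_def)
      also have "\<dots> = (\<Sum>j\<in>?S. pointwise_scale (x j) (\<phi> i (unit_vec j)))"
      proof (rule sum.mono_neutral_cong_right[OF fin])
        show "\<forall>j\<in>J - ?S. pointwise_scale (x j) (u j) = 0"
          using x unfolding V coord_space_def by (auto simp: fun_eq_iff)
        show "pointwise_scale (x j) (u j) = pointwise_scale (x j) (\<phi> i (unit_vec j))" if "j \<in> ?S" for j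
          using val[OF _ i] that by simp
      qed auto
      also have "\<dots> = \<phi> i (\<Sum>j\<in>?S. pointwise_scale (x j) (unit_vec j))"
        by (rule linear_between_sum[OF vector_space_pointwise vector_space_pointwise subV lin[OF i], symmetric])
          (use unit in blast)
      also have "(\<Sum>j\<in>?S. pointwise_scale (x j) (unit_vec j)) = x"
        by (rule coord_space_expand[symmetric]) (use fin x in \<open>simp_all add: V\<close>)
      finally show ?thesis .
    qed
    have "linear_between pointwise_scale C pointwise_scale X h"
    proof (rule linear_betweenI)
      show "h x \<in> X" for x
        unfolding h_def by (intro subspace_sum[OF X] subspace_scale[OF X] uX)
      show "h (x + y) = h x + h y" for x y
        unfolding h_def by (simp add: sum.distrib[symmetric] scale_left_distrib[symmetric])
      show "h (pointwise_scale c x) = pointwise_scale c (h x)" for c x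
        unfolding h_def scale_sum_right by simp
    qed
    moreover have "h' y = h y" if h': "linear_between pointwise_scale C pointwise_scale X h'"
        "\<forall>i\<in>{k - 1, k, k + 1}. \<forall>x\<in>zz_space V i. h' (\<iota> i x) = \<phi> i x" and y: "y \<in> C" for h' y
    proof -
      let ?S = "{j\<in>J. ?apex_covered j}"
      have unitC: "unit_vec j \<in> C" if "j \<in> ?S" for j
        unfolding C_def by (rule unit_vec_in_coord_space[OF that])
      have "y = (\<Sum>j\<in>?S. pointwise_scale (y j) (unit_vec j))"
        by (rule coord_space_expand) (use fin y in \<open>simp_all add: C_def\<close>)
      then have "h' y = h' (\<Sum>j\<in>?S. pointwise_scale (y j) (unit_vec j))" by (rule arg_cong)
      also have "\<dots> = (\<Sum>j\<in>?S. pointwise_scale (y j) (h' (unit_vec j)))"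
        by (rule linear_between_sum[OF vector_space_pointwise vector_space_pointwise _ h'(1) unitC])
          (simp add: C_def subspace_coord_space)
      also have "\<dots> = (\<Sum>j\<in>?S. pointwise_scale (y j) (u j))"
      proof (rule sum.cong[OF HOL.refl])
        fix j assume j: "j \<in> ?S"
        then obtain i where i: "i \<in> {k - 1, k, k + 1}" "covers (iv j) i" using outer by blast
        have "\<iota> i (unit_vec j) = unit_vec j" using j by (auto simp: \<iota>_def unit_vec_def fun_eq_iff)
        then have "h' (unit_vec j) = \<phi> i (unit_vec j)" using h'(2) i unit[of j i] j by fastforce
        then show "pointwise_scale (y j) (h' (unit_vec j)) = pointwise_scale (y j) (u j)"
          using val[of j i] i j by simp
      qed
      also have "\<dots> = h y"
        unfolding h_def using fin by (intro sum.mono_neutral_left) (auto simp: u_def fun_eq_iff)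
      finally show ?thesis .
    qed
    ultimately show ?thesis unfolding V(1) using legs by (intro exI[of _ h]) blast
  qed
  ultimately show ?thesis unfolding is_colimit_def by blast
qed

section \<open>Reflections of sums of intervals\<close>

lemma linear_between_id: "linear_between s A s A (\<lambda>x. x)"
  by (simp add: linear_between_def)

lemma bij_betw_of_mutual_inverses:
  "(\<And>x. x \<in> A \<Longrightarrow> f x \<in> B) \<Longrightarrow> (\<And>y. y \<in> B \<Longrightarrow> g y \<in> A) \<Longrightarrow>
   (\<And>x. x \<in> A \<Longrightarrow> g (f x) = x) \<Longrightarrow> (\<And>y. y \<in> B \<Longrightarrow> f (g y) = y) \<Longrightarrow> bij_betw f A B"
  by (rule bij_betw_byWitness[where f' = g]) auto

lemma is_limit_mediator:
  assumes "is_limit V k L \<pi>" "is_cone V k X \<phi>"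
  obtains h where "linear_between (zz_scale V) X (zz_scale V) L h"
    "\<And>i x. i \<in> {k - 1, k, k + 1} \<Longrightarrow> x \<in> X \<Longrightarrow> \<pi> i (h x) = \<phi> i x"
  using assms unfolding is_limit_def by (elim conjE allE[of _ X] allE[of _ \<phi>] impE exE) blast+

text \<open>
  Mediating maps are unique, and the identity is one from a limit to itself.
\<close>

lemma is_limit_endomorphism:
  assumes L: "is_limit V k L \<pi>" and h: "linear_between (zz_scale V) L (zz_scale V) L h"
    "\<forall>i\<in>{k - 1, k, k + 1}. \<forall>x\<in>L. \<pi> i (h x) = \<pi> i x" and x: "x \<in> L"
  shows "h x = x"
proof -
  have "is_cone V k L \<pi>" using L unfolding is_limit_def by blast
  then obtain w where w: "\<forall>h'. linear_between (zz_scale V) L (zz_scale V) L h' \<and>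
      (\<forall>i\<in>{k - 1, k, k + 1}. \<forall>x\<in>L. \<pi> i (h' x) = \<pi> i x) \<longrightarrow> (\<forall>x\<in>L. h' x = w x)"
    using L unfolding is_limit_def by blast
  have "h x = w x" using w[rule_format, of h x] h x by blast
  moreover have "x = w x" using w[rule_format, of "\<lambda>x. x" x] linear_between_id x by blast
  ultimately show ?thesis by simp
qed

lemma is_colimit_mediator:
  assumes "is_colimit V k C \<iota>" "is_cocone V k X \<phi>"
  obtains h where "linear_between (zz_scale V) C (zz_scale V) X h"
    "\<And>i x. i \<in> {k - 1, k, k + 1} \<Longrightarrow> x \<in> zz_space V i \<Longrightarrow> h (\<iota> i x) = \<phi> i x"
  using assms unfolding is_colimit_def by (elim conjE allE[of _ X] allE[of _ \<phi>] impE exE) blast+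

lemma is_colimit_endomorphism:
  assumes C: "is_colimit V k C \<iota>" and h: "linear_between (zz_scale V) C (zz_scale V) C h"
    "\<forall>i\<in>{k - 1, k, k + 1}. \<forall>x\<in>zz_space V i. h (\<iota> i x) = \<iota> i x" and x: "x \<in> C"
  shows "h x = x"
proof -
  have "is_cocone V k C \<iota>" using C unfolding is_colimit_def by blast
  then obtain w where w: "\<forall>h'. linear_between (zz_scale V) C (zz_scale V) C h' \<and>
      (\<forall>i\<in>{k - 1, k, k + 1}. \<forall>x\<in>zz_space V i. h' (\<iota> i x) = \<iota> i x) \<longrightarrow> (\<forall>x\<in>C. h' x = w x)"
    using C unfolding is_colimit_def by blast
  have "h x = w x" using w[rule_format, of h x] h x by blast
  moreover have "x = w x" using w[rule_format, of "\<lambda>x. x" x] linear_between_id x by blast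
  ultimately show ?thesis by simp
qed

lemma limit_unique:
  assumes L: "is_limit V k L \<pi>" and L': "is_limit V k L' \<pi>'"
  obtains h where "linear_between (zz_scale V) L (zz_scale V) L' h" "bij_betw h L L'"
    "\<And>i x. i \<in> {k - 1, k, k + 1} \<Longrightarrow> x \<in> L \<Longrightarrow> \<pi>' i (h x) = \<pi> i x"
proof -
  have c: "is_cone V k L \<pi>" and c': "is_cone V k L' \<pi>'"
    using L L' unfolding is_limit_def by blast+
  obtain h where h: "linear_between (zz_scale V) L (zz_scale V) L' h"
    "\<And>i x. i \<in> {k - 1, k, k + 1} \<Longrightarrow> x \<in> L \<Longrightarrow> \<pi>' i (h x) = \<pi> i x"
    by (rule is_limit_mediator[OF L' c]) blast
  obtain g where g: "linear_between (zz_scale V) L' (zz_scale V) L g"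
    "\<And>i x. i \<in> {k - 1, k, k + 1} \<Longrightarrow> x \<in> L' \<Longrightarrow> \<pi> i (g x) = \<pi>' i x"
    by (rule is_limit_mediator[OF L c']) blast
  note hL = linear_betweenD(1)[OF h(1)] and gL = linear_betweenD(1)[OF g(1)]
  have gh: "g (h x) = x" if "x \<in> L" for x
    by (rule is_limit_endomorphism[OF L linear_between_compose[OF h(1) g(1)] _ that])
      (use g(2) h(2) hL in simp)
  have hg: "h (g x) = x" if "x \<in> L'" for x
    by (rule is_limit_endomorphism[OF L' linear_between_compose[OF g(1) h(1)] _ that])
      (use g(2) h(2) gL in simp)
  show thesis by (rule that[OF h(1) bij_betw_of_mutual_inverses[OF hL gL gh hg] h(2)])
qed

lemma colimit_unique:
  assumes C: "is_colimit V k C \<iota>" and C': "is_colimit V k C' \<iota>'"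
  obtains h where "linear_between (zz_scale V) C (zz_scale V) C' h" "bij_betw h C C'"
    "\<And>i x. i \<in> {k - 1, k, k + 1} \<Longrightarrow> x \<in> zz_space V i \<Longrightarrow> h (\<iota> i x) = \<iota>' i x"
proof -
  have c: "is_cocone V k C \<iota>" and c': "is_cocone V k C' \<iota>'"
    using C C' unfolding is_colimit_def by blast+
  obtain h where h: "linear_between (zz_scale V) C (zz_scale V) C' h"
    "\<And>i x. i \<in> {k - 1, k, k + 1} \<Longrightarrow> x \<in> zz_space V i \<Longrightarrow> h (\<iota> i x) = \<iota>' i x"
    by (rule is_colimit_mediator[OF C c']) blast
  obtain g where g: "linear_between (zz_scale V) C' (zz_scale V) C g"
    "\<And>i x. i \<in> {k - 1, k, k + 1} \<Longrightarrow> x \<in> zz_space V i \<Longrightarrow> g (\<iota>' i x) = \<iota> i x"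
    by (rule is_colimit_mediator[OF C' c]) blast
  note hC = linear_betweenD(1)[OF h(1)] and gC = linear_betweenD(1)[OF g(1)]
  have gh: "g (h x) = x" if "x \<in> C" for x
    by (rule is_colimit_endomorphism[OF C linear_between_compose[OF h(1) g(1)] _ that])
      (use g(2) h(2) in simp)
  have hg: "h (g x) = x" if "x \<in> C'" for x
    by (rule is_colimit_endomorphism[OF C' linear_between_compose[OF g(1) h(1)] _ that])
      (use g(2) h(2) in simp)
  show thesis by (rule that[OF h(1) bij_betw_of_mutual_inverses[OF hC gC gh hg] h(2)])
qed

lemma coord_spaceD: "x \<in> coord_space S \<Longrightarrow> x j \<noteq> 0 \<Longrightarrow> j \<in> S"
  unfolding coord_space_def by blast

text \<open>
  The limit and the colimit that a reflection functor uses are chosen arbitrarily.  This transports the structure along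
  an isomorphism \<open>h\<close> from the coordinate space of the explicit one to the chosen apex \<open>A\<close>; an arrow
  points away from \<open>k\<close> for a limit and towards \<open>k\<close> for a colimit.
\<close>

lemma bar_module_replace_apex:
  fixes iv :: "'j \<Rightarrow> nat \<times> nat" and \<tau> J k u
  defines "V \<equiv> bar_module \<tau> J iv :: ('a::field, 'j \<Rightarrow> 'a) zigzag"
    and "L \<equiv> coord_space {j\<in>J. apex_covered_at u \<tau> k (iv j)} :: ('j \<Rightarrow> 'a) set"
  assumes iv: "\<And>j. j \<in> J \<Longrightarrow> fst (iv j) < snd (iv j)" and k: "1 \<le> k"
    and h: "linear_between pointwise_scale L pointwise_scale A h" "bij_betw h L A"
    and m1: "\<And>x. p = Backward \<Longrightarrow> x \<in> L \<Longrightarrow> m1 (h x) = (\<lambda>j. if covers (iv j) (k - 1) then x j else 0)"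
      "\<And>x. p = Forward \<Longrightarrow> x \<in> zz_space V (k - 1) \<Longrightarrow> m1 x = h (\<lambda>j. if apex_covered_at u \<tau> k (iv j) then x j else 0)"
    and m2: "\<And>x. q = Forward \<Longrightarrow> x \<in> L \<Longrightarrow> m2 (h x) = (\<lambda>j. if covers (iv j) (k + 1) then x j else 0)"
      "\<And>x. q = Backward \<Longrightarrow> x \<in> zz_space V (k + 1) \<Longrightarrow> m2 x = h (\<lambda>j. if apex_covered_at u \<tau> k (iv j) then x j else 0)"
  shows "zz_iso n (bar_module (\<tau>(k - 1 := p, k := q)) J (\<lambda>j. reflect_bar u \<tau> k (iv j)) :: ('a, 'j \<Rightarrow> 'a) zigzag)
    (V\<lparr>zz_space := (zz_space V)(k := A), zz_dir := (zz_dir V)(k - 1 := p, k := q),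
       zz_map := (zz_map V)(k - 1 := m1, k := m2)\<rparr>)"
    (is "zz_iso n ?B ?W")
proof -
  let ?apex_covered = "\<lambda>j. apex_covered_at u \<tau> k (iv j)"
  have kk: "k - 1 \<noteq> k" "k - 1 + 1 = k" using k by auto
  have cov: "covers (reflect_bar u \<tau> k (iv j)) i \<longleftrightarrow> (if i = k then ?apex_covered j else covers (iv j) i)"
    if "j \<in> J" for i j by (rule covers_reflect_bar[OF iv[OF that] k])
  have spaceB: "zz_space ?B i = (if i = k then L else zz_space V i)" for i
    using cov unfolding L_def V_def by (simp cong: conj_cong)
  have xL: "j \<in> J \<and> ?apex_covered j" if "x \<in> L" "x j \<noteq> 0" for x j
    using coord_spaceD[OF that(1)[unfolded L_def] that(2)] by simp
  have xV: "j \<in> J \<and> covers (iv j) i" if "x \<in> zz_space V i" "x j \<noteq> 0" for x i j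
    using coord_spaceD[OF that(1)[unfolded V_def bar_module_simps] that(2)] by simp
  have mapB: "zz_map ?B i = zz_map V i" if "i \<noteq> k - 1" "i \<noteq> k" for i
  proof (intro ext)
    fix x j
    have "i + 1 \<noteq> k" using that kk by auto
    then show "zz_map ?B i x j = zz_map V i x j" using cov[of j] that unfolding V_def by (cases "j \<in> J") simp_all
  qed
  have mapB1: "zz_map ?B (k - 1) x = (\<lambda>j. if j \<in> J \<and> covers (iv j) (k - 1) \<and> ?apex_covered j then x j else 0)" for x
    unfolding bar_module_simps kk(2) using cov kk(1) by (auto simp: fun_eq_iff)
  have mapB2: "zz_map ?B k x = (\<lambda>j. if j \<in> J \<and> ?apex_covered j \<and> covers (iv j) (k + 1) then x j else 0)" for x
    unfolding bar_module_simps using cov by (auto simp: fun_eq_iff)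
  define f where "f i = (if i = k then h else (\<lambda>x. x))" for i
  show ?thesis
  proof (rule zz_isoI[where f = f])
    show "same_type n ?B ?W" unfolding same_type_def V_def by simp
    show "linear_between (zz_scale ?B) (zz_space ?B i) (zz_scale ?W) (zz_space ?W i) (f i)" for i
      unfolding spaceB f_def using h(1) linear_between_id by (cases "i = k") (simp_all add: V_def)
    show "bij_betw (f i) (zz_space ?B i) (zz_space ?W i)" for i
      unfolding spaceB f_def using h(2) by (cases "i = k") (simp_all add: bij_betw_def)
  next
    fix i x assume "i \<in> {1..<n}" and d: "zz_dir ?B i = Forward" and x: "x \<in> zz_space ?B i"
    consider (left) "i = k - 1" "p = Forward" | (right) "i = k" "q = Forward" | (far) "i \<noteq> k - 1" "i \<noteq> k"
      using d kk by (auto split: if_splits)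
    then show "f (i + 1) (zz_map ?B i x) = zz_map ?W i (f i x)"
    proof cases
      case left
      then have x': "x \<in> zz_space V (k - 1)" using x kk unfolding spaceB by simp
      have "zz_map ?B (k - 1) x = (\<lambda>j. if ?apex_covered j then x j else 0)"
        unfolding mapB1 by (rule ext, rename_tac j, case_tac "x j = 0") (auto dest: xV[OF x'])
      then show ?thesis unfolding left(1) kk(2) f_def using m1(2)[OF left(2) x'] kk(1) by (simp del: bar_module_simps)
    next
      case right
      then have x': "x \<in> L" using x unfolding spaceB by simp
      have "zz_map ?B k x = (\<lambda>j. if covers (iv j) (k + 1) then x j else 0)"
        unfolding mapB2 by (rule ext, rename_tac j, case_tac "x j = 0") (auto dest: xL[OF x'])
      then show ?thesis unfolding right(1) f_def using m2(1)[OF right(2) x'] by (simp del: bar_module_simps)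
    next
      case far
      then have "i + 1 \<noteq> k" using kk by auto
      then show ?thesis unfolding mapB[OF far] f_def using far by simp
    qed
  next
    fix i x assume "i \<in> {1..<n}" and d: "zz_dir ?B i = Backward" and x: "x \<in> zz_space ?B (i + 1)"
    consider (left) "i = k - 1" "p = Backward" | (right) "i = k" "q = Backward" | (far) "i \<noteq> k - 1" "i \<noteq> k"
      using d kk by (auto split: if_splits)
    then show "f i (zz_map ?B i x) = zz_map ?W i (f (i + 1) x)"
    proof cases
      case left
      then have x': "x \<in> L" using x unfolding spaceB left(1) kk(2) by simp
      have "zz_map ?B (k - 1) x = (\<lambda>j. if covers (iv j) (k - 1) then x j else 0)"
        unfolding mapB1 by (rule ext, rename_tac j, case_tac "x j = 0") (auto dest: xL[OF x'])
      then show ?thesis unfolding left(1) kk(2) f_def using m1(1)[OF left(2) x'] kk(1) by (simp del: bar_module_simps)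
    next
      case right
      then have x': "x \<in> zz_space V (k + 1)" using x unfolding spaceB by simp
      have "zz_map ?B k x = (\<lambda>j. if ?apex_covered j then x j else 0)"
        unfolding mapB2 by (rule ext, rename_tac j, case_tac "x j = 0") (auto dest: xV[OF x'])
      then show ?thesis unfolding right(1) f_def using m2(2)[OF right(2) x'] by (simp del: bar_module_simps)
    next
      case far
      then have "i + 1 \<noteq> k" using kk by auto
      then show ?thesis unfolding mapB[OF far] f_def using far by simp
    qed
  qed
qed

lemma bar_module_limit_at:
  fixes iv :: "(nat \<times> nat) \<times> nat \<Rightarrow> nat \<times> nat"
  assumes fin: "finite J" and iv: "\<And>j. j \<in> J \<Longrightarrow> fst (iv j) < snd (iv j)" and k: "1 \<le> k"
  shows "zz_iso n (bar_module (\<tau>(k - 1 := Backward, k := Forward)) J (\<lambda>j. reflect_bar Limit_Functor \<tau> k (iv j))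
      :: ('a::field, 'a univ) zigzag)
    (limit_at k (bar_module \<tau> J iv :: ('a, 'a univ) zigzag))"
proof -
  let ?V = "bar_module \<tau> J iv :: ('a, 'a univ) zigzag"
  let ?L = "coord_space {j\<in>J. apex_covered_at Limit_Functor \<tau> k (iv j)} :: ('a univ) set"
  let ?\<pi> = "\<lambda>i x j. if covers (iv j) i then x j else (0 :: 'a)"
  have lim: "is_limit ?V k ?L ?\<pi>" by (rule is_limitI_bar_module[OF fin iv k])
  define c where "c = (SOME (L, \<pi>). is_limit ?V k L \<pi>)"
  have "case c of (L, \<pi>) \<Rightarrow> is_limit ?V k L \<pi>"
    unfolding c_def by (rule someI[where x = "(?L, ?\<pi>)"]) (simp add: lim)
  then obtain L \<pi> where c: "c = (L, \<pi>)" and lim': "is_limit ?V k L \<pi>" by (cases c) auto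
  obtain h where h: "linear_between pointwise_scale ?L pointwise_scale L h"
    "bij_betw h ?L L"
    "\<And>i x. i \<in> {k - 1, k, k + 1} \<Longrightarrow> x \<in> ?L \<Longrightarrow>
      \<pi> i (h x) = ?\<pi> i x"
    by (rule limit_unique[OF lim lim', unfolded bar_module_simps(1)]) blast
  show ?thesis
    unfolding limit_at_def c_def[symmetric] c Let_def split_conv
    by (rule bar_module_replace_apex[where h = h, OF iv k h(1,2)]) (simp_all add: h(3))
qed

lemma bar_module_colimit_at:
  fixes iv :: "(nat \<times> nat) \<times> nat \<Rightarrow> nat \<times> nat"
  assumes fin: "finite J" and iv: "\<And>j. j \<in> J \<Longrightarrow> fst (iv j) < snd (iv j)" and k: "1 \<le> k"
  shows "zz_iso n (bar_module (\<tau>(k - 1 := Forward, k := Backward)) J (\<lambda>j. reflect_bar Colimit_Functor \<tau> k (iv j))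
      :: ('a::field, 'a univ) zigzag)
    (colimit_at k (bar_module \<tau> J iv :: ('a, 'a univ) zigzag))"
proof -
  let ?V = "bar_module \<tau> J iv :: ('a, 'a univ) zigzag"
  let ?C = "coord_space {j\<in>J. apex_covered_at Colimit_Functor \<tau> k (iv j)} :: ('a univ) set"
  let ?\<iota> = "\<lambda>(i::nat) x j. if apex_covered_at Colimit_Functor \<tau> k (iv j) then x j else (0 :: 'a)"
  have colim: "is_colimit ?V k ?C ?\<iota>" by (rule is_colimitI_bar_module[OF fin iv k])
  define c where "c = (SOME (C, \<iota>). is_colimit ?V k C \<iota>)"
  have "case c of (C, \<iota>) \<Rightarrow> is_colimit ?V k C \<iota>"
    unfolding c_def by (rule someI[where x = "(?C, ?\<iota>)"]) (simp add: colim)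
  then obtain C \<iota> where c: "c = (C, \<iota>)" and colim': "is_colimit ?V k C \<iota>" by (cases c) auto
  obtain h where h: "linear_between pointwise_scale ?C pointwise_scale C h"
    "bij_betw h ?C C"
    "\<And>i x. i \<in> {k - 1, k, k + 1} \<Longrightarrow> x \<in> zz_space ?V i \<Longrightarrow>
      h (?\<iota> i x) = \<iota> i x"
    by (rule colimit_unique[OF colim colim', unfolded bar_module_simps(1)]) blast
  show ?thesis
    unfolding colimit_at_def c_def[symmetric] c Let_def split_conv
    by (rule bar_module_replace_apex[where h = h, OF iv k h(1,2)]) (simp_all add: h(3)[symmetric] del: bar_module_simps)
qed

lemma coord_space_empty: "coord_space {} = {0}"
  by (auto simp: coord_space_def fun_eq_iff)

lemma prepend_zero_bar_module:
  assumes "\<And>j. j \<in> J \<Longrightarrow> 1 \<le> fst (iv j)"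
  shows "prepend_zero e (bar_module \<tau> J iv) = bar_module (\<tau>(0 := e)) J iv"
proof (rule zigzag.equality)
  have none: "\<not> covers (iv j) 0" if "j \<in> J" for j using assms[OF that] by (simp add: covers_def)
  then have empty: "{j\<in>J. covers (iv j) 0} = {}" by blast
  show "zz_space (prepend_zero e (bar_module \<tau> J iv)) = zz_space (bar_module (\<tau>(0 := e)) J iv)"
    "zz_map (prepend_zero e (bar_module \<tau> J iv)) = zz_map (bar_module (\<tau>(0 := e)) J iv)"
    using none by (auto simp: prepend_zero_def fun_eq_iff coord_space_empty empty)
qed (simp_all add: prepend_zero_def)

lemma append_zero_bar_module:
  assumes "\<And>j. j \<in> J \<Longrightarrow> snd (iv j) \<le> n"
  shows "append_zero n e (bar_module \<tau> J iv) = bar_module (\<tau>(n := e)) J iv"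
proof (rule zigzag.equality)
  have none: "\<not> covers (iv j) (n + 1)" if "j \<in> J" for j using assms[OF that] by (simp add: covers_def)
  then have empty: "{j\<in>J. covers (iv j) (Suc n)} = {}" by simp
  show "zz_space (append_zero n e (bar_module \<tau> J iv)) = zz_space (bar_module (\<tau>(n := e)) J iv)"
    "zz_map (append_zero n e (bar_module \<tau> J iv)) = zz_map (bar_module (\<tau>(n := e)) J iv)"
    using none by (auto simp: append_zero_def fun_eq_iff coord_space_empty empty)
qed (simp_all add: append_zero_def)

lemma universal_at_bar_module:
  fixes iv :: "(nat \<times> nat) \<times> nat \<Rightarrow> nat \<times> nat"
  assumes "finite J" "\<And>j. j \<in> J \<Longrightarrow> fst (iv j) < snd (iv j)" "1 \<le> k"
  shows "\<exists>\<tau>'. zz_iso n (bar_module \<tau>' J (\<lambda>j. reflect_bar u \<tau> k (iv j)) :: ('a::field, 'a univ) zigzag)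
    (universal_at u k (bar_module \<tau> J iv :: ('a, 'a univ) zigzag))"
proof (cases u)
  case Limit_Functor
  then show ?thesis unfolding Limit_Functor universal_at.simps
    by (intro exI) (rule bar_module_limit_at[OF assms])
next
  case Colimit_Functor
  then show ?thesis unfolding Colimit_Functor universal_at.simps
    by (intro exI) (rule bar_module_colimit_at[OF assms])
qed

text \<open>
  At the ends, adding a zero space to a sum of intervals in \<open>{1..n}\<close> yields the same sum with another direction
  at the new arrow, so all reflections are instances of the one at an inner index.
\<close>

lemma barcode_reflect:
  assumes r: "reflection_defined n r" and D: "\<And>I. I \<in># D \<Longrightarrow> valid_bar n I \<and> fst I < snd I"
  shows "\<exists>u \<sigma> k. 1 \<le> k \<and> k \<le> n \<and>
    barcode n (reflect n r (interval_sum \<tau> D :: ('a::field, 'a univ) zigzag)) (image_mset (reflect_bar u \<sigma> k) D)"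
proof -
  let ?C = "{(x, j). j < count D x}"
  have C: "valid_bar n (fst j) \<and> fst (fst j) < snd (fst j)" if "j \<in> ?C" for j
  proof -
    have "x \<in># D" if "i < count D x" for x i
      using that by (metis not_in_iff not_less_zero)
    then show ?thesis using D that by auto
  qed
  have main: "barcode n (universal_at u k (bar_module \<sigma> ?C fst :: ('a, 'a univ) zigzag))
      (image_mset (reflect_bar u \<sigma> k) D)" if k: "1 \<le> k" "k \<le> n" for u \<sigma> k
  proof -
    obtain \<tau>' where "zz_iso n (bar_module \<tau>' ?C (\<lambda>j. reflect_bar u \<sigma> k (fst j)) :: ('a, 'a univ) zigzag)
        (universal_at u k (bar_module \<sigma> ?C fst :: ('a, 'a univ) zigzag))"
      using universal_at_bar_module[OF finite_copies, of D fst k] C k(1) by blast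
    then have "barcode n (universal_at u k (bar_module \<sigma> ?C fst :: ('a, 'a univ) zigzag))
        (image_mset (\<lambda>j. reflect_bar u \<sigma> k (fst j)) (mset_set ?C))"
      using C by (intro barcodeI[OF finite_copies]) (auto intro!: valid_bar_reflect_bar k)
    moreover have "image_mset (\<lambda>j. reflect_bar u \<sigma> k (fst j)) (mset_set ?C) =
        image_mset (reflect_bar u \<sigma> k) (image_mset fst (mset_set ?C))"
      by (simp add: multiset.map_comp comp_def)
    ultimately show ?thesis unfolding image_fst_copies by simp
  qed
  have pre: "prepend_zero e (bar_module \<tau> ?C fst :: ('a, 'a univ) zigzag) = bar_module (\<tau>(0 := e)) ?C fst" for e
    by (rule prepend_zero_bar_module) (use C in \<open>auto simp: valid_bar_def\<close>)
  have app: "append_zero n e (bar_module \<tau> ?C fst :: ('a, 'a univ) zigzag) = bar_module (\<tau>(n := e)) ?C fst" for e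
    by (rule append_zero_bar_module) (use C in \<open>auto simp: valid_bar_def\<close>)
  show ?thesis
  proof (cases r)
    case (Inner u k)
    then show ?thesis using main[of k u \<tau>] r unfolding interval_sum_eq_bar_module
      by (intro exI[of _ u] exI[of _ \<tau>] exI[of _ k]) simp
  next
    case (First u e)
    then show ?thesis using main[of 1 u "\<tau>(0 := e)"] r unfolding interval_sum_eq_bar_module
      by (intro exI[of _ u] exI[of _ "\<tau>(0 := e)"] exI[of _ 1]) (simp add: pre)
  next
    case (Last u e)
    then show ?thesis using main[of n u "\<tau>(n := e)"] r unfolding interval_sum_eq_bar_module
      by (intro exI[of _ u] exI[of _ "\<tau>(n := e)"] exI[of _ n]) (simp add: app)
  qed
qed

section \<open>Displacement along a sequence of reflections\<close>

lemma remove_simples_eq: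
  "barcode n V D \<Longrightarrow>
    remove_simples n V = interval_sum (zz_dir V) (filter_mset (\<lambda>I. fst I \<noteq> snd I) D)"
  unfolding remove_simples_def by (simp add: dgm_eqI case_prod_unfold)

lemma l1_dist_triangle: "l1_dist x z \<le> l1_dist x y + l1_dist y z"
  unfolding l1_dist_def by linarith

lemma length_le_l1_dist: "fst y = snd y \<Longrightarrow> int (snd x) \<le> int (fst x) + l1_dist x y"
  unfolding l1_dist_def by linarith

lemma reflect_seq_snoc:
  "reflect_seq n (rs @ [r]) V = remove_simples n (reflect n r (reflect_seq n rs V))"
  unfolding reflect_seq_def by simp

text \<open>
  \<open>P\<close> singles out the intervals that are never removed, and \<open>f\<close> gives their final positions.  An interval that becomes
  simple had a length of at most its displacement.
\<close>

lemma reflect_seq_displacement: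
  fixes V :: "('a::field, 'v::ab_group_add) zigzag"
  assumes V: "zigzag_module n V" and "list_all (reflection_defined n) rs"
  shows "\<exists>\<tau> f P. reflect_seq n rs V = (interval_sum \<tau> (image_mset f (filter_mset P (dgm n V))) :: ('a, 'a univ) zigzag) \<and>
    (\<forall>I\<in>#dgm n V. P I \<longrightarrow> valid_bar n (f I) \<and> fst (f I) < snd (f I) \<and> l1_dist I (f I) \<le> int (length rs)) \<and>
    (\<forall>I\<in>#dgm n V. \<not> P I \<longrightarrow> snd I \<le> fst I + length rs)"
  using assms(2)
proof (induction rs rule: rev_induct)
  case Nil
  let ?P = "\<lambda>I. fst I \<noteq> snd I"
  have bar: "barcode n V (dgm n V)" by (rule barcode_dgm[OF V])
  then have valid: "valid_bar n I" if "I \<in># dgm n V" for I using that unfolding barcode_def by blast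
  have "reflect_seq n [] V = (interval_sum (zz_dir V) (image_mset id (filter_mset ?P (dgm n V))) :: ('a, 'a univ) zigzag)"
    unfolding reflect_seq_def by (simp add: remove_simples_eq[OF bar])
  moreover have "\<forall>I\<in>#dgm n V. ?P I \<longrightarrow> valid_bar n (id I) \<and> fst (id I) < snd (id I) \<and> l1_dist I (id I) \<le> int (length ([] :: reflection list))"
    using valid by (auto simp: valid_bar_def l1_dist_def nat_less_le)
  moreover have "\<forall>I\<in>#dgm n V. \<not> ?P I \<longrightarrow> snd I \<le> fst I + length ([] :: reflection list)" by simp
  ultimately show ?case by blast
next
  case (snoc r rs)
  have rs: "list_all (reflection_defined n) rs" using snoc.prems by simp
  obtain \<tau> f P where IH: "reflect_seq n rs V = (interval_sum \<tau> (image_mset f (filter_mset P (dgm n V))) :: ('a, 'a univ) zigzag)"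
    "\<forall>I\<in>#dgm n V. P I \<longrightarrow> valid_bar n (f I) \<and> fst (f I) < snd (f I) \<and> l1_dist I (f I) \<le> int (length rs)"
    "\<forall>I\<in>#dgm n V. \<not> P I \<longrightarrow> snd I \<le> fst I + length rs"
    using snoc.IH[OF rs] by blast
  let ?D = "image_mset f (filter_mset P (dgm n V))"
  let ?R = "reflect n r (interval_sum \<tau> ?D :: ('a, 'a univ) zigzag)"
  have D: "valid_bar n I \<and> fst I < snd I" if "I \<in># ?D" for I using IH(2) that by auto
  have "reflection_defined n r" using snoc.prems by simp
  from barcode_reflect[OF this D]
  obtain u \<sigma> k where k: "1 \<le> k" "k \<le> n" and bar: "barcode n ?R (image_mset (reflect_bar u \<sigma> k) ?D)" by blast
  define g where "g I = reflect_bar u \<sigma> k (f I)" for I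
  define Q where "Q I \<longleftrightarrow> P I \<and> fst (g I) \<noteq> snd (g I)" for I
  have "reflect_seq n (rs @ [r]) V = interval_sum (zz_dir ?R) (filter_mset (\<lambda>I. fst I \<noteq> snd I) (image_mset (reflect_bar u \<sigma> k) ?D))"
    unfolding reflect_seq_snoc IH(1) by (rule remove_simples_eq[OF bar])
  also have "filter_mset (\<lambda>I. fst I \<noteq> snd I) (image_mset (reflect_bar u \<sigma> k) ?D) = image_mset g (filter_mset Q (dgm n V))"
    by (simp add: filter_mset_image_mset filter_filter_mset multiset.map_comp comp_def g_def[abs_def] Q_def[abs_def] conj_commute)
  finally have eq: "reflect_seq n (rs @ [r]) V = interval_sum (zz_dir ?R) (image_mset g (filter_mset Q (dgm n V)))" .
  have g: "valid_bar n (g I)" "l1_dist I (g I) \<le> int (length (rs @ [r]))" if I: "I \<in># dgm n V" "P I" for I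
  proof -
    have fI: "valid_bar n (f I)" "fst (f I) < snd (f I)" "l1_dist I (f I) \<le> int (length rs)"
      using IH(2) I by blast+
    show "valid_bar n (g I)" unfolding g_def by (rule valid_bar_reflect_bar[OF fI(1,2) k])
    show "l1_dist I (g I) \<le> int (length (rs @ [r]))"
      using l1_dist_triangle[of I "g I" "f I"] l1_dist_reflect_bar[OF fI(2) k(1), of u \<sigma>] fI(3)
      unfolding g_def by simp
  qed
  have "snd I \<le> fst I + length (rs @ [r])" if I: "I \<in># dgm n V" "\<not> Q I" for I
  proof (cases "P I")
    case True
    then have "fst (g I) = snd (g I)" using I(2) unfolding Q_def by simp
    then show ?thesis using length_le_l1_dist[of "g I" I] g(2)[OF I(1) True] by linarith
  next
    case False
    then show ?thesis using IH(3) I(1) by auto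
  qed
  moreover have "valid_bar n (g I) \<and> fst (g I) < snd (g I) \<and> l1_dist I (g I) \<le> int (length (rs @ [r]))"
    if I: "I \<in># dgm n V" "Q I" for I
    using g[OF I(1)] I(2) unfolding Q_def valid_bar_def by auto
  ultimately show ?case using eq by blast
qed

section \<open>The bottleneck distance is bounded by the reflection distance\<close>

lemma l1_dist_sym: "l1_dist x y = l1_dist y x"
  unfolding l1_dist_def by simp

theorem theorem1p1:
  fixes n :: nat
    and V :: "('a::field, 'v::ab_group_add) zigzag"
    and W :: "('a, 'w::ab_group_add) zigzag"
  assumes "zigzag_module n V" and "zigzag_module n W"
  shows "ereal (bottleneck_dist 1 (dgm_points n V) (dgm_points n W)) \<le> reflection_dist 1 n V W"
  unfolding reflection_dist_def
proof (rule Inf_greatest, safe)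
  fix rs rs'
  assume rs: "list_all (reflection_defined n) rs" "list_all (reflection_defined n) rs'"
    and sub: "sub_equiv n (reflect_seq n rs V) W" "sub_equiv n (reflect_seq n rs' W) V"
  define r where "r = max (length rs) (length rs')"
  have cost: "max (reflection_cost 1 rs) (reflection_cost 1 rs') = real r"
    unfolding reflection_cost_def r_def by auto
  let ?D = "dgm n V" and ?E = "dgm n W"
  obtain \<tau> f P where f: "reflect_seq n rs V = (interval_sum \<tau> (image_mset f (filter_mset P ?D)) :: ('a, 'a univ) zigzag)"
    "\<forall>I\<in>#?D. P I \<longrightarrow> valid_bar n (f I) \<and> fst (f I) < snd (f I) \<and> l1_dist I (f I) \<le> int (length rs)"
    "\<forall>I\<in>#?D. \<not> P I \<longrightarrow> snd I \<le> fst I + length rs"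
    using reflect_seq_displacement[OF assms(1) rs(1)] by blast
  obtain \<sigma> g Q where g: "reflect_seq n rs' W = (interval_sum \<sigma> (image_mset g (filter_mset Q ?E)) :: ('a, 'a univ) zigzag)"
    "\<forall>I\<in>#?E. Q I \<longrightarrow> valid_bar n (g I) \<and> fst (g I) < snd (g I) \<and> l1_dist I (g I) \<le> int (length rs')"
    "\<forall>I\<in>#?E. \<not> Q I \<longrightarrow> snd I \<le> fst I + length rs'"
    using reflect_seq_displacement[OF assms(2) rs(2)] by blast
  have fsub: "image_mset f (filter_mset P ?D) \<subseteq># ?E"
    by (rule dgm_mono_of_sub_equiv[OF _ assms(2) sub(1)[unfolded f(1)]]) (use f(2) in auto)
  have gsub: "image_mset g (filter_mset Q ?E) \<subseteq># ?D"
    by (rule dgm_mono_of_sub_equiv[OF _ assms(1) sub(2)[unfolded g(1)]]) (use g(2) in auto)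
  obtain M where M: "is_matching M ?D ?E"
    "\<forall>(s, t)\<in>#M. (P s \<and> t = f s) \<or> (Q t \<and> s = g t)"
    "\<forall>s\<in>#?D - image_mset fst M. \<not> P s" "\<forall>t\<in>#?E - image_mset snd M. \<not> Q t"
    using matching_of_partial_maps[OF fsub gsub] by blast
  have validD: "valid_bar n I" if "I \<in># ?D" for I
    using barcode_dgm[OF assms(1)] that unfolding barcode_def by blast
  have validE: "valid_bar n I" if "I \<in># ?E" for I
    using barcode_dgm[OF assms(2)] that unfolding barcode_def by blast
  have "bottleneck_dist 1 (dgm_points n V) (dgm_points n W) \<le> real r"
    unfolding dgm_points_def
  proof (rule bottleneck_dist_le[OF M(1)])
    fix s t assume st: "(s, t) \<in># M"
    have "s \<in># image_mset fst M" "t \<in># image_mset snd M" using st by force+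
    then have mem: "s \<in># ?D" "t \<in># ?E" 
      using mset_subset_eqD[of "image_mset fst M" ?D] mset_subset_eqD[of "image_mset snd M" ?E] M(1)
      unfolding is_matching_def by blast+
    have "(P s \<and> t = f s) \<or> (Q t \<and> s = g t)" using M(2) st by blast
    then show "l1_dist s t \<le> int r"
    proof
      assume "P s \<and> t = f s"
      then have "l1_dist s t \<le> int (length rs)" using f(2) mem(1) by blast
      then show ?thesis unfolding r_def by linarith
    next
      assume "Q t \<and> s = g t"
      then have "l1_dist t s \<le> int (length rs')" using g(2) mem(2) by blast
      then show ?thesis unfolding r_def l1_dist_sym[of s t] by linarith
    qed
  next
    fix b d assume bd: "(b, d) \<in># ?D - image_mset fst M"
    then have "(b, d) \<in># ?D" "\<not> P (b, d)" using M(3) by (auto dest: in_diffD)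
    then show "d \<le> b + r \<and> b \<le> d"
      using bspec[OF f(3), of "(b, d)"] validD[of "(b, d)"] unfolding r_def valid_bar_def by simp
  next
    fix b d assume bd: "(b, d) \<in># ?E - image_mset snd M"
    then have "(b, d) \<in># ?E" "\<not> Q (b, d)" using M(4) by (auto dest: in_diffD)
    then show "d \<le> b + r \<and> b \<le> d"
      using bspec[OF g(3), of "(b, d)"] validE[of "(b, d)"] unfolding r_def valid_bar_def by simp
  qed
  then show "ereal (bottleneck_dist 1 (dgm_points n V) (dgm_points n W))
      \<le> ereal (max (reflection_cost 1 rs) (reflection_cost 1 rs'))"
    unfolding cost by simp
qed

end
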